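(* Let $(M,\omega)$ be a symplectic manifold conical at infinity, with collar $\Sigma\times[1,\infty)$, contact form $\alpha$ on $\Sigma$ with Reeb vector field $Y$, and radial coordinate $R$. Let $H:M\to\mathbb{R}$ be a Hamiltonian which for large $R$ has the form $$H(y,R)=f(y)\,R,\qquad (y,R)\in\Sigma\times(1,\infty),$$ where $f:\Sigma\to\mathbb{R}$ satisfies: (i) $f$ is invariant under the Reeb flow, i.e. $df(Y)=0$; (ii) $f\ge 0$ (condition (ii) can be omitted if $d\beta=0$). Let $J$ be an $\omega$-compatible almost complex structure of contact type at infinity. Then the $R$-coordinate of any Floer solution $u:S\to M$, i.e. any solution of $(du-X_H\otimes\beta)^{0,1}=0$, is bounded a priori in terms of the $R$-coordinates of the asymptotic conditions of $u$.
   Context: A symplectic manifold $(M,\omega)$ is conical at infinity if outside a bounded domain $M_0\subset M$ there is a symplectomorphism $(M\setminus M_0,\omega)\cong(\Sigma\times[1,\infty),d(R\alpha))$, where $(\Sigma,\alpha)$ is a contact manifold and $R$ is the coordinate on $[1,\infty)$ ($\omega$ need not be globally exact). The Reeb vector field $Y$ is defined by $\alpha(Y)=1$, $d\alpha(Y,\cdot)=0$; the Liouville vector field on the collar is $Z=R\partial_R$. An $\omega$-compatible almost complex structure $J$ is of contact type at infinity if $JZ=Y$ for large $R$. $S$ is a punctured Riemann surface with complex structure $j$, and $\beta$ is a 1-form on $S$ with $d\beta\le 0$ which near each puncture is a constant positive multiple of $dt$ in cylindrical coordinates $(s,t)$. The Hamiltonian vector field $X_H$ is defined by $\omega(\cdot,X_H)=dH$,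 and the $(0,1)$-part is taken with respect to $J$. The asymptotic conditions of a Floer solution $u$ are the Hamiltonian orbits to which $u$ converges at the punctures. *)

theory Defs
  imports "HOL-Analysis.Analysis"
begin

text \<open>
  The libraries have no smooth manifolds, so the basic notions are set up here.
  A manifold modelled on a Euclidean space \<open>'e\<close> is the universe of a type \<open>'m\<close>
  together with an atlas indexed by the points of the manifold, where the chart \<open>c p\<close> is defined
  near \<open>p\<close>. (Any atlas contains such a family, and the family determines the smooth structure.)
  The tangent space at \<open>p\<close> is \<open>'e\<close>, a tangent vector being given by its components in the chart
  \<open>c p\<close>. So vector fields, 1-forms, 2-forms and endomorphism fields are families
  \<open>'m \<Rightarrow> 'e\<close>, \<open>'m \<Rightarrow> 'e \<Rightarrow> real\<close>, \<open>'m \<Rightarrow> 'e \<Rightarrow> 'e \<Rightarrow> real\<close>, \<open>'m \<Rightarrow> 'e \<Rightarrow> 'e\<close>; as \<open>c p\<close> need not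
  vary continuously with \<open>p\<close>, their smoothness is tested on representatives in a fixed chart.
\<close>

subsection \<open>Smooth maps between Euclidean spaces\<close>

fun Ck_on :: "nat \<Rightarrow> 'a::real_normed_vector set \<Rightarrow> ('a \<Rightarrow> 'b::real_normed_vector) \<Rightarrow> bool" where
  "Ck_on 0 U f \<longleftrightarrow> continuous_on U f"
| "Ck_on (Suc k) U f \<longleftrightarrow>
     (\<forall>x\<in>U. f differentiable (at x)) \<and> (\<forall>v. Ck_on k U (\<lambda>x. frechet_derivative f (at x) v))"

text \<open>Only used for open \<open>U\<close>.\<close>

definition smooth_on :: "'a::real_normed_vector set \<Rightarrow> ('a \<Rightarrow> 'b::real_normed_vector) \<Rightarrow> bool" where
  "smooth_on U f \<longleftrightarrow> (\<forall>k. Ck_on k U f)"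

subsection \<open>Manifolds and smooth maps\<close>

record ('m, 'e) chart =
  cdom :: "'m set"
  cmap :: "'m \<Rightarrow> 'e"
  cinv :: "'e \<Rightarrow> 'm"

definition chart_at ::
    "'m::topological_space \<Rightarrow> ('m, 'e::euclidean_space) chart \<Rightarrow> bool" where
  "chart_at p C \<longleftrightarrow> p \<in> cdom C \<and> open (cdom C) \<and> open (cmap C ` cdom C) \<and>
     homeomorphism (cdom C) (cmap C ` cdom C) (cmap C) (cinv C)"

definition smooth_atlas ::
    "('m::topological_space \<Rightarrow> ('m, 'e::euclidean_space) chart) \<Rightarrow> bool" where
  "smooth_atlas c \<longleftrightarrow> (\<forall>p. chart_at p (c p)) \<and>
     (\<forall>p q. smooth_on (cmap (c p) ` (cdom (c p) \<inter> cdom (c q))) (cmap (c q) \<circ> cinv (c p)))"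

definition complex_atlas :: "('r::topological_space \<Rightarrow> ('r, complex) chart) \<Rightarrow> bool" where
  "complex_atlas c \<longleftrightarrow> (\<forall>p. chart_at p (c p)) \<and>
     (\<forall>p q. (cmap (c q) \<circ> cinv (c p)) holomorphic_on (cmap (c p) ` (cdom (c p) \<inter> cdom (c q))))"

definition euclid :: "'e::euclidean_space \<Rightarrow> ('e, 'e) chart" where
  "euclid p = \<lparr>cdom = UNIV, cmap = id, cinv = id\<rparr>"

definition prod_atlas ::
    "('a \<Rightarrow> ('a, 'e) chart) \<Rightarrow> ('b \<Rightarrow> ('b, 'f) chart) \<Rightarrow> 'a \<times> 'b \<Rightarrow> ('a \<times> 'b, 'e \<times> 'f) chart" where
  "prod_atlas c d p =
     \<lparr>cdom = cdom (c (fst p)) \<times> cdom (d (snd p)),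
      cmap = map_prod (cmap (c (fst p))) (cmap (d (snd p))),
      cinv = map_prod (cinv (c (fst p))) (cinv (d (snd p)))\<rparr>"

definition msmooth_open ::
    "('m::topological_space \<Rightarrow> ('m, 'e::euclidean_space) chart) \<Rightarrow>
     ('n::topological_space \<Rightarrow> ('n, 'f::euclidean_space) chart) \<Rightarrow> 'm set \<Rightarrow> ('m \<Rightarrow> 'n) \<Rightarrow> bool" where
  "msmooth_open c d U F \<longleftrightarrow> open U \<and> continuous_on U F \<and>
     (\<forall>p q. smooth_on (cmap (c p) ` (cdom (c p) \<inter> U \<inter> F -` cdom (d q)))
                      (cmap (d q) \<circ> F \<circ> cinv (c p)))"

text \<open>On an arbitrary subset, e.g. a submanifold with boundary, smooth means locally the
  restriction of a smooth map defined on an open set.\<close>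

definition msmooth_on ::
    "('m::topological_space \<Rightarrow> ('m, 'e::euclidean_space) chart) \<Rightarrow>
     ('n::topological_space \<Rightarrow> ('n, 'f::euclidean_space) chart) \<Rightarrow> 'm set \<Rightarrow> ('m \<Rightarrow> 'n) \<Rightarrow> bool" where
  "msmooth_on c d A F \<longleftrightarrow>
     (\<forall>p\<in>A. \<exists>U G. p \<in> U \<and> msmooth_open c d U G \<and> (\<forall>x\<in>U \<inter> A. G x = F x))"

text \<open>The differential \<open>dF(p)\<close>, from the tangent space at \<open>p\<close> to that at \<open>F p\<close>. For real-valued
  \<open>F\<close> and \<open>d = euclid\<close> this is the 1-form \<open>dF\<close>.\<close>

definition mderiv ::
    "('m \<Rightarrow> ('m, 'e::euclidean_space) chart) \<Rightarrow> ('n \<Rightarrow> ('n, 'f::euclidean_space) chart) \<Rightarrow>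
     ('m \<Rightarrow> 'n) \<Rightarrow> 'm \<Rightarrow> 'e \<Rightarrow> 'f" where
  "mderiv c d F p =
     frechet_derivative (cmap (d (F p)) \<circ> F \<circ> cinv (c p)) (at (cmap (c p) p))"

subsection \<open>Differential forms\<close>

text \<open>Representatives in the chart \<open>c q\<close>, i.e. pullbacks under \<open>cinv (c q)\<close>.\<close>

definition rep1 ::
    "('m \<Rightarrow> ('m, 'e::euclidean_space) chart) \<Rightarrow> 'm \<Rightarrow> ('m \<Rightarrow> 'e \<Rightarrow> real) \<Rightarrow> 'e \<Rightarrow> 'e \<Rightarrow> real" where
  "rep1 c q \<theta> x v = \<theta> (cinv (c q) x) (mderiv euclid c (cinv (c q)) x v)"

definition rep2 ::
    "('m \<Rightarrow> ('m, 'e::euclidean_space) chart) \<Rightarrow> 'm \<Rightarrow> ('m \<Rightarrow> 'e \<Rightarrow> 'e \<Rightarrow> real) \<Rightarrow>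
     'e \<Rightarrow> 'e \<Rightarrow> 'e \<Rightarrow> real" where
  "rep2 c q \<omega> x v w = \<omega> (cinv (c q) x)
     (mderiv euclid c (cinv (c q)) x v) (mderiv euclid c (cinv (c q)) x w)"

definition rep_endo ::
    "('m \<Rightarrow> ('m, 'e::euclidean_space) chart) \<Rightarrow> 'm \<Rightarrow> ('m \<Rightarrow> 'e \<Rightarrow> 'e) \<Rightarrow> 'e \<Rightarrow> 'e \<Rightarrow> 'e" where
  "rep_endo c q J x v = mderiv c euclid (cmap (c q)) (cinv (c q) x)
     (J (cinv (c q) x) (mderiv euclid c (cinv (c q)) x v))"

definition one_form_on ::
    "('m::topological_space \<Rightarrow> ('m, 'e::euclidean_space) chart) \<Rightarrow> 'm set \<Rightarrow>
     ('m \<Rightarrow> 'e \<Rightarrow> real) \<Rightarrow> bool" where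
  "one_form_on c U \<theta> \<longleftrightarrow> open U \<and> (\<forall>p\<in>U. linear (\<theta> p)) \<and>
     (\<forall>q v. smooth_on (cmap (c q) ` (cdom (c q) \<inter> U)) (\<lambda>x. rep1 c q \<theta> x v))"

definition two_form ::
    "('m::topological_space \<Rightarrow> ('m, 'e::euclidean_space) chart) \<Rightarrow>
     ('m \<Rightarrow> 'e \<Rightarrow> 'e \<Rightarrow> real) \<Rightarrow> bool" where
  "two_form c \<omega> \<longleftrightarrow> (\<forall>p. bilinear (\<omega> p)) \<and> (\<forall>p v. \<omega> p v v = 0) \<and>
     (\<forall>q v w. smooth_on (cmap (c q) ` cdom (c q)) (\<lambda>x. rep2 c q \<omega> x v w))"

text \<open>Exterior derivatives, computed at \<open>p\<close> in the chart \<open>c p\<close> with constant vector fields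
  \<open>u, v, w\<close>.\<close>

definition d1 ::
    "('m \<Rightarrow> ('m, 'e::euclidean_space) chart) \<Rightarrow> ('m \<Rightarrow> 'e \<Rightarrow> real) \<Rightarrow> 'm \<Rightarrow> 'e \<Rightarrow> 'e \<Rightarrow> real" where
  "d1 c \<theta> p v w =
     frechet_derivative (\<lambda>x. rep1 c p \<theta> x w) (at (cmap (c p) p)) v -
     frechet_derivative (\<lambda>x. rep1 c p \<theta> x v) (at (cmap (c p) p)) w"

definition d2 ::
    "('m \<Rightarrow> ('m, 'e::euclidean_space) chart) \<Rightarrow> ('m \<Rightarrow> 'e \<Rightarrow> 'e \<Rightarrow> real) \<Rightarrow>
     'm \<Rightarrow> 'e \<Rightarrow> 'e \<Rightarrow> 'e \<Rightarrow> real" where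
  "d2 c \<omega> p u v w =
     frechet_derivative (\<lambda>x. rep2 c p \<omega> x v w) (at (cmap (c p) p)) u -
     frechet_derivative (\<lambda>x. rep2 c p \<omega> x u w) (at (cmap (c p) p)) v +
     frechet_derivative (\<lambda>x. rep2 c p \<omega> x u v) (at (cmap (c p) p)) w"

subsection \<open>Symplectic and contact geometry\<close>

definition symplectic_form ::
    "('m::topological_space \<Rightarrow> ('m, 'e::euclidean_space) chart) \<Rightarrow>
     ('m \<Rightarrow> 'e \<Rightarrow> 'e \<Rightarrow> real) \<Rightarrow> bool" where
  "symplectic_form c \<omega> \<longleftrightarrow> two_form c \<omega> \<and> (\<forall>p u v w. d2 c \<omega> p u v w = 0) \<and>
     (\<forall>p v. v \<noteq> 0 \<longrightarrow> (\<exists>w. \<omega> p v w \<noteq> 0))"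

text \<open>A nowhere vanishing 1-form \<open>\<alpha>\<close> such that \<open>d\<alpha>\<close> is nondegenerate on the hyperplanes
  \<open>ker \<alpha>\<close>, i.e. \<open>\<alpha> \<and> (d\<alpha>)^(n-1)\<close> is a volume form.\<close>

definition contact_form ::
    "('y::topological_space \<Rightarrow> ('y, 'f::euclidean_space) chart) \<Rightarrow> ('y \<Rightarrow> 'f \<Rightarrow> real) \<Rightarrow> bool" where
  "contact_form c \<alpha> \<longleftrightarrow> one_form_on c UNIV \<alpha> \<and> (\<forall>y. \<exists>v. \<alpha> y v \<noteq> 0) \<and>
     (\<forall>y v. \<alpha> y v = 0 \<and> v \<noteq> 0 \<longrightarrow> (\<exists>w. \<alpha> y w = 0 \<and> d1 c \<alpha> y v w \<noteq> 0))"

definition reeb ::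
    "('y \<Rightarrow> ('y, 'f::euclidean_space) chart) \<Rightarrow> ('y \<Rightarrow> 'f \<Rightarrow> real) \<Rightarrow> 'y \<Rightarrow> 'f" where
  "reeb c \<alpha> y = (THE Y. \<alpha> y Y = 1 \<and> (\<forall>v. d1 c \<alpha> y Y v = 0))"

definition ham_vf ::
    "('m \<Rightarrow> ('m, 'e::euclidean_space) chart) \<Rightarrow> ('m \<Rightarrow> 'e \<Rightarrow> 'e \<Rightarrow> real) \<Rightarrow> ('m \<Rightarrow> real) \<Rightarrow>
     'm \<Rightarrow> 'e" where
  "ham_vf c \<omega> H p = (THE X. \<forall>v. \<omega> p v X = mderiv c euclid H p v)"

text \<open>The manifold \<open>\<Sigma> \<times> \<real>\<close>, whose subset \<open>\<Sigma> \<times> [1,\<infinity>)\<close> is the model of the collar, and the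
  1-form \<open>R\<alpha>\<close> on it.\<close>

abbreviation collar_atlas ::
    "('y \<Rightarrow> ('y, 'f::euclidean_space) chart) \<Rightarrow> 'y \<times> real \<Rightarrow> ('y \<times> real, 'f \<times> real) chart" where
  "collar_atlas cY \<equiv> prod_atlas cY euclid"

definition liouville_form :: "('y \<Rightarrow> 'f \<Rightarrow> real) \<Rightarrow> 'y \<times> real \<Rightarrow> 'f \<times> real \<Rightarrow> real" where
  "liouville_form \<alpha> = (\<lambda>(y, R) (v, r). R * \<alpha> y v)"

text \<open>\<open>\<kappa>\<close> is the symplectomorphism from \<open>M \<setminus> M0\<close> to \<open>\<Sigma> \<times> [1,\<infinity>)\<close> and \<open>\<iota>\<close> its inverse; both are
  smooth up to the boundary. The condition on the frontier says that the boundary \<open>R = 1\<close> of the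
  collar is the boundary of the domain, so that \<open>M \<setminus> M0\<close> has full dimension. The equation
  \<open>\<iota>^* \<omega> = d(R\<alpha>)\<close> is stated for \<open>R > 1\<close>, where the differential of \<open>\<iota>\<close> is two-sided; it
  extends to \<open>R = 1\<close> by continuity.\<close>

definition conical_at_infinity ::
    "('m::topological_space \<Rightarrow> ('m, 'e::euclidean_space) chart) \<Rightarrow>
     ('m \<Rightarrow> 'e \<Rightarrow> 'e \<Rightarrow> real) \<Rightarrow>
     ('y::topological_space \<Rightarrow> ('y, 'f::euclidean_space) chart) \<Rightarrow> ('y \<Rightarrow> 'f \<Rightarrow> real) \<Rightarrow>
     'm set \<Rightarrow> ('m \<Rightarrow> 'y \<times> real) \<Rightarrow> ('y \<times> real \<Rightarrow> 'm) \<Rightarrow> bool" where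
  "conical_at_infinity cM \<omega> cY \<alpha> M0 \<kappa> \<iota> \<longleftrightarrow>
     smooth_atlas cM \<and> symplectic_form cM \<omega> \<and>
     smooth_atlas cY \<and> contact_form cY \<alpha> \<and>
     open M0 \<and> compact (closure M0) \<and>
     frontier M0 = \<iota> ` (UNIV \<times> {1}) \<and>
     homeomorphism (- M0) (UNIV \<times> {1..}) \<kappa> \<iota> \<and>
     msmooth_on cM (collar_atlas cY) (- M0) \<kappa> \<and>
     msmooth_on (collar_atlas cY) cM (UNIV \<times> {1..}) \<iota> \<and>
     (\<forall>y. \<forall>R>1. \<forall>a b.
        \<omega> (\<iota> (y, R)) (mderiv (collar_atlas cY) cM \<iota> (y, R) a) (mderiv (collar_atlas cY) cM \<iota> (y, R) b)
        = d1 (collar_atlas cY) (liouville_form \<alpha>) (y, R) a b)"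

definition compatible_acs ::
    "('m::topological_space \<Rightarrow> ('m, 'e::euclidean_space) chart) \<Rightarrow>
     ('m \<Rightarrow> 'e \<Rightarrow> 'e \<Rightarrow> real) \<Rightarrow> ('m \<Rightarrow> 'e \<Rightarrow> 'e) \<Rightarrow> bool" where
  "compatible_acs c \<omega> J \<longleftrightarrow>
     (\<forall>p. linear (J p)) \<and>
     (\<forall>q v. smooth_on (cmap (c q) ` cdom (c q)) (\<lambda>x. rep_endo c q J x v)) \<and>
     (\<forall>p v. J p (J p v) = - v) \<and>
     (\<forall>p v w. \<omega> p (J p v) (J p w) = \<omega> p v w) \<and>
     (\<forall>p v. v \<noteq> 0 \<longrightarrow> \<omega> p v (J p v) > 0)"

text \<open>\<open>J Z = Y\<close> for large \<open>R\<close>, where \<open>Z = R \<partial>\<^sub>R\<close>.\<close>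

definition contact_type_at_infinity ::
    "('m \<Rightarrow> ('m, 'e::euclidean_space) chart) \<Rightarrow> ('y \<Rightarrow> ('y, 'f::euclidean_space) chart) \<Rightarrow>
     ('y \<Rightarrow> 'f \<Rightarrow> real) \<Rightarrow> ('y \<times> real \<Rightarrow> 'm) \<Rightarrow> ('m \<Rightarrow> 'e \<Rightarrow> 'e) \<Rightarrow> bool" where
  "contact_type_at_infinity cM cY \<alpha> \<iota> J \<longleftrightarrow>
     (\<exists>R1\<ge>1. \<forall>y. \<forall>R>R1.
        J (\<iota> (y, R)) (mderiv (collar_atlas cY) cM \<iota> (y, R) (0, R))
        = mderiv (collar_atlas cY) cM \<iota> (y, R) (reeb cY \<alpha> y, 0))"

subsection \<open>Punctured Riemann surfaces\<close>

text \<open>The surface is \<open>S = - P\<close>, where \<open>P\<close> is a finite nonempty set of punctures in a compact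
  connected Riemann surface. The complex structure \<open>j\<close> is multiplication by \<open>\<i>\<close> on
  the tangent spaces \<open>\<complex>\<close>.

  Cylindrical coordinates near a puncture \<open>p\<close> identify a punctured neighbourhood of \<open>p\<close>
  with \<open>(0,\<infinity>) \<times> \<real>/\<int>\<close> (sign \<open>1\<close>) or \<open>(-\<infinity>,0) \<times> \<real>/\<int>\<close> (sign \<open>-1\<close>), with \<open>p\<close> at the infinite
  end. They are given by the lift \<open>E\<close> of the inverse identification to the half plane of points
  \<open>s + \<i>t\<close>.\<close>

definition half_plane :: "real \<Rightarrow> complex set" where
  "half_plane \<sigma> = {w. \<sigma> * Re w > 0}"

definition cylindrical_coords ::
    "('r::topological_space \<Rightarrow> ('r, complex) chart) \<Rightarrow> 'r set \<Rightarrow> 'r \<Rightarrow> real \<Rightarrow> (complex \<Rightarrow> 'r) \<Rightarrow>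
     bool" where
  "cylindrical_coords cS P p \<sigma> E \<longleftrightarrow>
     (\<sigma> = 1 \<or> \<sigma> = - 1) \<and>
     continuous_on (half_plane \<sigma>) E \<and>
     (\<forall>q. (cmap (cS q) \<circ> E) holomorphic_on (half_plane \<sigma> \<inter> E -` cdom (cS q))) \<and>
     (\<forall>w\<in>half_plane \<sigma>. \<forall>w'\<in>half_plane \<sigma>. E w = E w' \<longleftrightarrow> (\<exists>n::int. w' - w = of_int n * \<i>)) \<and>
     E ` half_plane \<sigma> \<subseteq> - P \<and>
     open (insert p (E ` half_plane \<sigma>)) \<and>
     (E \<longlongrightarrow> p) (filtercomap (\<lambda>w. \<sigma> * Re w) at_top)"

definition punctured_riemann_surface ::
    "('r::topological_space \<Rightarrow> ('r, complex) chart) \<Rightarrow> 'r set \<Rightarrow> ('r \<Rightarrow> real) \<Rightarrow>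
     ('r \<Rightarrow> complex \<Rightarrow> 'r) \<Rightarrow> bool" where
  "punctured_riemann_surface cS P \<sigma> E \<longleftrightarrow>
     complex_atlas cS \<and> compact (UNIV :: 'r set) \<and> connected (UNIV :: 'r set) \<and>
     finite P \<and> P \<noteq> {} \<and> (\<forall>p\<in>P. cylindrical_coords cS P p (\<sigma> p) (E p))"

text \<open>\<open>d\<beta> \<le> 0\<close> refers to the orientation given by \<open>j\<close>; near the puncture \<open>p\<close>, \<open>\<beta> = k p dt\<close>.\<close>

definition floer_one_form ::
    "('r::topological_space \<Rightarrow> ('r, complex) chart) \<Rightarrow> 'r set \<Rightarrow> ('r \<Rightarrow> real) \<Rightarrow>
     ('r \<Rightarrow> complex \<Rightarrow> 'r) \<Rightarrow> ('r \<Rightarrow> real) \<Rightarrow> ('r \<Rightarrow> complex \<Rightarrow> real) \<Rightarrow> bool" where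
  "floer_one_form cS P \<sigma> E k \<beta> \<longleftrightarrow>
     one_form_on cS (- P) \<beta> \<and>
     (\<forall>z\<in>- P. \<forall>v. d1 cS \<beta> z v (\<i> * v) \<le> 0) \<and>
     (\<forall>p\<in>P. k p > 0 \<and>
        (\<exists>T\<ge>0. \<forall>w. \<sigma> p * Re w > T \<longrightarrow>
           (\<forall>v. \<beta> (E p w) (mderiv euclid cS (E p) w v) = k p * Im v)))"

subsection \<open>Floer solutions\<close>

text \<open>The \<open>(0,1)\<close>-part of a real linear map \<open>A\<close> from \<open>(\<complex>, \<i>)\<close> to \<open>(V, J)\<close>.\<close>

definition part01 :: "('e \<Rightarrow> 'e) \<Rightarrow> (complex \<Rightarrow> 'e) \<Rightarrow> complex \<Rightarrow> 'e::real_vector" where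
  "part01 J A v = (1/2) *\<^sub>R (A v + J (A (\<i> * v)))"

definition floer_solution ::
    "('m::topological_space \<Rightarrow> ('m, 'e::euclidean_space) chart) \<Rightarrow>
     ('m \<Rightarrow> 'e \<Rightarrow> 'e \<Rightarrow> real) \<Rightarrow> ('m \<Rightarrow> real) \<Rightarrow> ('m \<Rightarrow> 'e \<Rightarrow> 'e) \<Rightarrow>
     ('r::topological_space \<Rightarrow> ('r, complex) chart) \<Rightarrow> 'r set \<Rightarrow> ('r \<Rightarrow> complex \<Rightarrow> real) \<Rightarrow>
     ('r \<Rightarrow> 'm) \<Rightarrow> bool" where
  "floer_solution cM \<omega> H J cS P \<beta> u \<longleftrightarrow>
     msmooth_open cS cM (- P) u \<and>
     (\<forall>z\<in>- P. \<forall>v.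
        part01 (J (u z)) (\<lambda>v. mderiv cS cM u z v - \<beta> z v *\<^sub>R ham_vf cM \<omega> H (u z)) v = 0)"

text \<open>1-periodic orbits of the Hamiltonian vector field of \<open>k H\<close>.\<close>

definition hamiltonian_orbit ::
    "('m::topological_space \<Rightarrow> ('m, 'e::euclidean_space) chart) \<Rightarrow>
     ('m \<Rightarrow> 'e \<Rightarrow> 'e \<Rightarrow> real) \<Rightarrow> ('m \<Rightarrow> real) \<Rightarrow> real \<Rightarrow> (real \<Rightarrow> 'm) \<Rightarrow> bool" where
  "hamiltonian_orbit cM \<omega> H k x \<longleftrightarrow>
     msmooth_open euclid cM UNIV x \<and> (\<forall>t. x (t + 1) = x t) \<and>
     (\<forall>t. mderiv euclid cM x t 1 = k *\<^sub>R ham_vf cM \<omega> H (x t))"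

text \<open>At each puncture \<open>p\<close>, \<open>u(s,\<cdot>)\<close> converges to the orbit \<open>x p\<close> as \<open>s \<rightarrow> \<plusminus>\<infinity>\<close>, uniformly in
  \<open>t\<close>: as \<open>x p\<close> is continuous and periodic, the joint limits below express exactly that, without
  reference to a metric on \<open>M\<close>.\<close>

definition asymptotic_orbits ::
    "('m::topological_space \<Rightarrow> ('m, 'e::euclidean_space) chart) \<Rightarrow>
     ('m \<Rightarrow> 'e \<Rightarrow> 'e \<Rightarrow> real) \<Rightarrow> ('m \<Rightarrow> real) \<Rightarrow> 'r set \<Rightarrow> ('r \<Rightarrow> real) \<Rightarrow> ('r \<Rightarrow> complex \<Rightarrow> 'r) \<Rightarrow>
     ('r \<Rightarrow> real) \<Rightarrow> ('r \<Rightarrow> 'm) \<Rightarrow> ('r \<Rightarrow> real \<Rightarrow> 'm) \<Rightarrow> bool" where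
  "asymptotic_orbits cM \<omega> H P \<sigma> E k u x \<longleftrightarrow>
     (\<forall>p\<in>P. hamiltonian_orbit cM \<omega> H (k p) (x p) \<and>
        (\<forall>t0. ((\<lambda>(s, t). u (E p (Complex (\<sigma> p * s) t))) \<longlongrightarrow> x p t0) (at_top \<times>\<^sub>F nhds t0)))"

end

theory Submission
  imports Defs "HOL-Complex_Analysis.Cauchy_Integral_Formula"
begin

text \<open>Write \<open>\<rho> = R \<circ> u\<close>, \<open>\<lambda> = R\<alpha>\<close> and \<open>A = du - X_H \<otimes> \<beta>\<close>. The bound is a maximum
principle for \<open>\<rho>\<close> on the part of \<open>S\<close> that \<open>u\<close> maps to \<open>{R > R_1}\<close>, where \<open>R_1 \<ge> 1\<close> is so large
that both \<open>H = fR\<close> and \<open>JZ = Y\<close> hold for \<open>R > R_1\<close>.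

On this part of \<open>M\<close> one has \<open>\<omega>(\<cdot>, Y) = dR\<close> and \<open>\<omega>(Z, \<cdot>) = \<lambda>\<close>, so that \<open>JZ = Y\<close> and the
\<open>J\<close>-invariance of \<open>\<omega>\<close> give \<open>dR = \<lambda> \<circ> J\<close>. Moreover \<open>dR(X_H) = -dH(Y) = -R df(Y) = 0\<close>, which is
where the Reeb invariance of \<open>f\<close> enters, and \<open>\<lambda>(X_H) = dH(Z) = H\<close>. The Floer equation says
\<open>A \<circ> j = J \<circ> A\<close>, and therefore

  \<open> d\<rho> = \<lambda>(J A) = \<lambda>(A \<circ> j) = (u^*\<lambda> - H(u)\<beta>) \<circ> j . \<close>

Applying \<open>d\<close> once more,

  \<open> \<Delta>\<rho>  ds \<and> dt = u^*\<omega> - d(H \<circ> u) \<and> \<beta> - H(u) d\<beta>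
   = |A|^2 ds \<and> dt - H(u) d\<beta> , \<close>

where \<open>|A|^2 = \<omega>(A\<partial>_s, J A\<partial>_s)\<close>. This is nonnegative if \<open>d\<beta> = 0\<close>, or if \<open>f \<ge> 0\<close> and
\<open>d\<beta> \<le> 0\<close>. So \<open>\<rho>\<close> is subharmonic wherever \<open>\<rho> > R_1\<close> (\<open>radius_subharmonic\<close>).

Suppose that \<open>\<rho>\<close> exceeds at some point every asymptotic value and \<open>R_1\<close>. The points where it is
at least as large form a compact set, because near the punctures \<open>\<rho>\<close> is close to its
asymptotic values; hence \<open>\<rho>\<close> attains its supremum. The set where it does is closed, it is open by
the strong maximum principle, and it misses the punctures. This contradicts the connectedness of
the compact surface. So \<open>B(C) = max(R_1, C)\<close> works, independently of the surface and of \<open>u\<close>.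

Two facts of independent interest carry the argument. The exterior derivative commutes with the
pullback along a map that is merely twice differentiable (\<open>d1_pullback\<close>); it is applied to
\<open>\<lambda>\<close> along \<open>\<kappa> \<circ> u\<close> and to \<open>\<beta>\<close> along the inverse of a chart. The strong maximum principle
(\<open>strong_maximum_principle\<close>) is derived from the second derivative test with Hopf's barrier.\<close>

section \<open>Twice differentiable maps between Euclidean spaces\<close>

abbreviation FD :: "('a::real_normed_vector \<Rightarrow> 'b::real_normed_vector) \<Rightarrow> 'a \<Rightarrow> 'a \<Rightarrow> 'b" where
  "FD f x \<equiv> frechet_derivative f (at x)"

lemma FD_works: "f differentiable (at x) \<Longrightarrow> (f has_derivative FD f x) (at x)"
  by (rule iffD1[OF frechet_derivative_works])

lemma FD_eqI: "(f has_derivative f') (at x) \<Longrightarrow> FD f x = f'"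
  by (metis frechet_derivative_at)

lemma FD_linear: "f differentiable (at x) \<Longrightarrow> linear (FD f x)"
  by (rule linear_frechet_derivative)

lemma FD_chain:
  assumes "f differentiable (at x)" "g differentiable (at (f x))"
  shows "FD (\<lambda>y. g (f y)) x v = FD g (f x) (FD f x v)"
  using FD_eqI[OF has_derivative_compose[OF FD_works[OF assms(1)] FD_works[OF assms(2)]]] by simp

lemma FD_cong:
  assumes "open U" "x \<in> U" "\<And>y. y \<in> U \<Longrightarrow> f y = g y"
  shows "FD f x = FD g x"
proof -
  have "(f has_derivative f') (at x) \<longleftrightarrow> (g has_derivative f') (at x)" for f'
    using assms by (metis has_derivative_transform_within_open)
  then show ?thesis unfolding frechet_derivative_def by simp
qed

lemma differentiable_cong:
  assumes "open U" "x \<in> U" "\<And>y. y \<in> U \<Longrightarrow> f y = g y" "g differentiable (at x)"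
  shows "f differentiable (at x)"
  using assms(4) has_derivative_transform_within_open[OF _ assms(1,2)] assms(3)
  unfolding differentiable_def by metis

lemma has_real_derivative_along_line:
  fixes f :: "'a::real_normed_vector \<Rightarrow> real"
  assumes "f differentiable (at (x + t *\<^sub>R v))"
  shows "((\<lambda>s. f (x + s *\<^sub>R v)) has_real_derivative FD f (x + t *\<^sub>R v) v) (at t)"
proof -
  have l: "((\<lambda>s. x + s *\<^sub>R v) has_derivative (\<lambda>h. h *\<^sub>R v)) (at t)"
    by (auto intro!: derivative_eq_intros)
  have "((\<lambda>s. f (x + s *\<^sub>R v)) has_derivative (\<lambda>h. FD f (x + t *\<^sub>R v) (h *\<^sub>R v))) (at t)"
    by (rule has_derivative_compose[OF l FD_works[OF assms]])
  moreover have "(\<lambda>h. FD f (x + t *\<^sub>R v) (h *\<^sub>R v)) = (*) (FD f (x + t *\<^sub>R v) v)"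
    using linear_cmul[OF FD_linear[OF assms]] by auto
  ultimately show ?thesis by (simp add: has_field_derivative_def)
qed

text \<open>By the mean value theorem in the direction \<open>v\<close>, the second difference is
\<open>t (g(x + sv + tw) - g(x + sv))\<close> with \<open>g = Df(\<cdot>)v\<close> and \<open>0 < s < t\<close>, and \<open>g\<close> is differentiable at \<open>x\<close>.
The second difference is symmetric in \<open>v\<close> and \<open>w\<close>, hence so is its limit.\<close>

lemma second_difference_quotient_limit:
  fixes f :: "'a::real_normed_vector \<Rightarrow> real"
  assumes U: "open U" "x \<in> U" "\<And>y. y \<in> U \<Longrightarrow> f differentiable (at y)"
    and v: "(\<lambda>y. FD f y v) differentiable (at x)"
  shows "((\<lambda>t. (f (x + t *\<^sub>R v + t *\<^sub>R w) - f (x + t *\<^sub>R v) - f (x + t *\<^sub>R w) + f x) / t\<^sup>2)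
           \<longlongrightarrow> FD (\<lambda>y. FD f y v) x w) (at_right 0)"
proof (rule tendstoI)
  fix e :: real assume e: "e > 0"
  define g where "g = (\<lambda>y. FD f y v)"
  define L where "L = FD g x"
  define c where "c = 2 * norm v + norm w + 1"
  have c: "c > 0" unfolding c_def by (simp add: add_nonneg_pos)
  have gL: "(g has_derivative L) (at x)" unfolding L_def by (rule FD_works) (use v g_def in simp)
  then have lin: "linear L" by (simp add: has_derivative_linear)
  obtain d1 where d1: "d1 > 0" "\<And>y. norm (y - x) < d1 \<Longrightarrow> norm (g y - g x - L (y - x)) \<le> e / (2*c) * norm (y - x)"
    using gL e c unfolding has_derivative_at_alt by (metis divide_pos_pos mult_pos_pos zero_less_numeral)
  obtain d2 where d2: "d2 > 0" "ball x d2 \<subseteq> U" using U openE by blast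
  \<comment> \<open>all points used below are within \<open>t * (norm v + norm w) \<le> t * c\<close> of \<open>x\<close>\<close>
  define d where "d = min d1 d2 / c"
  have d: "d > 0" using d1 d2 c by (simp add: d_def)
  have main: "dist ((f (x + t *\<^sub>R v + t *\<^sub>R w) - f (x + t *\<^sub>R v) - f (x + t *\<^sub>R w) + f x) / t\<^sup>2) (L w) < e"
    if t: "0 < t" "t < d" for t
  proof -
    have near: "norm (s *\<^sub>R v + r *\<^sub>R w) \<le> t * (norm v + norm w) \<and> norm (s *\<^sub>R v + r *\<^sub>R w) < min d1 d2"
      if s: "0 \<le> s" "s \<le> t" "0 \<le> r" "r \<le> t" for s r
    proof -
      have "norm (s *\<^sub>R v + r *\<^sub>R w) \<le> s * norm v + r * norm w"
        using s norm_triangle_ineq[of "s *\<^sub>R v" "r *\<^sub>R w"] by simp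
      also have "\<dots> \<le> t * norm v + t * norm w"
        using s by (intro add_mono mult_right_mono) auto
      finally have 1: "norm (s *\<^sub>R v + r *\<^sub>R w) \<le> t * (norm v + norm w)" by (simp add: algebra_simps)
      also have "\<dots> < t * c" unfolding c_def using t norm_ge_zero[of v] by (intro mult_strict_left_mono) (linarith, simp)
      also have "\<dots> < min d1 d2" using t c by (simp add: d_def field_simps)
      finally show ?thesis using 1 by simp
    qed
    have inU: "x + s *\<^sub>R v + r *\<^sub>R w \<in> U" if "0 \<le> s" "s \<le> t" "0 \<le> r" "r \<le> t" for s r
    proof -
      have "x + s *\<^sub>R v + r *\<^sub>R w \<in> ball x d2"
        using near[OF that] dist_add_cancel[of x 0 "s *\<^sub>R v + r *\<^sub>R w"] by (simp add: add.assoc)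
      then show ?thesis using d2(2) by blast
    qed
    have ND: "((\<lambda>s. f (x + s *\<^sub>R v + r *\<^sub>R w)) has_real_derivative g (x + s *\<^sub>R v + r *\<^sub>R w)) (at s)"
      if "0 \<le> s" "s \<le> t" "0 \<le> r" "r \<le> t" for s r
      using has_real_derivative_along_line[of f "x + r *\<^sub>R w" s v] U(3)[OF inU[OF that]]
      by (simp add: g_def add_ac)
    have "\<exists>s. s > 0 \<and> s < t \<and> (f (x + t *\<^sub>R v + t *\<^sub>R w) - f (x + t *\<^sub>R v + 0 *\<^sub>R w)) - (f (x + 0 *\<^sub>R v + t *\<^sub>R w) - f (x + 0 *\<^sub>R v + 0 *\<^sub>R w))
       = (t - 0) * (g (x + s *\<^sub>R v + t *\<^sub>R w) - g (x + s *\<^sub>R v + 0 *\<^sub>R w))"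
      by (rule MVT2) (use t in \<open>auto intro!: DERIV_diff ND simp del: scaleR_zero_left\<close>)
    then obtain s where s: "0 < s" "s < t" and eq: "(f (x + t *\<^sub>R v + t *\<^sub>R w) - f (x + t *\<^sub>R v)) - (f (x + t *\<^sub>R w) - f x)
       = t * (g (x + s *\<^sub>R v + t *\<^sub>R w) - g (x + s *\<^sub>R v))" by auto
    have A: "\<bar>g (x + s *\<^sub>R v + t *\<^sub>R w) - g x - L (s *\<^sub>R v + t *\<^sub>R w)\<bar> \<le> e / (2*c) * (t * (norm v + norm w))"
    proof -
      have "norm ((x + s *\<^sub>R v + t *\<^sub>R w) - x) < d1" using near[of s t] s t by (simp add: algebra_simps)
      from d1(2)[OF this] have "\<bar>g (x + s *\<^sub>R v + t *\<^sub>R w) - g x - L (s *\<^sub>R v + t *\<^sub>R w)\<bar> \<le> e / (2*c) * norm (s *\<^sub>R v + t *\<^sub>R w)"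
        by (simp add: add.assoc)
      also have "\<dots> \<le> e / (2*c) * (t * (norm v + norm w))"
        using near[of s t] s t e c by (intro mult_left_mono) auto
      finally show ?thesis .
    qed
    have B: "\<bar>g (x + s *\<^sub>R v) - g x - L (s *\<^sub>R v)\<bar> \<le> e / (2*c) * (t * norm v)"
    proof -
      have "norm ((x + s *\<^sub>R v) - x) < d1" using near[of s 0] s t by (simp add: algebra_simps)
      from d1(2)[OF this] have "\<bar>g (x + s *\<^sub>R v) - g x - L (s *\<^sub>R v)\<bar> \<le> e / (2*c) * (s * norm v)"
        using s by simp
      also have "\<dots> \<le> e / (2*c) * (t * norm v)"
        using s t e c by (intro mult_left_mono mult_right_mono) auto
      finally show ?thesis .
    qed
    have Lw: "L (s *\<^sub>R v + t *\<^sub>R w) - L (s *\<^sub>R v) = t * L w"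
      using lin by (simp add: linear_add linear_cmul)
    have "\<bar>(g (x + s *\<^sub>R v + t *\<^sub>R w) - g (x + s *\<^sub>R v)) - t * L w\<bar> \<le> e / (2*c) * (t * (norm v + norm w)) + e / (2*c) * (t * norm v)"
      using A B Lw by linarith
    also have "\<dots> = t * (e / (2*c) * (2 * norm v + norm w))" by (simp add: algebra_simps)
    also have "\<dots> < t * e"
    proof -
      have "e / (2*c) * (2 * norm v + norm w) < e / (2*c) * (2*c)"
        using e c by (intro mult_strict_left_mono) (auto simp: c_def add_nonneg_pos intro: add_nonneg_nonneg)
      also have "\<dots> = e" using c by simp
      finally show ?thesis using t by (intro mult_strict_left_mono) auto
    qed
    finally have F: "\<bar>(g (x + s *\<^sub>R v + t *\<^sub>R w) - g (x + s *\<^sub>R v)) - t * L w\<bar> < t * e" .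
    have "f (x + t *\<^sub>R v + t *\<^sub>R w) - f (x + t *\<^sub>R v) - f (x + t *\<^sub>R w) + f x
        = t * (g (x + s *\<^sub>R v + t *\<^sub>R w) - g (x + s *\<^sub>R v))"
      using eq by linarith
    then have "(f (x + t *\<^sub>R v + t *\<^sub>R w) - f (x + t *\<^sub>R v) - f (x + t *\<^sub>R w) + f x) / t\<^sup>2 - L w
      = ((g (x + s *\<^sub>R v + t *\<^sub>R w) - g (x + s *\<^sub>R v)) - t * L w) / t"
      using t by (simp only:) (simp add: field_simps power2_eq_square)
    moreover have "\<bar>((g (x + s *\<^sub>R v + t *\<^sub>R w) - g (x + s *\<^sub>R v)) - t * L w) / t\<bar> < e"
      using F t unfolding abs_divide by (simp add: pos_divide_less_eq mult.commute)
    ultimately show ?thesis unfolding dist_real_def by (simp only:)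
  qed
  have "eventually (\<lambda>t::real. 0 < t \<and> t < d) (at_right 0)"
    using eventually_at_right_real[OF d] by (auto elim!: eventually_mono)
  then show "\<forall>\<^sub>F t in at_right 0. dist ((f (x + t *\<^sub>R v + t *\<^sub>R w) - f (x + t *\<^sub>R v) - f (x + t *\<^sub>R w) + f x) / t\<^sup>2) (FD (\<lambda>y. FD f y v) x w) < e"
    using main unfolding L_def g_def by (auto elim!: eventually_mono)
qed

lemma second_derivative_symmetric_real:
  fixes f :: "'a::real_normed_vector \<Rightarrow> real"
  assumes "open U" "x \<in> U" "\<And>y. y \<in> U \<Longrightarrow> f differentiable (at y)"
    and "(\<lambda>y. FD f y v) differentiable (at x)" "(\<lambda>y. FD f y w) differentiable (at x)"
  shows "FD (\<lambda>y. FD f y v) x w = FD (\<lambda>y. FD f y w) x v"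
proof -
  note 1 = second_difference_quotient_limit[OF assms(1-3) assms(4), where w=w]
  note 2 = second_difference_quotient_limit[OF assms(1-3) assms(5), where w=v]
  have e: "(\<lambda>t. (f (x + t *\<^sub>R w + t *\<^sub>R v) - f (x + t *\<^sub>R w) - f (x + t *\<^sub>R v) + f x) / t\<^sup>2)
     = (\<lambda>t. (f (x + t *\<^sub>R v + t *\<^sub>R w) - f (x + t *\<^sub>R v) - f (x + t *\<^sub>R w) + f x) / t\<^sup>2)"
    by (auto simp: algebra_simps)
  show ?thesis by (rule tendsto_unique[OF _ 1 2[unfolded e]]) simp
qed

text \<open>The smoothness under which the symmetry of second derivatives is proved and the exterior
derivative is shown to commute with pullback.\<close>

definition twice_diff_on :: "'a::real_normed_vector set \<Rightarrow> ('a \<Rightarrow> 'b::real_normed_vector) \<Rightarrow> bool" where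
  "twice_diff_on U f \<longleftrightarrow> (\<forall>x\<in>U. f differentiable (at x)) \<and>
     (\<forall>x\<in>U. \<forall>v. (\<lambda>y. FD f y v) differentiable (at x))"

lemma smooth_on_imp_twice_diff_on:
  assumes "smooth_on U f" shows "twice_diff_on U f"
proof -
  have "Ck_on (Suc (Suc 0)) U f" using assms by (simp only: smooth_on_def)
  then show ?thesis unfolding twice_diff_on_def by (auto simp: )
qed

lemma twice_diff_on_subset: "twice_diff_on U f \<Longrightarrow> V \<subseteq> U \<Longrightarrow> twice_diff_on V f"
  unfolding twice_diff_on_def by blast

lemma twice_diff_on_cong:
  assumes "twice_diff_on U f" "open U" "\<And>x. x \<in> U \<Longrightarrow> f x = g x"
  shows "twice_diff_on U g"
  unfolding twice_diff_on_def
proof (intro conjI ballI allI)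
  fix x v assume x: "x \<in> U"
  show "g differentiable (at x)"
    by (rule differentiable_cong[OF assms(2) x, of _ f]) (use assms x in \<open>auto simp: twice_diff_on_def\<close>)
  show "(\<lambda>y. FD g y v) differentiable (at x)"
    by (rule differentiable_cong[OF assms(2) x, of _ "\<lambda>y. FD f y v"])
      (use assms x FD_cong[OF assms(2), of _ g f] in \<open>auto simp: twice_diff_on_def\<close>)
qed

lemma FD_inner:
  fixes f :: "'a::real_normed_vector \<Rightarrow> 'b::euclidean_space"
  assumes "f differentiable (at x)"
  shows "FD (\<lambda>y. f y \<bullet> i) x v = FD f x v \<bullet> i" "(\<lambda>y. f y \<bullet> i) differentiable (at x)"
proof -
  have "((\<lambda>y. f y \<bullet> i) has_derivative (\<lambda>v. FD f x v \<bullet> i)) (at x)"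
    by (rule has_derivative_inner_left[OF FD_works[OF assms]])
  then show "FD (\<lambda>y. f y \<bullet> i) x v = FD f x v \<bullet> i" "(\<lambda>y. f y \<bullet> i) differentiable (at x)"
    by (simp_all add: FD_eqI differentiableI)
qed

lemma second_derivative_symmetric:
  fixes f :: "'a::real_normed_vector \<Rightarrow> 'b::euclidean_space"
  assumes U: "open U" "x \<in> U" and tw: "twice_diff_on U f"
  shows "FD (\<lambda>y. FD f y v) x w = FD (\<lambda>y. FD f y w) x v"
proof (rule euclidean_eqI)
  fix i :: 'b assume "i \<in> Basis"
  have f1: "f differentiable (at y)" and f2: "(\<lambda>y. FD f y v) differentiable (at y)" if "y \<in> U" for y v
    using tw that by (auto simp: twice_diff_on_def)
  have eq: "FD (\<lambda>y. f y \<bullet> i) y v = FD f y v \<bullet> i" if "y \<in> U" for y v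
    using FD_inner(1)[OF f1[OF that]] .
  have d: "(\<lambda>y. FD (\<lambda>y. f y \<bullet> i) y v) differentiable (at x)" for v
    by (rule differentiable_cong[OF U, of _ "\<lambda>y. FD f y v \<bullet> i"]) (simp_all add: eq FD_inner(2) f2 U)
  have c: "FD (\<lambda>y. FD (\<lambda>y. f y \<bullet> i) y v) x w = FD (\<lambda>y. FD f y v) x w \<bullet> i" for v w
    using FD_cong[OF U, of "\<lambda>y. FD (\<lambda>y. f y \<bullet> i) y v" "\<lambda>y. FD f y v \<bullet> i"] FD_inner(1)[OF f2[OF U(2)]]
    by (simp add: eq)
  have "FD (\<lambda>y. FD (\<lambda>y. f y \<bullet> i) y v) x w = FD (\<lambda>y. FD (\<lambda>y. f y \<bullet> i) y w) x v"
    by (rule second_derivative_symmetric_real[OF U]) (auto simp: FD_inner(2) f1 d)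
  then show "FD (\<lambda>y. FD f y v) x w \<bullet> i = FD (\<lambda>y. FD f y w) x v \<bullet> i" by (simp add: c)
qed

text \<open>The product rule for the evaluation of a linear-map-valued function at a vector-valued one.
Differentiability is only known for each fixed argument of the linear map; expanding in a basis
turns this into a finite sum of products.\<close>

lemma FD_linear_family:
  fixes a :: "'b::euclidean_space \<Rightarrow> 'c::euclidean_space \<Rightarrow> 'd::real_normed_vector"
  assumes V: "open V" "x \<in> V"
    and \<phi>: "\<phi> differentiable (at x)" 
    and w: "w differentiable (at x)"
    and lin: "\<And>y. y \<in> V \<Longrightarrow> linear (a (\<phi> y))"
    and a: "\<And>v. (\<lambda>y. a y v) differentiable (at (\<phi> x))"
  shows "(\<lambda>y. a (\<phi> y) (w y)) differentiable (at x)"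
    "FD (\<lambda>y. a (\<phi> y) (w y)) x v = a (\<phi> x) (FD w x v) + FD (\<lambda>y. a y (w x)) (\<phi> x) (FD \<phi> x v)"
proof -
  have exp: "a (\<phi> y) u = (\<Sum>i\<in>Basis. (u \<bullet> i) *\<^sub>R a (\<phi> y) i)" if "y \<in> V" for u y
    using linear_sum[OF lin[OF that], of "\<lambda>i. (u \<bullet> i) *\<^sub>R i" Basis] linear_cmul[OF lin[OF that]]
    by (simp add: euclidean_representation)
  define A where "A i = FD (\<lambda>y. a y i) (\<phi> x)" for i
  have A: "((\<lambda>y. a y i) has_derivative A i) (at (\<phi> x))" for i
    unfolding A_def by (rule FD_works[OF a])
  have Ac: "((\<lambda>y. a (\<phi> y) i) has_derivative (\<lambda>v. A i (FD \<phi> x v))) (at x)" for i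
    by (rule has_derivative_compose[OF FD_works[OF \<phi>] A])
  have "((\<lambda>y. \<Sum>i\<in>Basis. (w y \<bullet> i) *\<^sub>R a (\<phi> y) i) has_derivative
     (\<lambda>v. \<Sum>i\<in>Basis. (w x \<bullet> i) *\<^sub>R A i (FD \<phi> x v) + (FD w x v \<bullet> i) *\<^sub>R a (\<phi> x) i)) (at x)"
    by (intro has_derivative_sum has_derivative_scaleR has_derivative_inner_left FD_works[OF w] Ac)
  then have hd: "((\<lambda>y. a (\<phi> y) (w y)) has_derivative
     (\<lambda>v. \<Sum>i\<in>Basis. (w x \<bullet> i) *\<^sub>R A i (FD \<phi> x v) + (FD w x v \<bullet> i) *\<^sub>R a (\<phi> x) i)) (at x)"
    by (rule has_derivative_transform_within_open[OF _ V]) (simp add: exp[symmetric])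
  then show "(\<lambda>y. a (\<phi> y) (w y)) differentiable (at x)" by (auto simp: differentiable_def)
  have 2: "FD (\<lambda>y. a y (w x)) (\<phi> x) (FD \<phi> x v) = (\<Sum>i\<in>Basis. (w x \<bullet> i) *\<^sub>R A i (FD \<phi> x v))"
  proof -
    have "FD (\<lambda>y. a (\<phi> y) (w x)) x v = FD (\<lambda>y. a y (w x)) (\<phi> x) (FD \<phi> x v)"
      using FD_chain[OF \<phi> a] .
    moreover have "((\<lambda>y. \<Sum>i\<in>Basis. (w x \<bullet> i) *\<^sub>R a (\<phi> y) i) has_derivative
       (\<lambda>v. \<Sum>i\<in>Basis. (w x \<bullet> i) *\<^sub>R A i (FD \<phi> x v))) (at x)"
      by (intro has_derivative_sum has_derivative_scaleR_right Ac)
    then have "((\<lambda>y. a (\<phi> y) (w x)) has_derivative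
       (\<lambda>v. \<Sum>i\<in>Basis. (w x \<bullet> i) *\<^sub>R A i (FD \<phi> x v))) (at x)"
      by (rule has_derivative_transform_within_open[OF _ V]) (simp add: exp[symmetric])
    note FD_eqI[OF this]
    ultimately show ?thesis by simp
  qed
  show "FD (\<lambda>y. a (\<phi> y) (w y)) x v = a (\<phi> x) (FD w x v) + FD (\<lambda>y. a y (w x)) (\<phi> x) (FD \<phi> x v)"
    unfolding FD_eqI[OF hd] 2 by (simp add: sum.distrib exp[OF V(2), of "FD w x v"])
qed

text \<open>By the product rule each term has a part containing \<open>D^2\<phi>(v, w)\<close>, and these cancel because
second derivatives are symmetric.\<close>

lemma exterior_derivative_pullback:
  fixes a :: "'b::euclidean_space \<Rightarrow> 'b \<Rightarrow> real"
  assumes V: "open V" "x \<in> V" and tw: "twice_diff_on V \<phi>"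
    and lin: "\<And>y. y \<in> V \<Longrightarrow> linear (a (\<phi> y))"
    and a: "\<And>v. (\<lambda>y. a y v) differentiable (at (\<phi> x))"
  shows "(\<lambda>y. a (\<phi> y) (FD \<phi> y v)) differentiable (at x)"
    "FD (\<lambda>y. a (\<phi> y) (FD \<phi> y w)) x v - FD (\<lambda>y. a (\<phi> y) (FD \<phi> y v)) x w
     = FD (\<lambda>y. a y (FD \<phi> x w)) (\<phi> x) (FD \<phi> x v) - FD (\<lambda>y. a y (FD \<phi> x v)) (\<phi> x) (FD \<phi> x w)"
proof -
  have \<phi>: "\<phi> differentiable (at x)" "(\<lambda>y. FD \<phi> y v) differentiable (at x)" for v
    using tw V by (auto simp: twice_diff_on_def)
  have lin': "\<And>y. y \<in> V \<Longrightarrow> linear (a (\<phi> y))" by (rule lin)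
  have L: "(\<lambda>y. a (\<phi> y) (FD \<phi> y u)) differentiable (at x)"
    "FD (\<lambda>y. a (\<phi> y) (FD \<phi> y u)) x v = a (\<phi> x) (FD (\<lambda>y. FD \<phi> y u) x v) + FD (\<lambda>y. a y (FD \<phi> x u)) (\<phi> x) (FD \<phi> x v)" for u v
    using FD_linear_family[where a=a and \<phi>=\<phi> and w="\<lambda>y. FD \<phi> y u", OF V \<phi> lin' a] by blast+
  show "(\<lambda>y. a (\<phi> y) (FD \<phi> y v)) differentiable (at x)" by (rule L(1))
  show "FD (\<lambda>y. a (\<phi> y) (FD \<phi> y w)) x v - FD (\<lambda>y. a (\<phi> y) (FD \<phi> y v)) x w
     = FD (\<lambda>y. a y (FD \<phi> x w)) (\<phi> x) (FD \<phi> x v) - FD (\<lambda>y. a y (FD \<phi> x v)) (\<phi> x) (FD \<phi> x w)"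
    unfolding L(2) using second_derivative_symmetric[OF V tw, of v w] by simp
qed

lemma twice_diff_on_compose:
  fixes f :: "'a::euclidean_space \<Rightarrow> 'b::euclidean_space" and g :: "'b \<Rightarrow> 'c::real_normed_vector"
  assumes f: "twice_diff_on U f" "open U" and g: "twice_diff_on V g" and sub: "f ` U \<subseteq> V"
  shows "twice_diff_on U (\<lambda>x. g (f x))"
  unfolding twice_diff_on_def
proof (intro conjI ballI allI)
  fix x v assume x: "x \<in> U"
  have f1: "f differentiable (at y)" and f2: "(\<lambda>y. FD f y v) differentiable (at y)"
   and g1: "g differentiable (at (f y))" and g2: "(\<lambda>z. FD g z w) differentiable (at (f y))" if "y \<in> U" for y v w
    using assms that by (auto simp: twice_diff_on_def)
  show "(\<lambda>x. g (f x)) differentiable (at x)"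
    using differentiable_chain_at[OF f1 g1] x by (simp add: o_def)
  show "(\<lambda>y. FD (\<lambda>x. g (f x)) y v) differentiable (at x)"
  proof (rule differentiable_cong[OF f(2) x])
    show "FD (\<lambda>x. g (f x)) y v = FD g (f y) (FD f y v)" if "y \<in> U" for y
      by (rule FD_chain[OF f1 g1]) (fact that)+
    show "(\<lambda>y. FD g (f y) (FD f y v)) differentiable (at x)"
      by (rule FD_linear_family(1)[OF f(2) x f1 f2 _ g2]) (use x g1 in \<open>auto intro: FD_linear\<close>)
  qed
qed

section \<open>The strong maximum principle for subharmonic functions on the plane\<close>

lemma second_derivative_nonpos_at_max:
  fixes f f' :: "real \<Rightarrow> real"
  assumes d: "d > 0" and f': "\<And>s. \<bar>s\<bar> < d \<Longrightarrow> (f has_real_derivative f' s) (at s)"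
    and L: "(f' has_real_derivative L) (at 0)"
    and max: "\<And>s. \<bar>s\<bar> < d \<Longrightarrow> f s \<le> f 0"
  shows "L \<le> 0"
proof (rule ccontr)
  assume "\<not> L \<le> 0" then have L0: "L > 0" by simp
  have f'0: "f' 0 = 0"
    by (rule DERIV_local_max[OF f' d]) (use d max in auto)
  obtain e where e: "e > 0" "\<And>h. 0 < h \<Longrightarrow> h < e \<Longrightarrow> f' 0 < f' (0 + h)"
    using DERIV_pos_inc_right[OF L L0] by blast
  define t where "t = min d e / 2"
  have t: "0 < t" "t < d" "t < e" using d e by (auto simp: t_def min_def)
  obtain s where s: "0 < s" "s < t" "f t - f 0 = (t - 0) * f' s"
    using MVT2[of 0 t f f'] t f' by auto
  have "f' s > 0" using e(2)[of s] s t f'0 by simp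
  then have "t * f' s > 0" using t by simp
  then have "f t > f 0" using s(3) by simp
  then show False using max[of t] t by simp
qed

definition laplacian :: "(complex \<Rightarrow> real) \<Rightarrow> complex \<Rightarrow> real" where
  "laplacian G x = FD (\<lambda>y. FD G y 1) x 1 + FD (\<lambda>y. FD G y \<i>) x \<i>"

text \<open>Hopf's barrier \<open>1/|x - q|^2 - 1/|z - q|^2 - k|x - z|^2\<close>. The function \<open>1/|x - q|^2\<close> has Laplacian
\<open>4/|x - q|^4 > 0\<close>. The last term makes the barrier negative at all points other than \<open>z\<close> that
are outside the open disc around \<open>q\<close> through \<open>z\<close>, and costs only \<open>4k\<close> in the Laplacian.\<close>

definition barrier :: "real \<Rightarrow> complex \<Rightarrow> complex \<Rightarrow> complex \<Rightarrow> real" where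
  "barrier k z q x = inverse ((Re x - Re q)\<^sup>2 + (Im x - Im q)\<^sup>2)
     - inverse ((Re z - Re q)\<^sup>2 + (Im z - Im q)\<^sup>2)
     - k * ((Re x - Re z)\<^sup>2 + (Im x - Im z)\<^sup>2)"

lemma barrier_line:
  fixes X Y a b c k :: real
  assumes "(X + s)\<^sup>2 + Y\<^sup>2 \<noteq> 0"
  shows "((\<lambda>s. inverse ((X + s)\<^sup>2 + Y\<^sup>2) - c - k * ((a + s)\<^sup>2 + b\<^sup>2)) has_real_derivative
      - 2 * (X + s) / ((X + s)\<^sup>2 + Y\<^sup>2)\<^sup>2 - 2 * k * (a + s)) (at s)"
    "((\<lambda>s. - 2 * (X + s) / ((X + s)\<^sup>2 + Y\<^sup>2)\<^sup>2 - 2 * k * (a + s)) has_real_derivative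
      (- 2 / ((X + s)\<^sup>2 + Y\<^sup>2)\<^sup>2 + 8 * (X + s)\<^sup>2 / ((X + s)\<^sup>2 + Y\<^sup>2)^3 - 2 * k)) (at s)"
proof -
  define n where "n = (X + s)\<^sup>2 + Y\<^sup>2"
  have n: "n \<noteq> 0" using assms by (simp add: n_def)
  show "((\<lambda>s. inverse ((X + s)\<^sup>2 + Y\<^sup>2) - c - k * ((a + s)\<^sup>2 + b\<^sup>2)) has_real_derivative
      - 2 * (X + s) / ((X + s)\<^sup>2 + Y\<^sup>2)\<^sup>2 - 2 * k * (a + s)) (at s)"
    apply (rule derivative_eq_intros refl assms)+
    using n unfolding n_def[symmetric] by (simp add: field_simps power2_eq_square)
  show "((\<lambda>s. - 2 * (X + s) / ((X + s)\<^sup>2 + Y\<^sup>2)\<^sup>2 - 2 * k * (a + s)) has_real_derivative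
      (- 2 / ((X + s)\<^sup>2 + Y\<^sup>2)\<^sup>2 + 8 * (X + s)\<^sup>2 / ((X + s)\<^sup>2 + Y\<^sup>2)^3 - 2 * k)) (at s)"
  proof -
    have d1: "((\<lambda>s. (X + s)\<^sup>2 + Y\<^sup>2) has_real_derivative 2 * (X + s)) (at s)"
      by (auto intro!: derivative_eq_intros)
    have d2: "((\<lambda>s. ((X + s)\<^sup>2 + Y\<^sup>2)\<^sup>2) has_real_derivative 2 * n * (2 * (X + s))) (at s)"
      by (rule DERIV_cong[OF DERIV_power[OF d1, of 2]]) (simp flip: n_def)
    have d3: "((\<lambda>s. - 2 * (X + s)) has_real_derivative - 2) (at s)"
      by (rule derivative_eq_intros refl)+ simp
    have d4: "((\<lambda>s. 2 * k * (a + s)) has_real_derivative 2 * k) (at s)"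
      by (auto intro!: derivative_eq_intros)
    have "((\<lambda>s. - 2 * (X + s) / ((X + s)\<^sup>2 + Y\<^sup>2)\<^sup>2 - 2 * k * (a + s)) has_real_derivative
      (- 2 * n\<^sup>2 - - 2 * (X + s) * (2 * n * (2 * (X + s)))) / (n\<^sup>2 * n\<^sup>2) - 2 * k) (at s)"
      using DERIV_diff[OF DERIV_divide[OF d3 d2] d4] n unfolding n_def[symmetric] by (simp only: power_eq_0_iff) simp
    moreover have "(- 2 * n\<^sup>2 - - 2 * (X + s) * (2 * n * (2 * (X + s)))) / (n\<^sup>2 * n\<^sup>2)
       = - 2 / n\<^sup>2 + 8 * (X + s)\<^sup>2 / n^3"
      using n by (simp add: field_simps power2_eq_square power3_eq_cube)
    ultimately show ?thesis unfolding n_def[symmetric] by simp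
  qed
qed

text \<open>Hopf's argument: add a small multiple \<open>\<epsilon> h\<close> of the barrier to \<open>G\<close>. On a small circle around the
touching point \<open>z\<close> the sum stays below \<open>m\<close>: where \<open>h \<ge> 0\<close> the point lies in the open disc, where
\<open>G < m\<close> with a margin by compactness, and elsewhere \<open>h < 0\<close>. At \<open>z\<close> the sum equals \<open>m\<close>.
So it has an interior maximum, at which both second derivatives are nonpositive; but its Laplacian is
positive.\<close>

lemma no_touching_disc:
  fixes G :: "complex \<Rightarrow> real"
  assumes U: "open U" "twice_diff_on U G"
    and sub: "\<And>x. x \<in> U \<Longrightarrow> laplacian G x \<ge> 0"
    and le: "\<And>x. x \<in> U \<Longrightarrow> G x \<le> m"
    and z: "z \<in> U" "G z = m" "q \<noteq> z"
    and lt: "\<And>x. x \<in> U \<Longrightarrow> dist x q < dist z q \<Longrightarrow> G x < m"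
  shows False
proof -
  define r where "r = dist z q"
  have r: "r > 0" using z by (simp add: r_def)
  \<comment> \<open>\<open>4/|x - q|^4 \<ge> 1/(4r^4)\<close> within distance \<open>2r\<close> of \<open>q\<close>, so \<open>4k = 1/(8r^4)\<close> is affordable\<close>
  define k where "k = 1 / (32 * r^4)"
  have k: "k > 0" using r by (simp add: k_def)
  define h where "h = barrier k z q"
  obtain s0 where s0: "s0 > 0" "cball z s0 \<subseteq> U" using U z open_contains_cball by metis
  define s where "s = min s0 (r/2)"
  have s: "s > 0" "cball z s \<subseteq> U" "s < r" using s0 r by (auto simp: s_def min_def)
  have sqd: "(Re x - Re y)\<^sup>2 + (Im x - Im y)\<^sup>2 = (dist x y)\<^sup>2" for x y :: complex
    by (simp add: dist_norm cmod_power2)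
  have h_eq: "h x = inverse ((dist x q)\<^sup>2) - inverse (r\<^sup>2) - k * (dist x z)\<^sup>2" for x
    by (simp add: h_def barrier_def sqd r_def)
  have dq: "0 < dist x q" "dist x q < 2 * r" if "x \<in> cball z s" for x
    using that s(3) dist_triangle[of z q x] dist_triangle[of x q z] by (auto simp: r_def dist_commute)
  have Gc: "continuous_on (cball z s) G"
    using U(2) s(2) by (intro continuous_at_imp_continuous_on)
      (auto simp: twice_diff_on_def intro: differentiable_imp_continuous_within)
  have hc: "continuous_on (cball z s) h"
    unfolding h_eq using dq(1) by (intro continuous_intros) force
  have "\<exists>\<epsilon>>0. \<forall>x\<in>sphere z s. G x + \<epsilon> * h x < m"
  proof -
    define T where "T = {x \<in> sphere z s. h x \<ge> 0}"
    have T: "compact T"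
    proof -
      have "continuous_on (sphere z s) h" by (rule continuous_on_subset[OF hc]) auto
      then have "closed (sphere z s \<inter> h -` {0..})" by (intro continuous_closed_preimage) auto
      moreover have "sphere z s \<inter> h -` {0..} = T" by (auto simp: T_def)
      ultimately have "compact (sphere z s \<inter> T)" by (intro compact_Int_closed) auto
      moreover have "sphere z s \<inter> T = T" by (auto simp: T_def)
      ultimately show ?thesis by simp
    qed
    have GT: "G x < m" if "x \<in> T" for x
    proof -
      have x: "x \<in> cball z s" "dist x z = s" using that by (auto simp: T_def dist_commute)
      have "inverse ((dist x q)\<^sup>2) \<ge> inverse (r\<^sup>2) + k * s\<^sup>2" using that x by (auto simp: T_def h_eq)
      moreover have "k * s\<^sup>2 > 0" using k s by simp
      ultimately have "inverse (r\<^sup>2) < inverse ((dist x q)\<^sup>2)" by linarith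
      then have "(dist x q)\<^sup>2 < r\<^sup>2" using dq[OF x(1)] r by (metis inverse_less_iff_less zero_less_power)
      then have "dist x q < r" using r by (simp add: power2_less_imp_less)
      then show ?thesis using lt[of x] x s(2) by (auto simp: r_def)
    qed
    show ?thesis
    proof (cases "T = {}")
      case True
      then have "G x + 1 * h x < m" if "x \<in> sphere z s" for x
        using that le[of x] s(2) by (auto simp: T_def not_le) (smt (verit) mem_cball subset_iff mem_sphere order_refl)
      then show ?thesis by (intro exI[of _ 1]) auto
    next
      case False
      have Tc: "T \<subseteq> cball z s" by (auto simp: T_def)
      obtain x1 where x1: "x1 \<in> T" "\<And>x. x \<in> T \<Longrightarrow> G x \<le> G x1"
        using continuous_attains_sup[OF T False continuous_on_subset[OF Gc Tc]] by blast
      obtain x2 where x2: "x2 \<in> T" "\<And>x. x \<in> T \<Longrightarrow> h x \<le> h x2"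
        using continuous_attains_sup[OF T False continuous_on_subset[OF hc Tc]] by blast
      define \<epsilon> where "\<epsilon> = (m - G x1) / (2 * (h x2 + 1))"
      have h2: "h x2 \<ge> 0" using x2 by (auto simp: T_def)
      have \<epsilon>: "\<epsilon> > 0" using GT[OF x1(1)] h2 by (simp add: \<epsilon>_def)
      have "G x + \<epsilon> * h x < m" if x: "x \<in> sphere z s" for x
      proof (cases "x \<in> T")
        case True
        have "\<epsilon> * h x \<le> \<epsilon> * (h x2 + 1)" using x2(2)[OF True] \<epsilon> by (intro mult_left_mono) auto
        also have "\<dots> = (m - G x1) / 2" using h2 by (simp add: \<epsilon>_def field_simps)
        also have "\<dots> < m - G x1" using GT[OF x1(1)] by simp
        finally show ?thesis using x1(2)[OF True] by simp
      next
        case False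
        then have "h x < 0" using x by (auto simp: T_def)
        then have "\<epsilon> * h x < 0" using \<epsilon> by (simp add: mult_pos_neg)
        then show ?thesis using le[of x] x s(2) by (smt (verit) mem_cball subset_iff mem_sphere order_refl)
      qed
      then show ?thesis using \<epsilon> by blast
    qed
  qed
  then obtain \<epsilon> where \<epsilon>: "\<epsilon> > 0" "\<And>x. x \<in> sphere z s \<Longrightarrow> G x + \<epsilon> * h x < m" by blast
  define F where "F = (\<lambda>x. G x + \<epsilon> * h x)"
  have "continuous_on (cball z s) F" unfolding F_def by (intro continuous_intros Gc hc)
  then obtain x1 where x1: "x1 \<in> cball z s" "\<And>x. x \<in> cball z s \<Longrightarrow> F x \<le> F x1"
    using continuous_attains_sup[OF compact_cball, of z s F] s(1) by auto
  have "F z = m" using z by (simp add: F_def h_eq r_def)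
  then have "F x1 \<ge> m" using x1(2)[of z] s by simp
  then have x1b: "x1 \<in> ball z s" using \<epsilon>(2)[of x1] x1(1) by (force simp: F_def)
  obtain d where d: "d > 0" "ball x1 d \<subseteq> ball z s" using x1b openE[OF open_ball] by blast
  define N where "N = (Re x1 - Re q)\<^sup>2 + (Im x1 - Im q)\<^sup>2"
  have N: "N = (dist x1 q)\<^sup>2" by (simp add: N_def sqd)
  have test: "FD (\<lambda>y. FD G y v) x1 v + \<epsilon> * h2 \<le> 0"
    if v: "norm v = 1" and h': "\<And>t. \<bar>t\<bar> < d \<Longrightarrow> ((\<lambda>t. h (x1 + t *\<^sub>R v)) has_real_derivative h' t) (at t)"
      and h2: "(h' has_real_derivative h2) (at 0)" for v h' h2
  proof (rule second_derivative_nonpos_at_max[OF d(1)])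
    have inU: "x1 + t *\<^sub>R v \<in> ball z s" if "\<bar>t\<bar> < d" for t
      using that v d(2) by (intro subsetD[OF d(2)]) (simp add: dist_norm)
    show "((\<lambda>t. F (x1 + t *\<^sub>R v)) has_real_derivative FD G (x1 + t *\<^sub>R v) v + \<epsilon> * h' t) (at t)" if "\<bar>t\<bar> < d" for t
      unfolding F_def using inU[OF that] U(2) s(2)
      by (intro DERIV_add DERIV_cmult h' that has_real_derivative_along_line) (force simp: twice_diff_on_def)
    have "((\<lambda>t. FD G (x1 + t *\<^sub>R v) v) has_real_derivative FD (\<lambda>y. FD G y v) (x1 + 0 *\<^sub>R v) v) (at 0)"
      using inU[of 0] d(1) U(2) s(2)
      by (intro has_real_derivative_along_line[of "\<lambda>y. FD G y v"]) (force simp: twice_diff_on_def)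
    then show "((\<lambda>t. FD G (x1 + t *\<^sub>R v) v + \<epsilon> * h' t) has_real_derivative FD (\<lambda>y. FD G y v) x1 v + \<epsilon> * h2) (at 0)"
      by (intro DERIV_add DERIV_cmult h2) simp
    show "F (x1 + t *\<^sub>R v) \<le> F (x1 + 0 *\<^sub>R v)" if "\<bar>t\<bar> < d" for t
      using x1(2)[of "x1 + t *\<^sub>R v"] inU[OF that] by auto
  qed
  have nz: "(Re x - Re q)\<^sup>2 + (Im x - Im q)\<^sup>2 \<noteq> 0" if "x \<in> ball x1 d" for x
    using dq(1)[of x] d(2) that unfolding sqd by force
  have "FD (\<lambda>y. FD G y 1) x1 1 + \<epsilon> * (- 2 / N\<^sup>2 + 8 * (Re x1 - Re q)\<^sup>2 / N^3 - 2 * k) \<le> 0"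
  proof (rule test)
    let ?X = "Re x1 - Re q" and ?Y = "Im x1 - Im q" and ?a = "Re x1 - Re z" and ?b = "Im x1 - Im z"
    let ?h' = "\<lambda>s. - 2 * (?X + s) / ((?X + s)\<^sup>2 + ?Y\<^sup>2)\<^sup>2 - 2 * k * (?a + s)"
    show "((\<lambda>t. h (x1 + t *\<^sub>R 1)) has_real_derivative ?h' t) (at t)" if "\<bar>t\<bar> < d" for t
    proof -
      have "(?X + t)\<^sup>2 + ?Y\<^sup>2 \<noteq> 0" using nz[of "x1 + t *\<^sub>R 1"] that by (simp add: dist_norm algebra_simps)
      from barrier_line(1)[OF this, of "inverse ((Re z - Re q)\<^sup>2 + (Im z - Im q)\<^sup>2)" k ?a ?b]
      show ?thesis by (simp add: h_def barrier_def algebra_simps)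
    qed
    show "(?h' has_real_derivative - 2 / N\<^sup>2 + 8 * (Re x1 - Re q)\<^sup>2 / N^3 - 2 * k) (at 0)"
      using barrier_line(2)[of ?X 0 ?Y k ?a] nz[of x1] d(1) by (simp add: N_def)
  qed simp
  moreover have "FD (\<lambda>y. FD G y \<i>) x1 \<i> + \<epsilon> * (- 2 / N\<^sup>2 + 8 * (Im x1 - Im q)\<^sup>2 / N^3 - 2 * k) \<le> 0"
  proof (rule test)
    let ?X = "Im x1 - Im q" and ?Y = "Re x1 - Re q" and ?a = "Im x1 - Im z" and ?b = "Re x1 - Re z"
    let ?h' = "\<lambda>s. - 2 * (?X + s) / ((?X + s)\<^sup>2 + ?Y\<^sup>2)\<^sup>2 - 2 * k * (?a + s)"
    show "((\<lambda>t. h (x1 + t *\<^sub>R \<i>)) has_real_derivative ?h' t) (at t)" if "\<bar>t\<bar> < d" for t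
    proof -
      have "(?X + t)\<^sup>2 + ?Y\<^sup>2 \<noteq> 0" using nz[of "x1 + t *\<^sub>R \<i>"] that by (simp add: dist_norm algebra_simps)
      from barrier_line(1)[OF this, of "inverse ((Re z - Re q)\<^sup>2 + (Im z - Im q)\<^sup>2)" k ?a ?b]
      show ?thesis by (simp add: h_def barrier_def algebra_simps)
    qed
    show "(?h' has_real_derivative - 2 / N\<^sup>2 + 8 * (Im x1 - Im q)\<^sup>2 / N^3 - 2 * k) (at 0)"
      using barrier_line(2)[of ?X 0 ?Y k ?a] nz[of x1] d(1) by (simp add: N_def add.commute)
  qed simp
  ultimately have "laplacian G x1 + \<epsilon> * ((- 2 / N\<^sup>2 + 8 * (Re x1 - Re q)\<^sup>2 / N^3 - 2 * k) + (- 2 / N\<^sup>2 + 8 * (Im x1 - Im q)\<^sup>2 / N^3 - 2 * k)) \<le> 0"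
    unfolding laplacian_def distrib_left[of \<epsilon>] by linarith
  moreover have "laplacian G x1 \<ge> 0" using sub x1(1) s(2) by blast
  moreover have "(- 2 / N\<^sup>2 + 8 * (Re x1 - Re q)\<^sup>2 / N^3 - 2 * k) + (- 2 / N\<^sup>2 + 8 * (Im x1 - Im q)\<^sup>2 / N^3 - 2 * k) > 0"
  proof -
    have N0: "N > 0" "N < (2 * r)\<^sup>2" using dq[OF x1(1)] r unfolding N by (simp, intro power_strict_mono, auto)
    have "N\<^sup>2 < ((2 * r)\<^sup>2)\<^sup>2" using N0 by (intro power_strict_mono) auto
    also have "((2 * r)\<^sup>2)\<^sup>2 = 16 * r^4" by (simp add: power_mult_distrib flip: power_mult)
    finally have N2: "N\<^sup>2 < 16 * r^4" .
    have "8 * (Re x1 - Re q)\<^sup>2 / N^3 + 8 * (Im x1 - Im q)\<^sup>2 / N^3 = 8 * N / N^3"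
      by (simp add: N_def ring_distribs add_divide_distrib)
    also have "\<dots> = 8 / N\<^sup>2" using N0 by (simp add: power2_eq_square power3_eq_cube)
    finally have "(- 2 / N\<^sup>2 + 8 * (Re x1 - Re q)\<^sup>2 / N^3 - 2 * k) + (- 2 / N\<^sup>2 + 8 * (Im x1 - Im q)\<^sup>2 / N^3 - 2 * k) = 4 / N\<^sup>2 - 4 * k"
      by (simp add: field_simps)
    moreover have "4 / N\<^sup>2 > 4 / (16 * r^4)" using N0 N2 r by (intro divide_strict_left_mono) auto
    moreover have "4 / (16 * r^4) > 4 * k" using r by (simp add: k_def field_simps)
    ultimately show ?thesis by linarith
  qed
  ultimately show False using \<epsilon>(1) by (smt (verit) mult_pos_pos)
qed

text \<open>If \<open>G(q) < m\<close>, grow a disc around \<open>q\<close> until it first meets \<open>{G = m}\<close>. It does so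
before it leaves \<open>ball c e\<close>, since \<open>q\<close> is closer to \<open>c\<close> than to the boundary.\<close>

lemma strong_maximum_principle:
  fixes G :: "complex \<Rightarrow> real"
  assumes tw: "twice_diff_on (ball c e) G"
    and sub: "\<And>x. x \<in> ball c e \<Longrightarrow> laplacian G x \<ge> 0"
    and le: "\<And>x. x \<in> ball c e \<Longrightarrow> G x \<le> m"
    and c: "G c = m" and q: "q \<in> ball c (e/2)"
  shows "G q = m"
proof (rule ccontr)
  assume ne: "G q \<noteq> m"
  have e: "e > 0" using q by (smt (verit) mem_ball zero_le_dist field_sum_of_halves)
  define S where "S = {x \<in> cball q (dist q c). G x = m}"
  have sub2: "cball q (dist q c) \<subseteq> ball c e"
  proof
    fix x assume "x \<in> cball q (dist q c)"
    then show "x \<in> ball c e" using q dist_triangle[of c x q] by (auto simp: dist_commute)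
  qed
  have "continuous_on (cball q (dist q c)) G"
    using tw sub2 by (intro continuous_at_imp_continuous_on)
      (auto simp: twice_diff_on_def intro: differentiable_imp_continuous_within)
  then have "closed S" unfolding S_def by (intro continuous_closed_preimage_constant) auto
  moreover have "c \<in> S" using c by (simp add: S_def)
  ultimately obtain z where z: "z \<in> S" "\<And>x. x \<in> S \<Longrightarrow> dist q z \<le> dist q x"
    using distance_attains_inf[of S q] by blast
  show False
  proof (rule no_touching_disc[OF open_ball tw sub le, of z q])
    show "z \<in> ball c e" "G z = m" using z(1) sub2 by (auto simp: S_def)
    show "q \<noteq> z" using ne z(1) by (auto simp: S_def)
    fix x assume x: "x \<in> ball c e" "dist x q < dist z q"
    then have "x \<notin> S" using z(2)[of x] by (auto simp: dist_commute)
    moreover have "dist q x \<le> dist q c" using x z(2)[OF \<open>c \<in> S\<close>] by (simp add: dist_commute)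
    ultimately show "G x < m" using le[OF x(1)] by (auto simp: S_def)
  qed
qed

section \<open>Calculus on manifolds\<close>

lemma chart_atD:
  assumes "chart_at p C"
  shows "p \<in> cdom C" "open (cdom C)" "open (cmap C ` cdom C)"
    "\<And>x. x \<in> cdom C \<Longrightarrow> cinv C (cmap C x) = x"
    "\<And>y. y \<in> cmap C ` cdom C \<Longrightarrow> cinv C y \<in> cdom C"
    "\<And>y. y \<in> cmap C ` cdom C \<Longrightarrow> cmap C (cinv C y) = y"
    "continuous_on (cdom C) (cmap C)" "continuous_on (cmap C ` cdom C) (cinv C)"
  using assms by (auto simp: chart_at_def homeomorphism_def)

lemma chart_image:
  assumes "chart_at p C"
  shows "cmap C ` (cdom C \<inter> V) = cmap C ` cdom C \<inter> cinv C -` V"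
  using chart_atD(4-6)[OF assms] by auto

lemma open_chart_image:
  assumes C: "chart_at p C" and "open V"
  shows "open (cmap C ` (cdom C \<inter> V))"
  unfolding chart_image[OF C]
  by (rule continuous_open_preimage[OF chart_atD(8,3)[OF C] assms(2)])

lemma isCont_chart:
  assumes C: "chart_at p C"
  shows "x \<in> cdom C \<Longrightarrow> isCont (cmap C) x"
    "y \<in> cmap C ` cdom C \<Longrightarrow> isCont (cinv C) y"
  using chart_atD(2,3,7,8)[OF C] by (auto simp: continuous_on_eq_continuous_at)

text \<open>What smooth atlases, complex atlases and their products have in common and what the chain rule needs.\<close>

definition diff_atlas :: "('m::t2_space \<Rightarrow> ('m, 'e::euclidean_space) chart) \<Rightarrow> bool" where
  "diff_atlas c \<longleftrightarrow> (\<forall>p. chart_at p (c p)) \<and>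
     (\<forall>p q. \<forall>x\<in>cmap (c p) ` (cdom (c p) \<inter> cdom (c q)).
        (\<lambda>y. cmap (c q) (cinv (c p) y)) differentiable (at x))"

lemma diff_atlas_chart: "diff_atlas c \<Longrightarrow> chart_at p (c p)"
  by (simp add: diff_atlas_def)

lemma smooth_atlas_imp_diff_atlas: "smooth_atlas c \<Longrightarrow> diff_atlas c"
  using smooth_on_imp_twice_diff_on
  unfolding smooth_atlas_def diff_atlas_def twice_diff_on_def o_def by blast

text \<open>The derivative of a holomorphic function is holomorphic.\<close>

lemma twice_diff_on_holomorphic:
  assumes "f holomorphic_on U" "open U"
  shows "twice_diff_on U f"
  unfolding twice_diff_on_def
proof (intro conjI ballI allI)
  fix x v assume x: "x \<in> U"
  have d: "f field_differentiable (at y)" if "y \<in> U" for y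
    using assms that holomorphic_on_imp_differentiable_at by blast
  then have fd: "(f has_derivative (\<lambda>h. deriv f y * h)) (at y)" if "y \<in> U" for y
    using that by (simp add: DERIV_deriv_iff_field_differentiable has_field_derivative_def[symmetric])
  show "f differentiable (at x)" using fd[OF x] by (auto simp: differentiable_def)
  have "deriv f field_differentiable (at x)"
    using holomorphic_deriv[OF assms] assms(2) x holomorphic_on_imp_differentiable_at by blast
  then have "deriv f differentiable (at x)" by (rule field_differentiable_imp_differentiable)
  then have "(\<lambda>y. deriv f y * v) differentiable (at x)" by (intro differentiable_mult) auto
  then show "(\<lambda>y. FD f y v) differentiable (at x)"
    by (rule differentiable_cong[OF assms(2) x, rotated]) (simp add: FD_eqI[OF fd])
qed

lemma complex_atlas_imp_diff_atlas: "complex_atlas c \<Longrightarrow> diff_atlas c"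
  unfolding complex_atlas_def diff_atlas_def
proof (intro conjI allI ballI)
  fix p q x assume c: "(\<forall>p. chart_at p (c p)) \<and>
     (\<forall>p q. (cmap (c q) \<circ> cinv (c p)) holomorphic_on (cmap (c p) ` (cdom (c p) \<inter> cdom (c q))))"
    and x: "x \<in> cmap (c p) ` (cdom (c p) \<inter> cdom (c q))"
  have "open (cmap (c p) ` (cdom (c p) \<inter> cdom (c q)))"
    using c chart_atD(2) open_chart_image by blast
  then show "(\<lambda>y. cmap (c q) (cinv (c p) y)) differentiable at x"
    using twice_diff_on_holomorphic[of "cmap (c q) \<circ> cinv (c p)"] c x
    unfolding twice_diff_on_def o_def by blast
qed auto

lemma euclid_simps [simp]: "cdom (euclid p) = UNIV" "cmap (euclid p) = id" "cinv (euclid p) = id"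
  by (simp_all add: euclid_def)

lemma diff_atlas_euclid: "diff_atlas euclid"
  unfolding diff_atlas_def by (auto simp: chart_at_def homeomorphism_def id_def)

lemma prod_atlas_simps:
  "cdom (prod_atlas c d p) = cdom (c (fst p)) \<times> cdom (d (snd p))"
  "cmap (prod_atlas c d p) = map_prod (cmap (c (fst p))) (cmap (d (snd p)))"
  "cinv (prod_atlas c d p) = map_prod (cinv (c (fst p))) (cinv (d (snd p)))"
  by (simp_all add: prod_atlas_def)

lemma diff_atlas_prod:
  fixes c :: "'m::t2_space \<Rightarrow> ('m, 'e::euclidean_space) chart"
    and d :: "'n::t2_space \<Rightarrow> ('n, 'f::euclidean_space) chart"
  assumes c: "diff_atlas c" and d: "diff_atlas d"
  shows "diff_atlas (prod_atlas c d)"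
  unfolding diff_atlas_def
proof (intro conjI allI ballI)
  fix p :: "'m \<times> 'n"
  note C = chart_atD[OF diff_atlas_chart[OF c, of "fst p"]]
  note D = chart_atD[OF diff_atlas_chart[OF d, of "snd p"]]
  have im: "cmap (prod_atlas c d p) ` cdom (prod_atlas c d p)
     = cmap (c (fst p)) ` cdom (c (fst p)) \<times> cmap (d (snd p)) ` cdom (d (snd p))"
    by (auto simp: prod_atlas_simps intro!: image_eqI)
  show "chart_at p (prod_atlas c d p)"
    unfolding chart_at_def im homeomorphism_def
  proof (intro conjI)
    show "p \<in> cdom (prod_atlas c d p)" using C D by (simp add: prod_atlas_simps mem_Times_iff)
    show "open (cdom (prod_atlas c d p))" using C D by (simp add: prod_atlas_simps open_Times)
    show "open (cmap (c (fst p)) ` cdom (c (fst p)) \<times> cmap (d (snd p)) ` cdom (d (snd p)))"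
      using C D by (simp add: open_Times)
    show "continuous_on (cdom (prod_atlas c d p)) (cmap (prod_atlas c d p))"
      unfolding prod_atlas_simps map_prod_def case_prod_beta
      by (intro continuous_on_Pair continuous_on_compose2[OF C(7)] continuous_on_compose2[OF D(7)] continuous_intros) auto
    show "continuous_on (cmap (c (fst p)) ` cdom (c (fst p)) \<times> cmap (d (snd p)) ` cdom (d (snd p))) (cinv (prod_atlas c d p))"
      unfolding prod_atlas_simps map_prod_def case_prod_beta
      by (intro continuous_on_Pair continuous_on_compose2[OF C(8)] continuous_on_compose2[OF D(8)] continuous_intros) auto
    show "cmap (c (fst p)) ` cdom (c (fst p)) \<times> cmap (d (snd p)) ` cdom (d (snd p))
     = cmap (c (fst p)) ` cdom (c (fst p)) \<times> cmap (d (snd p)) ` cdom (d (snd p))" by simp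
    show "\<forall>x\<in>cdom (prod_atlas c d p). cinv (prod_atlas c d p) (cmap (prod_atlas c d p) x) = x"
      using C(4) D(4) by (auto simp: prod_atlas_simps)
    show "\<forall>y\<in>cmap (c (fst p)) ` cdom (c (fst p)) \<times> cmap (d (snd p)) ` cdom (d (snd p)). cmap (prod_atlas c d p) (cinv (prod_atlas c d p) y) = y"
      using C(4) D(4) by (auto simp: prod_atlas_simps)
    show "cinv (prod_atlas c d p) ` (cmap (c (fst p)) ` cdom (c (fst p)) \<times> cmap (d (snd p)) ` cdom (d (snd p))) = cdom (prod_atlas c d p)"
      unfolding im[symmetric] image_image using C(4) D(4) by (force simp: prod_atlas_simps)
  qed
next
  fix p q :: "'m \<times> 'n" and x
  assume "x \<in> cmap (prod_atlas c d p) ` (cdom (prod_atlas c d p) \<inter> cdom (prod_atlas c d q))"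
  then have x: "fst x \<in> cmap (c (fst p)) ` (cdom (c (fst p)) \<inter> cdom (c (fst q)))"
    "snd x \<in> cmap (d (snd p)) ` (cdom (d (snd p)) \<inter> cdom (d (snd q)))"
    by (auto simp: prod_atlas_simps)
  have "(\<lambda>y. cmap (c (fst q)) (cinv (c (fst p)) y)) differentiable (at (fst x))"
    using c x by (auto simp: diff_atlas_def)
  then have 1: "(\<lambda>y. cmap (c (fst q)) (cinv (c (fst p)) (fst y))) differentiable (at x)"
    by (rule differentiable_chain_at[OF bounded_linear_imp_differentiable[OF bounded_linear_fst], unfolded o_def])
  have "(\<lambda>y. cmap (d (snd q)) (cinv (d (snd p)) y)) differentiable (at (snd x))"
    using d x by (auto simp: diff_atlas_def)
  then have 2: "(\<lambda>y. cmap (d (snd q)) (cinv (d (snd p)) (snd y))) differentiable (at x)"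
    by (rule differentiable_chain_at[OF bounded_linear_imp_differentiable[OF bounded_linear_snd], unfolded o_def])
  show "(\<lambda>y. cmap (prod_atlas c d q) (cinv (prod_atlas c d p) y)) differentiable at x"
    using differentiable_Pair[OF 1 2] by (simp add: prod_atlas_simps map_prod_def case_prod_beta)
qed

text \<open>Continuity is required separately: without it the chart representative of \<open>F\<close> at \<open>p\<close> says nothing
about \<open>F\<close>, since points near \<open>p\<close> may be mapped outside the chart at \<open>F(p)\<close>.\<close>

definition mdiff ::
    "('m::t2_space \<Rightarrow> ('m, 'e::euclidean_space) chart) \<Rightarrow>
     ('n::t2_space \<Rightarrow> ('n, 'f::euclidean_space) chart) \<Rightarrow> ('m \<Rightarrow> 'n) \<Rightarrow> 'm \<Rightarrow> bool" where
  "mdiff c d F p \<longleftrightarrow> isCont F p \<and>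
     (cmap (d (F p)) \<circ> F \<circ> cinv (c p)) differentiable (at (cmap (c p) p))"

lemma mderiv_linear: "mdiff c d F p \<Longrightarrow> linear (mderiv c d F p)"
  unfolding mdiff_def mderiv_def by (auto intro: FD_linear)

lemma mderiv_chain:
  assumes atlas: "diff_atlas c" "diff_atlas d"
    and F: "mdiff c d F p" and G: "mdiff d e G (F p)"
  shows "mdiff c e (\<lambda>x. G (F x)) p"
    "mderiv c e (\<lambda>x. G (F x)) p v = mderiv d e G (F p) (mderiv c d F p v)"
proof -
  note c = diff_atlas_chart[OF atlas(1), of p] and d = diff_atlas_chart[OF atlas(2), of "F p"]
  let ?x = "cmap (c p) p"
  let ?f = "cmap (d (F p)) \<circ> F \<circ> cinv (c p)"
  let ?g = "cmap (e (G (F p))) \<circ> G \<circ> cinv (d (F p))"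
  let ?h = "cmap (e (G (F p))) \<circ> (\<lambda>x. G (F x)) \<circ> cinv (c p)"
  have fp: "?f ?x = cmap (d (F p)) (F p)" using chart_atD(1,4)[OF c] by simp
  have f: "?f differentiable (at ?x)" using F by (simp add: mdiff_def)
  have g: "?g differentiable (at (?f ?x))" using G unfolding fp by (simp add: mdiff_def)
  have "isCont (cinv (c p)) ?x" using isCont_chart(2)[OF c] chart_atD(1)[OF c] by blast
  moreover have "isCont F (cinv (c p) ?x)" using F chart_atD(1,4)[OF c] by (simp add: mdiff_def)
  ultimately have "isCont (\<lambda>y. F (cinv (c p) y)) ?x" by (rule isCont_o2)
  then have "(\<lambda>y. F (cinv (c p) y)) \<midarrow>?x\<rightarrow> F p" using chart_atD(1,4)[OF c] by (simp add: isCont_def)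
  then have "eventually (\<lambda>y. F (cinv (c p) y) \<in> cdom (d (F p))) (at ?x)"
    using chart_atD(1,2)[OF d] topological_tendstoD by blast
  then have "eventually (\<lambda>y. F (cinv (c p) y) \<in> cdom (d (F p))) (nhds ?x)"
    using chart_atD(1)[OF d] chart_atD(1,4)[OF c] by (simp add: eventually_nhds_conv_at)
  then obtain S where S: "open S" "?x \<in> S" "\<And>y. y \<in> S \<Longrightarrow> F (cinv (c p) y) \<in> cdom (d (F p))"
    unfolding eventually_nhds by blast
  have eq: "?h y = ?g (?f y)" if "y \<in> S" for y
    using chart_atD(4)[OF d S(3)[OF that]] by simp
  have gf: "(\<lambda>y. ?g (?f y)) differentiable (at ?x)"
    using differentiable_chain_at[OF f g] by (simp add: o_def)
  have "?h differentiable (at ?x)" by (rule differentiable_cong[OF S(1,2) eq gf])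
  moreover have "isCont (\<lambda>x. G (F x)) p"
    using F G unfolding mdiff_def by (blast intro: isCont_o2)
  ultimately show "mdiff c e (\<lambda>x. G (F x)) p" by (simp add: mdiff_def)
  have "FD ?h ?x v = FD (\<lambda>y. ?g (?f y)) ?x v" by (rule fun_cong[OF FD_cong[OF S(1,2) eq]])
  also have "\<dots> = FD ?g (?f ?x) (FD ?f ?x v)" by (rule FD_chain[OF f g])
  finally show "mderiv c e (\<lambda>x. G (F x)) p v = mderiv d e G (F p) (mderiv c d F p v)"
    unfolding fp mderiv_def by simp
qed

lemma mderiv_cong:
  assumes atlas: "diff_atlas c" and U: "open U" "p \<in> U" "\<And>x. x \<in> U \<Longrightarrow> F x = G x"
  shows "mderiv c d F p = mderiv c d G p" "mdiff c d F p \<longleftrightarrow> mdiff c d G p"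
proof -
  note c = diff_atlas_chart[OF atlas, of p]
  let ?W = "cmap (c p) ` (cdom (c p) \<inter> U)"
  have W: "open ?W" "cmap (c p) p \<in> ?W"
    using open_chart_image[OF c U(1)] chart_atD(1)[OF c] U(2) by auto
  have eq: "(cmap (d (F p)) \<circ> F \<circ> cinv (c p)) y = (cmap (d (G p)) \<circ> G \<circ> cinv (c p)) y" if "y \<in> ?W" for y
    using that U chart_atD(4)[OF c] by auto
  show "mderiv c d F p = mderiv c d G p"
    unfolding mderiv_def by (rule FD_cong[OF W eq])
  have "isCont F p \<longleftrightarrow> isCont G p"
    using U by (intro isCont_cong) (auto simp: eventually_nhds)
  then show "mdiff c d F p \<longleftrightarrow> mdiff c d G p"
    unfolding mdiff_def using differentiable_cong[OF W] eq by metis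
qed

lemma mderiv_id:
  assumes atlas: "diff_atlas c"
  shows "mdiff c c (\<lambda>x. x) p" "mderiv c c (\<lambda>x. x) p v = v"
proof -
  note c = diff_atlas_chart[OF atlas, of p]
  let ?W = "cmap (c p) ` cdom (c p)"
  have W: "open ?W" "cmap (c p) p \<in> ?W"
    using chart_atD(1,3)[OF c] by auto
  have eq: "(cmap (c p) \<circ> (\<lambda>x. x) \<circ> cinv (c p)) y = y" if "y \<in> ?W" for y
    using that chart_atD(4)[OF c] by auto
  show "mdiff c c (\<lambda>x. x) p" unfolding mdiff_def by (intro conjI differentiable_cong[OF W eq] differentiable_ident) simp_all
  show "mderiv c c (\<lambda>x. x) p v = v" unfolding mderiv_def by (subst FD_cong[OF W eq]) simp_all
qed

lemma msmooth_open_twice_diff: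
  assumes "msmooth_open c d U F"
  shows "twice_diff_on (cmap (c p) ` (cdom (c p) \<inter> U \<inter> F -` cdom (d q))) (\<lambda>x. cmap (d q) (F (cinv (c p) x)))"
  using assms smooth_on_imp_twice_diff_on unfolding msmooth_open_def o_def by blast

lemma msmooth_open_mdiff:
  assumes "msmooth_open c d U F" "p \<in> U" and atlas: "diff_atlas c" "diff_atlas d"
  shows "mdiff c d F p"
  unfolding mdiff_def
proof
  note ch = diff_atlas_chart[OF atlas(1), of p] diff_atlas_chart[OF atlas(2), of "F p"]
  show "isCont F p" using assms(1,2) unfolding msmooth_open_def by (auto simp: continuous_on_eq_continuous_at)
  have "cmap (c p) p \<in> cmap (c p) ` (cdom (c p) \<inter> U \<inter> F -` cdom (d (F p)))"
    using assms(2) chart_atD(1)[OF ch(1)] chart_atD(1)[OF ch(2)] by auto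
  then show "(cmap (d (F p)) \<circ> F \<circ> cinv (c p)) differentiable at (cmap (c p) p)"
    using msmooth_open_twice_diff[OF assms(1), of p "F p"] unfolding twice_diff_on_def o_def by blast
qed

lemma mdiff_cinv:
  assumes c: "diff_atlas c" and y: "y \<in> cmap (c p) ` cdom (c p)"
  shows "mdiff euclid c (cinv (c p)) y"
proof -
  note C = chart_atD[OF diff_atlas_chart[OF c, of p]]
  have "y \<in> cmap (c p) ` (cdom (c p) \<inter> cdom (c (cinv (c p) y)))"
    using y C(4) chart_atD(1)[OF diff_atlas_chart[OF c]] by auto
  then show ?thesis using c isCont_chart(2)[OF diff_atlas_chart[OF c] y]
    unfolding mdiff_def diff_atlas_def by (simp add: o_def del: ball_simps)
qed

lemma mderiv_euclid: "mderiv euclid c F x = FD (\<lambda>y. cmap (c (F x)) (F y)) x"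
  by (simp add: mderiv_def o_def)

text \<open>On manifolds the exterior derivative at \<open>F(\<zeta>)\<close> is computed in the chart belonging to the
point \<open>F(\<zeta>)\<close>, while the form at nearby points is given in the charts of these points. Expressing
everything in the one chart at \<open>F(\<zeta>)\<close>, by the chain rule for the transition maps, reduces the
statement to Euclidean space.\<close>

lemma d1_pullback:
  fixes F :: "'a::euclidean_space \<Rightarrow> 'n::t2_space"
    and c :: "'n \<Rightarrow> ('n, 'e::euclidean_space) chart"
  assumes c: "diff_atlas c"
    and D: "open D" "\<zeta> \<in> D" "continuous_on D F"
    and tw: "twice_diff_on (D \<inter> F -` cdom (c (F \<zeta>))) (\<lambda>x. cmap (c (F \<zeta>)) (F x))"
    and lin: "\<And>x. x \<in> D \<Longrightarrow> linear (\<theta> (F x))"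
    and rep: "\<And>v. (\<lambda>y. rep1 c (F \<zeta>) \<theta> y v) differentiable (at (cmap (c (F \<zeta>)) (F \<zeta>)))"
  shows "(\<lambda>x. \<theta> (F x) (mderiv euclid c F x v)) differentiable (at \<zeta>)"
    "FD (\<lambda>x. \<theta> (F x) (mderiv euclid c F x w)) \<zeta> v - FD (\<lambda>x. \<theta> (F x) (mderiv euclid c F x v)) \<zeta> w
     = d1 c \<theta> (F \<zeta>) (mderiv euclid c F \<zeta> v) (mderiv euclid c F \<zeta> w)"
proof -
  define C where "C = c (F \<zeta>)"
  define V where "V = D \<inter> F -` cdom C"
  define \<phi> where "\<phi> = (\<lambda>x. cmap C (F x))"
  define a where "a = rep1 c (F \<zeta>) \<theta>"
  have ch: "chart_at q (c q)" for q by (rule diff_atlas_chart[OF c])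
  have chC: "chart_at (F \<zeta>) C" unfolding C_def by (rule ch)
  have V: "open V" "\<zeta> \<in> V"
    using continuous_open_preimage[OF D(3,1) chart_atD(2)[OF chC]] D(2) chart_atD(1)[OF chC] by (auto simp: V_def)
  have tw': "twice_diff_on V \<phi>" using tw by (simp add: V_def \<phi>_def C_def)
  have inv: "cinv C (\<phi> x) = F x" "\<phi> x \<in> cmap C ` cdom C" if "x \<in> V" for x
    using that chart_atD(4)[OF chC] by (auto simp: V_def \<phi>_def)
  have md: "mdiff euclid c (cinv C) (\<phi> x)" if "x \<in> V" for x
    unfolding C_def by (rule mdiff_cinv[OF c inv(2)[OF that, unfolded C_def]])
  have eq: "\<theta> (F x) (mderiv euclid c F x u) = a (\<phi> x) (FD \<phi> x u)" if x: "x \<in> V" for x u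
  proof -
    have \<phi>d: "\<phi> differentiable (at x)" using tw' x by (simp add: twice_diff_on_def)
    have g: "(\<lambda>y. cmap (c (F x)) (cinv C y)) differentiable (at (\<phi> x))"
      using md[OF x] inv(1)[OF x] by (simp add: mdiff_def o_def)
    have "FD (\<lambda>y. cmap (c (F x)) (F y)) x u = FD (\<lambda>y. cmap (c (F x)) (cinv C (\<phi> y))) x u"
      using FD_cong[OF V(1) x, of "\<lambda>y. cmap (c (F x)) (F y)" "\<lambda>y. cmap (c (F x)) (cinv C (\<phi> y))"] inv(1) by simp
    also have "\<dots> = FD (\<lambda>y. cmap (c (F x)) (cinv C y)) (\<phi> x) (FD \<phi> x u)"
      by (rule FD_chain[OF \<phi>d g])
    finally show ?thesis by (simp add: a_def rep1_def mderiv_euclid inv(1)[OF x] flip: C_def)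
  qed
  have la: "linear (a (\<phi> x))" if x: "x \<in> V" for x
  proof -
    have "linear (\<lambda>u. \<theta> (F x) (mderiv euclid c (cinv C) (\<phi> x) u))"
      using linear_compose[OF mderiv_linear[OF md[OF x]] lin[of x]] x by (simp add: o_def V_def)
    moreover have "a (\<phi> x) = (\<lambda>u. \<theta> (F x) (mderiv euclid c (cinv C) (\<phi> x) u))"
      by (simp add: fun_eq_iff a_def rep1_def inv(1)[OF x] flip: C_def)
    ultimately show ?thesis by (simp only:)
  qed
  have ra: "(\<lambda>y. a y v) differentiable (at (\<phi> \<zeta>))" for v
    using rep by (simp add: a_def \<phi>_def C_def)
  note P = exterior_derivative_pullback[of V \<zeta> \<phi> a, OF V tw' la ra]
  have cong: "FD (\<lambda>x. \<theta> (F x) (mderiv euclid c F x u)) \<zeta> = FD (\<lambda>x. a (\<phi> x) (FD \<phi> x u)) \<zeta>" for u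
    by (rule FD_cong[OF V eq])
  show "(\<lambda>x. \<theta> (F x) (mderiv euclid c F x v)) differentiable (at \<zeta>)"
    by (rule differentiable_cong[OF V eq P(1)])
  have m: "mderiv euclid c F \<zeta> u = FD \<phi> \<zeta> u" for u by (simp add: mderiv_euclid \<phi>_def C_def)
  show "FD (\<lambda>x. \<theta> (F x) (mderiv euclid c F x w)) \<zeta> v - FD (\<lambda>x. \<theta> (F x) (mderiv euclid c F x v)) \<zeta> w
     = d1 c \<theta> (F \<zeta>) (mderiv euclid c F \<zeta> v) (mderiv euclid c F \<zeta> w)"
  proof -
    have "FD (\<lambda>x. \<theta> (F x) (mderiv euclid c F x w)) \<zeta> v - FD (\<lambda>x. \<theta> (F x) (mderiv euclid c F x v)) \<zeta> w
       = FD (\<lambda>x. a (\<phi> x) (FD \<phi> x w)) \<zeta> v - FD (\<lambda>x. a (\<phi> x) (FD \<phi> x v)) \<zeta> w"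
      by (simp only: cong)
    also have "\<dots> = FD (\<lambda>y. a y (FD \<phi> \<zeta> w)) (\<phi> \<zeta>) (FD \<phi> \<zeta> v) - FD (\<lambda>y. a y (FD \<phi> \<zeta> v)) (\<phi> \<zeta>) (FD \<phi> \<zeta> w)"
      by (rule P(2))
    finally show ?thesis unfolding m d1_def by (simp add: a_def \<phi>_def C_def)
  qed
qed

section \<open>Nondegenerate forms, the Reeb field and the Liouville form\<close>

text \<open>The map \<open>v \<mapsto> B(v, \<cdot>)\<close> into the dual space, identified with the space itself by the inner
product, is injective and hence bijective.\<close>

lemma nondegenerate_represents:
  fixes B :: "'e::euclidean_space \<Rightarrow> 'e \<Rightarrow> real"
  assumes B: "bilinear B" and nd: "\<And>v. v \<noteq> 0 \<Longrightarrow> \<exists>w. B v w \<noteq> 0" and l: "linear l"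
  shows "\<exists>!Y. \<forall>w. B Y w = l w"
proof -
  have lin: "linear (B v)" "linear (\<lambda>v. B v w)" for v w
    using B by (auto simp: bilinear_def)
  have expand: "m w = (\<Sum>i\<in>Basis. m i *\<^sub>R i) \<bullet> w" if "linear m" for m :: "'e \<Rightarrow> real" and w
  proof -
    have "m w = m (\<Sum>i\<in>Basis. (w \<bullet> i) *\<^sub>R i)" by (simp add: euclidean_representation)
    also have "\<dots> = (\<Sum>i\<in>Basis. (w \<bullet> i) * m i)"
      using that by (simp add: linear_sum linear_cmul)
    also have "\<dots> = (\<Sum>i\<in>Basis. m i *\<^sub>R i) \<bullet> w"
      by (simp add: inner_sum_left inner_commute[of w] mult.commute)
    finally show ?thesis .
  qed
  define L where "L v = (\<Sum>i\<in>Basis. B v i *\<^sub>R i)" for v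
  have L: "L v \<bullet> w = B v w" for v w unfolding L_def by (rule expand[OF lin(1), symmetric])
  have linL: "linear L"
    unfolding L_def
    by (intro linearI)
      (simp_all add: linear_add[OF lin(2)] linear_cmul[OF lin(2)] scaleR_left.add sum.distrib scaleR_sum_right)
  have "inj L"
    unfolding linear_injective_0[OF linL]
  proof (intro allI impI)
    fix v assume "L v = 0" then have "B v w = 0" for w using L[of v w] by simp
    then show "v = 0" using nd by blast
  qed
  then have "surj L" using linear_injective_imp_surjective[OF linL] by blast
  then obtain Y where "L Y = (\<Sum>i\<in>Basis. l i *\<^sub>R i)" by (metis surjD)
  then have "\<forall>w. B Y w = l w" using L expand[OF l] by metis
  moreover have "Y = Y'" if "\<forall>w. B Y w = l w" "\<forall>w. B Y' w = l w" for Y Y'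
  proof (rule ccontr)
    assume "Y \<noteq> Y'"
    then obtain w where "B (Y - Y') w \<noteq> 0" using nd[of "Y - Y'"] by auto
    moreover have "B (Y - Y') w = B Y w - B Y' w" by (rule linear_diff[OF lin(2)])
    ultimately show False using that by simp
  qed
  ultimately show ?thesis by blast
qed

lemma rep1_linear:
  assumes c: "diff_atlas c" and \<theta>: "linear (\<theta> (cinv (c p) x))" and x: "x \<in> cmap (c p) ` cdom (c p)"
  shows "linear (rep1 c p \<theta> x)"
proof -
  have "rep1 c p \<theta> x = \<theta> (cinv (c p) x) \<circ> mderiv euclid c (cinv (c p)) x"
    by (auto simp: rep1_def)
  then show ?thesis using linear_compose[OF mderiv_linear[OF mdiff_cinv[OF c x]] \<theta>] by simp
qed

lemma rep1_center:
  assumes c: "diff_atlas c"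
  shows "rep1 c p \<theta> (cmap (c p) p) v = \<theta> p v"
proof -
  note C = chart_atD[OF diff_atlas_chart[OF c, of p]]
  have m: "mderiv euclid c (cinv (c p)) (cmap (c p) p) v = v"
    unfolding mderiv_euclid C(4)[OF C(1)]
    by (subst FD_cong[OF C(3), where g="\<lambda>x. x"]) (use C in auto)
  show ?thesis by (simp add: rep1_def m C(4)[OF C(1)])
qed

lemma one_form_rep_differentiable:
  assumes "one_form_on c U \<theta>" "x \<in> cmap (c q) ` (cdom (c q) \<inter> U)"
  shows "(\<lambda>y. rep1 c q \<theta> y v) differentiable (at x)"
  using assms smooth_on_imp_twice_diff_on unfolding one_form_on_def twice_diff_on_def by blast

lemma d1_alternating: "d1 c \<theta> p v w = - d1 c \<theta> p w v"
  by (simp add: d1_def)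

lemma d1_bilinear:
  fixes c :: "'m::t2_space \<Rightarrow> ('m, 'e::euclidean_space) chart"
  assumes c: "diff_atlas c" and \<theta>: "one_form_on c U \<theta>" and p: "p \<in> U"
  shows "bilinear (d1 c \<theta> p)"
proof -
  note C = chart_atD[OF diff_atlas_chart[OF c, of p]]
  let ?x = "cmap (c p) p"
  let ?W = "cmap (c p) ` (cdom (c p) \<inter> U)"
  have W: "open ?W" "?x \<in> ?W"
    using open_chart_image[OF diff_atlas_chart[OF c, of p]] \<theta> p C(1) by (auto simp: one_form_on_def)
  note df = one_form_rep_differentiable[OF \<theta> W(2)]
  have lr: "linear (rep1 c p \<theta> x)" if "x \<in> ?W" for x
    using that \<theta> C(4) by (intro rep1_linear[OF c]) (auto simp: one_form_on_def)
  have 1: "linear (\<lambda>v. FD (\<lambda>x. rep1 c p \<theta> x w) ?x v)" for w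
    using FD_linear[OF df] .
  have 2: "linear (\<lambda>w. FD (\<lambda>x. rep1 c p \<theta> x w) ?x v)" for v
  proof
    fix w w' :: 'e and r :: real
    have "FD (\<lambda>x. rep1 c p \<theta> x (w + w')) ?x = FD (\<lambda>x. rep1 c p \<theta> x w + rep1 c p \<theta> x w') ?x"
      by (rule FD_cong[OF W]) (rule linear_add[OF lr])
    also have "\<dots> = (\<lambda>v. FD (\<lambda>x. rep1 c p \<theta> x w) ?x v + FD (\<lambda>x. rep1 c p \<theta> x w') ?x v)"
      by (rule FD_eqI[OF has_derivative_add[OF FD_works[OF df] FD_works[OF df]]])
    finally show "FD (\<lambda>x. rep1 c p \<theta> x (w + w')) ?x v = FD (\<lambda>x. rep1 c p \<theta> x w) ?x v + FD (\<lambda>x. rep1 c p \<theta> x w') ?x v"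
      by simp
    have "FD (\<lambda>x. rep1 c p \<theta> x (r *\<^sub>R w)) ?x = FD (\<lambda>x. r *\<^sub>R rep1 c p \<theta> x w) ?x"
      by (rule FD_cong[OF W]) (rule linear_cmul[OF lr])
    also have "\<dots> = (\<lambda>v. r *\<^sub>R FD (\<lambda>x. rep1 c p \<theta> x w) ?x v)"
      by (rule FD_eqI[OF has_derivative_scaleR_right[OF FD_works[OF df]]])
    finally show "FD (\<lambda>x. rep1 c p \<theta> x (r *\<^sub>R w)) ?x v = r *\<^sub>R FD (\<lambda>x. rep1 c p \<theta> x w) ?x v"
      by simp
  qed
  show ?thesis unfolding bilinear_def d1_def by (auto intro!: linear_compose_sub 1 2)
qed

text \<open>The contact condition only provides nondegeneracy of \<open>d\<alpha>\<close> on \<open>ker \<alpha>\<close>. The form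
\<open>B = d\<alpha> + \<alpha> \<otimes> \<alpha>\<close> is nondegenerate on the whole tangent space, and the Reeb vector is the
vector \<open>Y\<close> with \<open>B(Y, \<cdot>) = \<alpha>\<close>: since \<open>B(Y, Y) = \<alpha>(Y)^2 = \<alpha>(Y)\<close>, either \<open>\<alpha>(Y) = 1\<close>, and
then \<open>d\<alpha>(Y, \<cdot>) = 0\<close>, or \<open>\<alpha>(Y) = 0\<close>, and then \<open>d\<alpha>(Y, \<cdot>) = \<alpha>\<close> vanishes on
\<open>ker \<alpha>\<close>, so that \<open>Y = 0\<close> and \<open>\<alpha> = 0\<close>.\<close>

lemma reeb_properties:
  fixes c :: "'y::t2_space \<Rightarrow> ('y, 'f::euclidean_space) chart"
  assumes c: "diff_atlas c" and \<alpha>: "contact_form c \<alpha>"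
  shows "\<alpha> y (reeb c \<alpha> y) = 1" "d1 c \<alpha> y (reeb c \<alpha> y) v = 0"
proof -
  let ?d = "d1 c \<alpha> y"
  have of: "one_form_on c UNIV \<alpha>" using \<alpha> by (simp add: contact_form_def)
  have d: "bilinear ?d" by (rule d1_bilinear[OF c of]) simp
  have a: "linear (\<alpha> y)" using of by (simp add: one_form_on_def)
  define B where "B v w = ?d v w + \<alpha> y v * \<alpha> y w" for v w
  have self: "?d v v = 0" for v by (simp add: d1_def)
  have lin: "linear (\<lambda>v. ?d v w)" "linear (?d w)" for w using d by (auto simp: bilinear_def)
  have Blin: "bilinear B"
    unfolding bilinear_def B_def
    by (intro conjI allI linear_compose_add lin)
      (auto intro!: linearI simp: linear_add[OF a] linear_cmul[OF a] algebra_simps)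
  have nd0: "v = 0" if "\<alpha> y v = 0" "\<And>w. \<alpha> y w = 0 \<Longrightarrow> ?d v w = 0" for v
    using \<alpha> that unfolding contact_form_def by blast
  have nd: "\<exists>w. B v w \<noteq> 0" if v: "v \<noteq> 0" for v
  proof (rule ccontr)
    assume "\<not> (\<exists>w. B v w \<noteq> 0)"
    then have B0: "B v w = 0" for w by blast
    then have "\<alpha> y v = 0" using B0[of v] by (simp add: B_def self)
    moreover from this have "?d v w = 0" for w using B0[of w] by (simp add: B_def)
    ultimately show False using nd0 v by blast
  qed
  from nondegenerate_represents[OF Blin nd a]
  obtain Y where Y: "\<And>w. B Y w = \<alpha> y w" and uniq: "\<And>Y'. (\<forall>w. B Y' w = \<alpha> y w) \<Longrightarrow> Y' = Y"
    by metis
  have "\<alpha> y Y * \<alpha> y Y = \<alpha> y Y" using Y[of Y] by (simp add: B_def self)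
  moreover have "\<alpha> y Y \<noteq> 0"
  proof
    assume 0: "\<alpha> y Y = 0"
    then have "?d Y w = \<alpha> y w" for w using Y[of w] by (simp add: B_def)
    moreover from this have "Y = 0" using nd0[OF 0] by simp
    ultimately have "\<alpha> y w = 0" for w using linear_0[OF lin(1)] by metis
    then show False using \<alpha> unfolding contact_form_def by blast
  qed
  ultimately have 1: "\<alpha> y Y = 1" by simp
  then have "\<alpha> y Y = 1 \<and> (\<forall>v. ?d Y v = 0)" using Y by (simp add: B_def)
  moreover have "Y' = Y" if "\<alpha> y Y' = 1 \<and> (\<forall>v. ?d Y' v = 0)" for Y'
    using that by (intro uniq) (simp add: B_def)
  ultimately have "\<alpha> y (reeb c \<alpha> y) = 1 \<and> (\<forall>v. ?d (reeb c \<alpha> y) v = 0)"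
    unfolding reeb_def by (rule theI)
  then show "\<alpha> y (reeb c \<alpha> y) = 1" "d1 c \<alpha> y (reeb c \<alpha> y) v = 0" by auto
qed

lemma rep1_liouville:
  fixes cY :: "'y::t2_space \<Rightarrow> ('y, 'f::euclidean_space) chart"
  assumes c: "diff_atlas cY" and x: "x \<in> cmap (cY y) ` cdom (cY y)"
  shows "rep1 (collar_atlas cY) (y, R) (liouville_form \<alpha>) (x, s) (w, q) = s * rep1 cY y \<alpha> x w"
proof -
  let ?g = "\<lambda>z. cmap (cY (cinv (cY y) x)) (cinv (cY y) z)"
  have g: "?g differentiable (at x)" using mdiff_cinv[OF c x] by (simp add: mdiff_def o_def)
  have "((\<lambda>z. ?g (fst z)) has_derivative (\<lambda>v. FD ?g x (fst v))) (at (x, s))"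
    by (rule has_derivative_compose[OF has_derivative_fst[OF has_derivative_ident]]) (simp add: FD_works[OF g])
  then have "((\<lambda>z. (?g (fst z), snd z)) has_derivative (\<lambda>v. (FD ?g x (fst v), snd v))) (at (x, s))"
    by (intro has_derivative_Pair has_derivative_snd has_derivative_ident)
  then have "mderiv euclid (collar_atlas cY) (cinv (collar_atlas cY (y, R))) (x, s) (w, q) = (FD ?g x w, q)"
    using FD_eqI by (fastforce simp: mderiv_euclid prod_atlas_simps map_prod_def case_prod_beta)
  then show ?thesis by (simp add: rep1_def liouville_form_def prod_atlas_simps mderiv_euclid)
qed

lemma liouville_rep_derivative:
  fixes cY :: "'y::t2_space \<Rightarrow> ('y, 'f::euclidean_space) chart"
  assumes c: "diff_atlas cY" and \<alpha>: "one_form_on cY UNIV \<alpha>"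
  shows "((\<lambda>z. rep1 (collar_atlas cY) (y, R) (liouville_form \<alpha>) z (w, q)) has_derivative
     (\<lambda>(v, r). r * \<alpha> y w + R * FD (\<lambda>x. rep1 cY y \<alpha> x w) (cmap (cY y) y) v))
     (at (cmap (collar_atlas cY (y, R)) (y, R)))"
proof -
  note C = chart_atD[OF diff_atlas_chart[OF c, of y]]
  let ?x = "cmap (cY y) y" let ?W = "cmap (cY y) ` cdom (cY y) \<times> (UNIV :: real set)"
  have df: "(\<lambda>x. rep1 cY y \<alpha> x w) differentiable (at ?x)"
    using one_form_rep_differentiable[OF \<alpha>] C(1) by blast
  have "((\<lambda>z. rep1 cY y \<alpha> (fst z) w) has_derivative (\<lambda>v. FD (\<lambda>x. rep1 cY y \<alpha> x w) ?x (fst v))) (at (?x, R))"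
    by (rule has_derivative_compose[OF has_derivative_fst[OF has_derivative_ident], of "\<lambda>x. rep1 cY y \<alpha> x w"])
      (simp add: FD_works[OF df])
  then have "((\<lambda>z. snd z * rep1 cY y \<alpha> (fst z) w) has_derivative
      (\<lambda>v. snd (?x, R) * FD (\<lambda>x. rep1 cY y \<alpha> x w) ?x (fst v) + snd v * rep1 cY y \<alpha> (fst (?x, R)) w)) (at (?x, R))"
    by (intro has_derivative_mult has_derivative_snd has_derivative_ident)
  then have "((\<lambda>z. snd z * rep1 cY y \<alpha> (fst z) w) has_derivative
     (\<lambda>(v, r). r * \<alpha> y w + R * FD (\<lambda>x. rep1 cY y \<alpha> x w) ?x v)) (at (?x, R))"
    by (simp add: case_prod_beta' rep1_center[OF c] add.commute)
  moreover have "open ?W" "(?x, R) \<in> ?W" using C(1,3) by (auto intro!: open_Times)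
  moreover have "snd z * rep1 cY y \<alpha> (fst z) w = rep1 (collar_atlas cY) (y, R) (liouville_form \<alpha>) z (w, q)"
    if "z \<in> ?W" for z
    using that rep1_liouville[OF c, of "fst z" y R \<alpha> "snd z" w q] by (simp add: mem_Times_iff)
  ultimately have "((\<lambda>z. rep1 (collar_atlas cY) (y, R) (liouville_form \<alpha>) z (w, q)) has_derivative
     (\<lambda>(v, r). r * \<alpha> y w + R * FD (\<lambda>x. rep1 cY y \<alpha> x w) ?x v)) (at (?x, R))"
    by (rule has_derivative_transform_within_open)
  then show ?thesis by (simp add: prod_atlas_simps)
qed

text \<open>In the product chart \<open>R\<alpha>\<close> is represented by \<open>s\<close> times the representative of \<open>\<alpha>\<close>, so the Leibniz
rule yields \<open>dR \<and> \<alpha> + R d\<alpha>\<close>.\<close>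

lemma d1_liouville:
  fixes cY :: "'y::t2_space \<Rightarrow> ('y, 'f::euclidean_space) chart"
  assumes c: "diff_atlas cY" and \<alpha>: "one_form_on cY UNIV \<alpha>"
  shows "d1 (collar_atlas cY) (liouville_form \<alpha>) (y, R) (v, r) (w, q)
     = r * \<alpha> y w - q * \<alpha> y v + R * d1 cY \<alpha> y v w"
  unfolding d1_def FD_eqI[OF liouville_rep_derivative[OF c \<alpha>]] by (simp add: algebra_simps)

section \<open>Geometry of the conical end\<close>

text \<open>The two thresholds beyond which \<open>H = fR\<close> and \<open>JZ = Y\<close> are merged into a single one, \<open>R_1\<close>.\<close>

locale hamiltonian_end =
  fixes cM :: "'m::t2_space \<Rightarrow> ('m, 'e::euclidean_space) chart"
    and \<omega> :: "'m \<Rightarrow> 'e \<Rightarrow> 'e \<Rightarrow> real"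
    and cY :: "'y::t2_space \<Rightarrow> ('y, 'f::euclidean_space) chart"
    and \<alpha> :: "'y \<Rightarrow> 'f \<Rightarrow> real"
    and M0 :: "'m set" and \<kappa> :: "'m \<Rightarrow> 'y \<times> real" and \<iota> :: "'y \<times> real \<Rightarrow> 'm"
    and H :: "'m \<Rightarrow> real" and f :: "'y \<Rightarrow> real" and J :: "'m \<Rightarrow> 'e \<Rightarrow> 'e" and R1 :: real
  assumes conical: "conical_at_infinity cM \<omega> cY \<alpha> M0 \<kappa> \<iota>"
    and H_smooth: "msmooth_open cM euclid UNIV H"
    and R1: "R1 \<ge> 1"
    and H_collar: "\<And>y R. R > R1 \<Longrightarrow> H (\<iota> (y, R)) = f y * R"
    and f_reeb: "\<And>y. mderiv cY euclid f y (reeb cY \<alpha> y) = 0"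
    and J_compat: "compatible_acs cM \<omega> J"
    and J_contact: "\<And>y R. R > R1 \<Longrightarrow>
        J (\<iota> (y, R)) (mderiv (collar_atlas cY) cM \<iota> (y, R) (0, R))
        = mderiv (collar_atlas cY) cM \<iota> (y, R) (reeb cY \<alpha> y, 0)"
begin

text \<open>The value \<open>1\<close> on the bounded domain makes this a continuous function on all of \<open>M\<close>, because \<open>R = 1\<close> on
the boundary of the domain. So the maximum principle can be run on the whole surface.\<close>

definition radius :: "'m \<Rightarrow> real" where
  "radius p = (if p \<in> M0 then 1 else snd (\<kappa> p))"

definition far_end :: "'m set" where
  "far_end = {p. radius p > R1}"

abbreviation cC where "cC \<equiv> collar_atlas cY"

abbreviation liouv where "liouv \<equiv> liouville_form \<alpha>"

lemma atM: "diff_atlas cM" and atY: "diff_atlas cY" and atC: "diff_atlas cC"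
proof -
  show "diff_atlas cM" and Y: "diff_atlas cY"
    using conical smooth_atlas_imp_diff_atlas unfolding conical_at_infinity_def by blast+
  show "diff_atlas cC" by (rule diff_atlas_prod[OF Y diff_atlas_euclid])
qed

lemma chM: "chart_at p (cM p)" and chC: "chart_at q (cC q)" and chY: "chart_at y (cY y)"
  using atM atC atY by (auto intro: diff_atlas_chart)

lemma contact: "contact_form cY \<alpha>" and symp: "symplectic_form cM \<omega>" and M0: "open M0"
  and front: "frontier M0 = \<iota> ` (UNIV \<times> {1})"
  and hom: "homeomorphism (- M0) (UNIV \<times> {1..}) \<kappa> \<iota>"
  using conical unfolding conical_at_infinity_def by auto

lemma \<alpha>_form: "one_form_on cY UNIV \<alpha>"
  using contact by (simp add: contact_form_def)

lemma \<iota>_\<kappa>: "p \<notin> M0 \<Longrightarrow> \<iota> (\<kappa> p) = p" "p \<notin> M0 \<Longrightarrow> snd (\<kappa> p) \<ge> 1"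
  and \<kappa>_\<iota>: "R \<ge> 1 \<Longrightarrow> \<kappa> (\<iota> (y, R)) = (y, R)" "R \<ge> 1 \<Longrightarrow> \<iota> (y, R) \<notin> M0"
proof -
  note h = hom[unfolded homeomorphism_def]
  show "p \<notin> M0 \<Longrightarrow> \<iota> (\<kappa> p) = p" using h by auto
  have "p \<notin> M0 \<Longrightarrow> \<kappa> p \<in> UNIV \<times> {1..}" using h by auto
  then show "p \<notin> M0 \<Longrightarrow> snd (\<kappa> p) \<ge> 1" by (auto simp: mem_Times_iff)
  show "R \<ge> 1 \<Longrightarrow> \<kappa> (\<iota> (y, R)) = (y, R)" using h by auto
  have "R \<ge> 1 \<Longrightarrow> \<iota> (y, R) \<in> \<iota> ` (UNIV \<times> {1..})" by auto
  then show "R \<ge> 1 \<Longrightarrow> \<iota> (y, R) \<notin> M0" using h by auto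
qed

lemma closure_M0: "closure M0 = M0 \<union> \<iota> ` (UNIV \<times> {1})"
  using front M0 closure_Un_frontier by metis

lemma radius_closure: "p \<in> closure M0 \<Longrightarrow> radius p = 1"
  unfolding closure_M0 radius_def using \<kappa>_\<iota> by auto

lemma radius_continuous: "continuous_on UNIV radius"
proof -
  have "continuous_on (closure M0 \<union> (- M0)) (\<lambda>p. if p \<in> M0 then 1 else snd (\<kappa> p))"
  proof (rule continuous_on_If)
    show "continuous_on (- M0) (\<lambda>p. snd (\<kappa> p))"
      using hom by (intro continuous_on_snd) (simp add: homeomorphism_def)
    show "1 = snd (\<kappa> p)" if "p \<in> closure M0" "\<not> p \<in> M0" for p
      using radius_closure[OF that(1)] that(2) by (simp add: radius_def)
  qed (use M0 in auto)
  moreover have "closure M0 \<union> (- M0) = UNIV" using closure_subset by blast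
  ultimately show ?thesis by (simp add: radius_def[abs_def])
qed

lemma open_far_end: "open far_end"
  unfolding far_end_def
  using continuous_open_preimage[OF radius_continuous open_UNIV open_greaterThan[of R1]]
  by (simp add: vimage_def)

lemma far_end_D:
  assumes "p \<in> far_end"
  shows "p \<notin> closure M0" "p \<notin> M0" "snd (\<kappa> p) > R1" "\<iota> (\<kappa> p) = p" "radius p = snd (\<kappa> p)"
proof -
  show 1: "p \<notin> closure M0" using assms radius_closure R1 by (force simp: far_end_def)
  then show 2: "p \<notin> M0" using closure_subset by blast
  then show "snd (\<kappa> p) > R1" "\<iota> (\<kappa> p) = p" "radius p = snd (\<kappa> p)"
    using assms \<iota>_\<kappa>(1) by (auto simp: far_end_def radius_def)
qed

lemma \<iota>_far_end: "R > R1 \<Longrightarrow> \<iota> (y, R) \<in> far_end"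
  using \<kappa>_\<iota>[of R y] R1 by (simp add: far_end_def radius_def)

text \<open>Smoothness of \<open>\<kappa>\<close> on the complement of \<open>M_0\<close>, which need not be open, only provides local smooth
extensions. On the open set \<open>far_end\<close> these agree with \<open>\<kappa>\<close>.\<close>

lemma \<kappa>_twice_diff:
  assumes "p \<in> far_end"
  obtains U where "open U" "p \<in> U" "U \<subseteq> far_end" "continuous_on U \<kappa>"
    "\<And>q q'. twice_diff_on (cmap (cM q) ` (cdom (cM q) \<inter> U \<inter> \<kappa> -` cdom (cC q'))) (\<lambda>x. cmap (cC q') (\<kappa> (cinv (cM q) x)))"
    "mdiff cM cC \<kappa> p"
proof -
  have "msmooth_on cM cC (- M0) \<kappa>" using conical by (simp add: conical_at_infinity_def)
  then obtain V G where V: "p \<in> V" "msmooth_open cM cC V G" "\<And>x. x \<in> V \<inter> - M0 \<Longrightarrow> G x = \<kappa> x"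
    using far_end_D(2)[OF assms] unfolding msmooth_on_def by (metis ComplI)
  define U where "U = V \<inter> far_end"
  have U: "open U" "p \<in> U" "U \<subseteq> far_end" using V open_far_end assms by (auto simp: U_def msmooth_open_def)
  have eq: "G x = \<kappa> x" if "x \<in> U" for x using V(3)[of x] that far_end_D(2)[of x] by (auto simp: U_def)
  have G: "continuous_on U G" using V(2) unfolding msmooth_open_def U_def by (auto intro: continuous_on_subset)
  then have c: "continuous_on U \<kappa>" using eq by (simp cong: continuous_on_cong)
  have td: "twice_diff_on (cmap (cM q) ` (cdom (cM q) \<inter> U \<inter> \<kappa> -` cdom (cC q'))) (\<lambda>x. cmap (cC q') (\<kappa> (cinv (cM q) x)))" for q q'
  proof (rule twice_diff_on_cong)
    have e: "cdom (cM q) \<inter> U \<inter> \<kappa> -` cdom (cC q') = cdom (cM q) \<inter> U \<inter> G -` cdom (cC q')" using eq by auto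
    show "twice_diff_on (cmap (cM q) ` (cdom (cM q) \<inter> U \<inter> \<kappa> -` cdom (cC q'))) (\<lambda>x. cmap (cC q') (G (cinv (cM q) x)))"
      unfolding e by (rule twice_diff_on_subset[OF msmooth_open_twice_diff[OF V(2)]]) (auto simp: U_def)
    have "open (U \<inter> \<kappa> -` cdom (cC q'))"
      by (rule continuous_open_preimage[OF c U(1) chart_atD(2)[OF chC]])
    then show "open (cmap (cM q) ` (cdom (cM q) \<inter> U \<inter> \<kappa> -` cdom (cC q')))"
      unfolding Int_assoc by (rule open_chart_image[OF chM])
    show "cmap (cC q') (G (cinv (cM q) x)) = cmap (cC q') (\<kappa> (cinv (cM q) x))"
      if "x \<in> cmap (cM q) ` (cdom (cM q) \<inter> U \<inter> \<kappa> -` cdom (cC q'))" for x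
      using that chart_atD(4)[OF chM[of q]] eq by auto
  qed
  have "mdiff cM cC G p" by (rule msmooth_open_mdiff[OF V(2,1) atM atC])
  then have "mdiff cM cC \<kappa> p" using mderiv_cong(2)[OF atM U(1,2), of G \<kappa> cC] eq by blast
  then show ?thesis using that[OF U c td] by blast
qed

lemma \<kappa>_mdiff: "p \<in> far_end \<Longrightarrow> mdiff cM cC \<kappa> p"
  using \<kappa>_twice_diff by metis

lemma \<iota>_mdiff: "R > R1 \<Longrightarrow> mdiff cC cM \<iota> (y, R)"
proof -
  assume R: "R > R1"
  have "msmooth_on cC cM (UNIV \<times> {1..}) \<iota>" using conical by (simp add: conical_at_infinity_def)
  moreover have "(y, R) \<in> UNIV \<times> {1..}" using R R1 by simp
  ultimately obtain V G where V: "(y, R) \<in> V" "msmooth_open cC cM V G" "\<And>x. x \<in> V \<inter> UNIV \<times> {1..} \<Longrightarrow> G x = \<iota> x"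
    unfolding msmooth_on_def by metis
  have eq: "G x = \<iota> x" if "x \<in> V \<inter> UNIV \<times> {R1<..}" for x
    using V(3)[of x] that R1 by (cases x) auto
  have op: "open (V \<inter> UNIV \<times> {R1<..})" using V(2) by (auto simp: msmooth_open_def intro!: open_Int open_Times)
  have "mdiff cC cM G (y, R)" by (rule msmooth_open_mdiff[OF V(2,1) atC atM])
  moreover have "(y, R) \<in> V \<inter> UNIV \<times> {R1<..}" using V(1) R by simp
  ultimately show ?thesis using mderiv_cong(2)[OF atC op, of "(y, R)" G \<iota> cM] eq by blast
qed

abbreviation dI where "dI \<equiv> mderiv cC cM \<iota>"
abbreviation dK where "dK \<equiv> mderiv cM cC \<kappa>"
abbreviation dH where "dH \<equiv> mderiv cM euclid H"

lemma H_mdiff: "mdiff cM euclid H p"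
  by (rule msmooth_open_mdiff[OF H_smooth UNIV_I atM diff_atlas_euclid])

lemma dI_dK: "p \<in> far_end \<Longrightarrow> dI (\<kappa> p) (dK p v) = v"
proof -
  assume p: "p \<in> far_end"
  have "mdiff cC cM \<iota> (\<kappa> p)" using \<iota>_mdiff[of "snd (\<kappa> p)" "fst (\<kappa> p)"] far_end_D[OF p] by simp
  then have "mderiv cM cM (\<lambda>x. \<iota> (\<kappa> x)) p v = dI (\<kappa> p) (dK p v)"
    by (rule mderiv_chain(2)[OF atM atC \<kappa>_mdiff[OF p]])
  moreover have "mderiv cM cM (\<lambda>x. \<iota> (\<kappa> x)) p = mderiv cM cM (\<lambda>x. x) p"
    by (rule mderiv_cong(1)[OF atM open_far_end p]) (simp add: far_end_D)
  ultimately show ?thesis using mderiv_id(2)[OF atM] by simp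
qed

lemma \<omega>_collar:
  assumes "R > R1"
  shows "\<omega> (\<iota> (y, R)) (dI (y, R) a) (dI (y, R) b) = d1 cC liouv (y, R) a b"
proof -
  have "\<forall>y. \<forall>R>1. \<forall>a b. \<omega> (\<iota> (y, R)) (dI (y, R) a) (dI (y, R) b) = d1 cC liouv (y, R) a b"
    using conical unfolding conical_at_infinity_def by blast
  moreover have "R > 1" using assms R1 by simp
  ultimately show ?thesis by blast
qed

lemma \<omega>_bilinear: "bilinear (\<omega> p)" and \<omega>_self: "\<omega> p v v = 0"
  and \<omega>_nd: "v \<noteq> 0 \<Longrightarrow> \<exists>w. \<omega> p v w \<noteq> 0"
  using symp by (auto simp: symplectic_form_def two_form_def)

lemma \<omega>_skew: "\<omega> p v w = - \<omega> p w v"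
proof -
  have "\<omega> p (v + w) (v + w) = 0" by (rule \<omega>_self)
  then have "\<omega> p v v + \<omega> p v w + (\<omega> p w v + \<omega> p w w) = 0"
    by (simp add: bilinear_ladd[OF \<omega>_bilinear] bilinear_radd[OF \<omega>_bilinear])
  then show ?thesis by (simp add: \<omega>_self)
qed

text \<open>\<open>\<omega>(\<cdot>, Y) = dR\<close>, since \<open>d(R\<alpha>)(\<cdot>, Y) = dR \<cdot> \<alpha>(Y)\<close>.\<close>

lemma \<omega>_reeb:
  assumes p: "p = \<iota> (y, R)" "R > R1"
  shows "\<omega> p v (dI (y, R) (reeb cY \<alpha> y, 0)) = snd (dK p v)"
proof -
  have fe: "p \<in> far_end" "\<kappa> p = (y, R)" using \<iota>_far_end p \<kappa>_\<iota>(1) R1 by auto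
  obtain w r where wr: "dK p v = (w, r)" by force
  have v: "v = dI (y, R) (w, r)" using dI_dK[OF fe(1), of v] fe(2) wr by simp
  have "\<omega> p v (dI (y, R) (reeb cY \<alpha> y, 0)) = d1 cC liouv (y, R) (w, r) (reeb cY \<alpha> y, 0)"
    unfolding p(1) v by (rule \<omega>_collar[OF p(2)])
  also have "\<dots> = r"
    unfolding d1_liouville[OF atY \<alpha>_form] d1_alternating[of _ _ _ w]
    by (simp add: reeb_properties[OF atY contact])
  finally show ?thesis by (simp add: wr)
qed

text \<open>\<open>\<omega>(Z, \<cdot>) = R\<alpha>\<close>, since \<open>Z = R\<partial>_R\<close>.\<close>

lemma \<omega>_liouville:
  assumes p: "p = \<iota> (y, R)" "R > R1"
  shows "\<omega> p (dI (y, R) (0, R)) v = liouv (\<kappa> p) (dK p v)"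
proof -
  have fe: "p \<in> far_end" "\<kappa> p = (y, R)" using \<iota>_far_end p \<kappa>_\<iota>(1) R1 by auto
  obtain w r where wr: "dK p v = (w, r)" by force
  have v: "v = dI (y, R) (w, r)" using dI_dK[OF fe(1), of v] fe(2) wr by simp
  have lin: "linear (\<alpha> y)" using \<alpha>_form by (simp add: one_form_on_def)
  have "\<omega> p (dI (y, R) (0, R)) v = d1 cC liouv (y, R) (0, R) (w, r)"
    unfolding p(1) v by (rule \<omega>_collar[OF p(2)])
  also have "\<dots> = R * \<alpha> y w"
    unfolding d1_liouville[OF atY \<alpha>_form]
    by (simp add: linear_0[OF lin] bilinear_lzero[OF d1_bilinear[OF atY \<alpha>_form UNIV_I]])
  finally show ?thesis by (simp add: wr fe(2) liouville_form_def)
qed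

lemma J_props:
  "linear (J p)" "J p (J p v) = - v" "\<omega> p (J p v) (J p w) = \<omega> p v w"
  "v \<noteq> 0 \<Longrightarrow> \<omega> p v (J p v) > 0"
  using J_compat by (auto simp: compatible_acs_def)

lemma \<omega>_J_nonneg: "\<omega> p v (J p v) \<ge> 0"
  using J_props(4)[of v p] bilinear_lzero[OF \<omega>_bilinear] by (cases "v = 0") (auto intro: less_imp_le)

text \<open>\<open>dR(v) = \<omega>(v, Y) = \<omega>(v, JZ) = \<omega>(Jv, JJZ) = \<omega>(Z, Jv) = \<lambda>(Jv)\<close>.\<close>

lemma dR_eq_liouville_J:
  assumes "p \<in> far_end"
  shows "snd (dK p v) = liouv (\<kappa> p) (dK p (J p v))"
proof -
  obtain y R where k: "\<kappa> p = (y, R)" by force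
  have p: "p = \<iota> (y, R)" "R > R1" using far_end_D[OF assms] k by auto
  let ?Z = "dI (y, R) (0, R)"
  have "snd (dK p v) = \<omega> p v (J p ?Z)"
    using \<omega>_reeb[OF p] J_contact[OF p(2)] p(1) by simp
  also have "\<dots> = \<omega> p (J p v) (J p (J p ?Z))" by (rule J_props(3)[symmetric])
  also have "\<dots> = - \<omega> p (J p v) ?Z" by (simp add: J_props(2) bilinear_rneg[OF \<omega>_bilinear])
  also have "\<dots> = \<omega> p ?Z (J p v)" using \<omega>_skew[of p "J p v" ?Z] by simp
  also have "\<dots> = liouv (\<kappa> p) (dK p (J p v))" by (rule \<omega>_liouville[OF p])
  finally show ?thesis .
qed

text \<open>The function \<open>f\<close> inherits differentiability from \<open>H\<close>, since \<open>f(y) = H(y, R)/R\<close> for any fixed large \<open>R\<close>.\<close>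

lemma dH_collar:
  assumes R: "R > R1"
  shows "dH (\<iota> (y, R)) (dI (y, R) (v, r)) = R * mderiv cY euclid f y v + f y * r"
    and "linear (mderiv cY euclid f y)"
proof -
  let ?g = "\<lambda>x. f (cinv (cY y) x)" and ?x = "cmap (cY y) y"
  note C = chart_atD[OF chY[of y]]
  note ch = mderiv_chain[OF atC atM \<iota>_mdiff[OF R, of y] H_mdiff]
  have op: "open (UNIV \<times> {R1<..} :: ('y \<times> real) set)" by (intro open_Times) auto
  have eqH: "H (\<iota> z) = f (fst z) * snd z" if "z \<in> UNIV \<times> {R1<..}" for z :: "'y \<times> real"
    using H_collar[of "snd z" "fst z"] that by (auto simp: mem_Times_iff)
  have md: "mdiff cC euclid (\<lambda>z. f (fst z) * snd z) (y, R)"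
  proof -
    have "(y, R) \<in> UNIV \<times> {R1<..}" using R by simp
    then show ?thesis
      using mderiv_cong(2)[OF atC op, of "(y, R)" "\<lambda>z. H (\<iota> z)" "\<lambda>z. f (fst z) * snd z" euclid] eqH ch(1) by blast
  qed
  then have 1: "(\<lambda>z. ?g (fst z) * snd z) differentiable (at (?x, R))"
    by (simp add: mdiff_def prod_atlas_simps o_def map_prod_def case_prod_beta)
  have "(\<lambda>x. (x, R)) differentiable (at ?x)" by (intro differentiable_Pair) auto
  from differentiable_chain_at[OF this 1] have "(\<lambda>x. ?g x * R) differentiable (at ?x)" by (simp add: o_def)
  then have "(\<lambda>x. ?g x * R * (1 / R)) differentiable (at ?x)"
    by (rule differentiable_mult[OF _ differentiable_const])
  moreover have "(\<lambda>x. ?g x * R * (1 / R)) = ?g" using R R1 by auto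
  ultimately have g: "?g differentiable (at ?x)" by (simp only:)
  have mg: "mderiv cY euclid f y = FD ?g ?x" by (simp add: mderiv_def o_def)
  show "linear (mderiv cY euclid f y)" unfolding mg by (rule FD_linear[OF g])
  have "((\<lambda>z. ?g (fst z)) has_derivative (\<lambda>v. FD ?g ?x (fst v))) (at (?x, R))"
    by (rule has_derivative_compose[OF has_derivative_fst[OF has_derivative_ident], of ?g])
      (simp add: FD_works[OF g])
  then have "((\<lambda>z. ?g (fst z) * snd z) has_derivative
      (\<lambda>v. ?g (fst (?x, R)) * snd v + FD ?g ?x (fst v) * snd (?x, R))) (at (?x, R))"
    by (intro has_derivative_mult has_derivative_snd has_derivative_ident)
  note FD = FD_eqI[OF this]
  have "dH (\<iota> (y, R)) (dI (y, R) (v, r)) = mderiv cC euclid (\<lambda>z. H (\<iota> z)) (y, R) (v, r)"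
    using ch(2) by simp
  also have "mderiv cC euclid (\<lambda>z. H (\<iota> z)) (y, R) = mderiv cC euclid (\<lambda>z. f (fst z) * snd z) (y, R)"
    by (rule mderiv_cong(1)[OF atC op _ eqH]) (use R in auto)
  also have "\<dots> (v, r) = FD (\<lambda>z. ?g (fst z) * snd z) (?x, R) (v, r)"
    by (simp add: mderiv_def prod_atlas_simps o_def map_prod_def case_prod_beta)
  also have "\<dots> = R * mderiv cY euclid f y v + f y * r"
    unfolding FD mg using C(1,4) by simp
  finally show "dH (\<iota> (y, R)) (dI (y, R) (v, r)) = R * mderiv cY euclid f y v + f y * r" .
qed

abbreviation XH where "XH \<equiv> ham_vf cM \<omega> H"

lemma \<omega>_XH: "\<omega> p v (XH p) = dH p v"
proof -
  have lin: "linear (\<lambda>v. - dH p v)" using mderiv_linear[OF H_mdiff] by (rule linear_compose_neg)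
  have "\<exists>!X. \<forall>w. \<omega> p X w = - dH p w"
    by (rule nondegenerate_represents[OF \<omega>_bilinear \<omega>_nd lin])
  moreover have "(\<forall>w. \<omega> p X w = - dH p w) \<longleftrightarrow> (\<forall>v. \<omega> p v X = dH p v)" for X
    using \<omega>_skew[of p X] by (metis neg_equal_iff_equal)
  ultimately have "\<exists>!X. \<forall>v. \<omega> p v X = dH p v" by simp
  from theI'[OF this] show ?thesis unfolding ham_vf_def by blast
qed

text \<open>\<open>dR(X_H) = \<omega>(X_H, Y) = -dH(Y) = 0\<close> as \<open>df(Y) = 0\<close>, and \<open>\<lambda>(X_H) = \<omega>(Z, X_H) = dH(Z) = fR\<close>.\<close>

lemma XH_radial:
  assumes "p \<in> far_end"
  shows "snd (dK p (XH p)) = 0" "liouv (\<kappa> p) (dK p (XH p)) = H p"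
proof -
  obtain y R where k: "\<kappa> p = (y, R)" by force
  have p: "p = \<iota> (y, R)" "R > R1" using far_end_D[OF assms] k by auto
  have "snd (dK p (XH p)) = \<omega> p (XH p) (dI (y, R) (reeb cY \<alpha> y, 0))" by (rule \<omega>_reeb[OF p, symmetric])
  also have "\<dots> = - dH p (dI (y, R) (reeb cY \<alpha> y, 0))" using \<omega>_skew \<omega>_XH by metis
  also have "\<dots> = 0" unfolding p(1) dH_collar(1)[OF p(2)] f_reeb by simp
  finally show "snd (dK p (XH p)) = 0" .
  have "liouv (\<kappa> p) (dK p (XH p)) = dH p (dI (y, R) (0, R))"
    using \<omega>_liouville[OF p, symmetric] \<omega>_XH by metis
  also have "\<dots> = f y * R" unfolding p(1) dH_collar(1)[OF p(2)] linear_0[OF dH_collar(2)[OF p(2)]] by simp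
  also have "\<dots> = H p" using H_collar[OF p(2)] p(1) by simp
  finally show "liouv (\<kappa> p) (dK p (XH p)) = H p" .
qed

lemma liouv_linear: "linear (liouv q)"
proof -
  have lin: "linear (\<alpha> (fst q))" using \<alpha>_form by (simp add: one_form_on_def)
  have "liouv q = (\<lambda>a. snd q * \<alpha> (fst q) (fst a))"
    by (auto simp: liouville_form_def case_prod_beta)
  then show ?thesis
    by (auto intro!: linearI simp: linear_add[OF lin] linear_cmul[OF lin] algebra_simps)
qed

text \<open>Here \<open>U\<close> stands for \<open>du\<close> and \<open>b\<close> for \<open>\<beta>\<close> at one point, and \<open>A = U - b X_H\<close>. The first
conclusion is \<open>dR(A) = \<lambda>(JA) = \<lambda>(A \<circ> \<i>)\<close>, with the terms containing \<open>X_H\<close> evaluated. The second is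
\<open>\<omega>(A1, A\<i>) = \<omega>(A1, JA1) \<ge> 0\<close>, expanded.\<close>

lemma floer_pointwise:
  assumes p: "p \<in> far_end" and U: "linear U" and b: "linear (b :: complex \<Rightarrow> real)"
    and fl: "\<And>v. part01 (J p) (\<lambda>v. U v - b v *\<^sub>R XH p) v = 0"
  shows "snd (dK p (U v)) = liouv (\<kappa> p) (dK p (U (\<i> * v))) - H p * b (\<i> * v)"
    "\<omega> p (U 1) (U \<i>) - (dH p (U 1) * b \<i> - dH p (U \<i>) * b 1) \<ge> 0"
proof -
  define A where "A v = U v - b v *\<^sub>R XH p" for v
  note linK = mderiv_linear[OF \<kappa>_mdiff[OF p]]
  have JA: "A (\<i> * v) = J p (A v)" for v
  proof -
    have "A v + J p (A (\<i> * v)) = 0" using fl[of v] by (simp add: part01_def A_def)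
    then have "J p (A v + J p (A (\<i> * v))) = 0" using linear_0[OF J_props(1)] by metis
    then show ?thesis by (simp add: linear_add[OF J_props(1)] J_props(2))
  qed
  have "snd (dK p (A v)) = snd (dK p (U v))"
    unfolding A_def by (simp add: linear_diff[OF linK] linear_cmul[OF linK] XH_radial[OF p])
  moreover have "snd (dK p (A v)) = liouv (\<kappa> p) (dK p (A (\<i> * v)))"
    unfolding JA by (rule dR_eq_liouville_J[OF p])
  moreover have "liouv (\<kappa> p) (dK p (A (\<i> * v))) = liouv (\<kappa> p) (dK p (U (\<i> * v))) - H p * b (\<i> * v)"
    unfolding A_def by (simp add: linear_diff[OF linK] linear_cmul[OF linK] linear_diff[OF liouv_linear] linear_cmul[OF liouv_linear] XH_radial[OF p])
  ultimately show "snd (dK p (U v)) = liouv (\<kappa> p) (dK p (U (\<i> * v))) - H p * b (\<i> * v)" by simp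
  note bl = bilinear_ladd[OF \<omega>_bilinear] bilinear_radd[OF \<omega>_bilinear] bilinear_lmul[OF \<omega>_bilinear] bilinear_rmul[OF \<omega>_bilinear]
    bilinear_lsub[OF \<omega>_bilinear] bilinear_rsub[OF \<omega>_bilinear]
  have XU: "\<omega> p (XH p) w = - dH p w" for w using \<omega>_skew \<omega>_XH by metis
  have dHX: "dH p (XH p) = 0" using \<omega>_XH[of p "XH p"] by (simp add: \<omega>_self)
  have "\<omega> p (A 1) (A \<i>) = \<omega> p (U 1) (U \<i>) - b \<i> * dH p (U 1) + b 1 * dH p (U \<i>)"
    unfolding A_def
    by (simp add: bl \<omega>_XH XU \<omega>_self linear_diff[OF mderiv_linear[OF H_mdiff]] linear_cmul[OF mderiv_linear[OF H_mdiff]] dHX)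
  moreover have "\<omega> p (A 1) (A \<i>) \<ge> 0" using JA[of 1] \<omega>_J_nonneg by simp
  ultimately show "\<omega> p (U 1) (U \<i>) - (dH p (U 1) * b \<i> - dH p (U \<i>) * b 1) \<ge> 0" by (simp add: algebra_simps)
qed

end

section \<open>The radial coordinate of a Floer solution is subharmonic\<close>

locale floer_curve = hamiltonian_end cM \<omega> cY \<alpha> M0 \<kappa> \<iota> H f J R1
  for cM :: "'m::t2_space \<Rightarrow> ('m, 'e::euclidean_space) chart"
    and \<omega> :: "'m \<Rightarrow> 'e \<Rightarrow> 'e \<Rightarrow> real"
    and cY :: "'y::t2_space \<Rightarrow> ('y, 'f::euclidean_space) chart"
    and \<alpha> :: "'y \<Rightarrow> 'f \<Rightarrow> real"
    and M0 :: "'m set" and \<kappa> :: "'m \<Rightarrow> 'y \<times> real" and \<iota> :: "'y \<times> real \<Rightarrow> 'm"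
    and H :: "'m \<Rightarrow> real" and f :: "'y \<Rightarrow> real" and J :: "'m \<Rightarrow> 'e \<Rightarrow> 'e" and R1 :: real +
  fixes cS :: "'r::t2_space \<Rightarrow> ('r, complex) chart" and P :: "'r set"
    and \<beta> :: "'r \<Rightarrow> complex \<Rightarrow> real" and u :: "'r \<Rightarrow> 'm"
  assumes atlas: "complex_atlas cS"
    and \<beta>_form: "one_form_on cS (- P) \<beta>"
    and \<beta>_sub: "\<And>z v. z \<notin> P \<Longrightarrow> d1 cS \<beta> z v (\<i> * v) \<le> 0"
    and sign: "(\<forall>y. f y \<ge> 0) \<or> (\<forall>z\<in>- P. \<forall>v w. d1 cS \<beta> z v w = 0)"
    and floer: "floer_solution cM \<omega> H J cS P \<beta> u"
begin

lemma atS: "diff_atlas cS"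
  by (rule complex_atlas_imp_diff_atlas[OF atlas])

lemma chS: "chart_at z (cS z)"
  by (rule diff_atlas_chart[OF atS])

lemma u_smooth: "msmooth_open cS cM (- P) u" and u_cont: "continuous_on (- P) u" and P_open: "open (- P)"
  using floer by (auto simp: floer_solution_def msmooth_open_def)

text \<open>The part of the surface on which the argument takes place, in the chart of a fixed point \<open>z_0\<close>. The
Laplacian is computed in this one chart, whereas the Floer equation is stated in the chart of each point.\<close>

definition far_chart :: "'r \<Rightarrow> complex set" where
  "far_chart z0 = cmap (cS z0) ` (cdom (cS z0) \<inter> (- P \<inter> u -` far_end))"

abbreviation \<psi> where "\<psi> z0 \<equiv> cinv (cS z0)"

lemma open_far_chart: "open (far_chart z0)"
  unfolding far_chart_def
  by (rule open_chart_image[OF chS continuous_open_preimage[OF u_cont P_open open_far_end]])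

lemma far_chartD:
  assumes "\<zeta> \<in> far_chart z0"
  shows "\<psi> z0 \<zeta> \<in> cdom (cS z0)" "\<psi> z0 \<zeta> \<notin> P" "u (\<psi> z0 \<zeta>) \<in> far_end"
    "\<zeta> \<in> cmap (cS z0) ` cdom (cS z0)" "cmap (cS z0) (\<psi> z0 \<zeta>) = \<zeta>"
  using assms chart_atD(4)[OF chS[of z0]] unfolding far_chart_def by auto

text \<open>The differentials of the inverse chart, of \<open>u\<close> and of \<open>\<kappa> \<circ> u\<close>, in the chart of \<open>z_0\<close>.\<close>

abbreviation dT where "dT z0 \<equiv> mderiv euclid cS (\<psi> z0)"
abbreviation dU where "dU z0 \<equiv> mderiv euclid cM (\<lambda>x. u (\<psi> z0 x))"
abbreviation dW where "dW z0 \<equiv> mderiv euclid cC (\<lambda>x. \<kappa> (u (\<psi> z0 x)))"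

lemma chart_map_mdiff: "\<zeta> \<in> far_chart z0 \<Longrightarrow> mdiff euclid cS (\<psi> z0) \<zeta>"
  using mdiff_cinv[OF atS] far_chartD(4) by blast

lemma u_mdiff: "z \<notin> P \<Longrightarrow> mdiff cS cM u z"
  by (rule msmooth_open_mdiff[OF u_smooth _ atS atM]) simp

lemma transition_twice_diff:
  "twice_diff_on (cmap (cS z) ` (cdom (cS z) \<inter> cdom (cS z'))) (\<lambda>x. cmap (cS z') (cinv (cS z) x))"
proof (rule twice_diff_on_holomorphic)
  show "(\<lambda>x. cmap (cS z') (cinv (cS z) x)) holomorphic_on cmap (cS z) ` (cdom (cS z) \<inter> cdom (cS z'))"
    using atlas unfolding complex_atlas_def o_def by blast
  show "open (cmap (cS z) ` (cdom (cS z) \<inter> cdom (cS z')))"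
    by (rule open_chart_image[OF chS chart_atD(2)[OF chS]])
qed

text \<open>The transition maps are holomorphic. This transports the Floer equation, which involves \<open>j\<close>, to the
chart of \<open>z_0\<close>.\<close>

lemma dT_complex_linear:
  assumes "\<zeta> \<in> far_chart z0"
  shows "dT z0 \<zeta> (\<i> * v) = \<i> * dT z0 \<zeta> v"
proof -
  let ?z = "\<psi> z0 \<zeta>" let ?V = "cmap (cS z0) ` (cdom (cS z0) \<inter> cdom (cS ?z))"
  let ?g = "\<lambda>x. cmap (cS ?z) (\<psi> z0 x)"
  have "\<zeta> \<in> ?V" using far_chartD(1,5)[OF assms] chart_atD(1)[OF chS] by (metis IntI imageI)
  moreover have "?g holomorphic_on ?V" using atlas unfolding complex_atlas_def o_def by blast
  moreover have "open ?V" by (rule open_chart_image[OF chS chart_atD(2)[OF chS]])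
  ultimately have "?g field_differentiable (at \<zeta>)" using holomorphic_on_imp_differentiable_at by blast
  then have "(?g has_derivative (\<lambda>h. deriv ?g \<zeta> * h)) (at \<zeta>)"
    by (simp add: DERIV_deriv_iff_field_differentiable has_field_derivative_def[symmetric])
  then show ?thesis by (simp add: mderiv_euclid FD_eqI mult.left_commute)
qed

lemma chain_rules:
  assumes "\<zeta> \<in> far_chart z0"
  defines "p \<equiv> u (\<psi> z0 \<zeta>)"
  shows "mdiff euclid cM (\<lambda>x. u (\<psi> z0 x)) \<zeta>"
    "dU z0 \<zeta> v = mderiv cS cM u (\<psi> z0 \<zeta>) (dT z0 \<zeta> v)"
    "mdiff euclid cC (\<lambda>x. \<kappa> (u (\<psi> z0 x))) \<zeta>"
    "dW z0 \<zeta> v = dK p (dU z0 \<zeta> v)"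
    "(\<lambda>x. H (u (\<psi> z0 x))) differentiable (at \<zeta>)"
    "FD (\<lambda>x. H (u (\<psi> z0 x))) \<zeta> v = dH p (dU z0 \<zeta> v)"
proof -
  note D = far_chartD[OF assms(1)]
  note 1 = mderiv_chain[OF diff_atlas_euclid atS chart_map_mdiff[OF assms(1)] u_mdiff[OF D(2)]]
  show "mdiff euclid cM (\<lambda>x. u (\<psi> z0 x)) \<zeta>"
    "dU z0 \<zeta> v = mderiv cS cM u (\<psi> z0 \<zeta>) (dT z0 \<zeta> v)" by (rule 1)+
  note 2 = mderiv_chain[OF diff_atlas_euclid atM 1(1) \<kappa>_mdiff[OF D(3)]]
  show "mdiff euclid cC (\<lambda>x. \<kappa> (u (\<psi> z0 x))) \<zeta>" "dW z0 \<zeta> v = dK p (dU z0 \<zeta> v)"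
    unfolding p_def by (rule 2)+
  note 3 = mderiv_chain[OF diff_atlas_euclid atM 1(1) H_mdiff]
  show "(\<lambda>x. H (u (\<psi> z0 x))) differentiable (at \<zeta>)"
    using 3(1) by (simp add: mdiff_def o_def)
  show "FD (\<lambda>x. H (u (\<psi> z0 x))) \<zeta> v = dH p (dU z0 \<zeta> v)"
    using 3(2) by (simp add: mderiv_def o_def p_def)
qed

lemma radius_derivative:
  assumes "\<zeta> \<in> far_chart z0"
  shows "((\<lambda>x. radius (u (\<psi> z0 x))) has_derivative (\<lambda>v. snd (dW z0 \<zeta> v))) (at \<zeta>)"
proof -
  let ?F = "\<lambda>x. cmap (cC (\<kappa> (u (\<psi> z0 \<zeta>)))) (\<kappa> (u (\<psi> z0 x)))"
  have "?F differentiable (at \<zeta>)" using chain_rules(3)[OF assms] by (simp add: mdiff_def o_def)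
  then have "((\<lambda>x. snd (?F x)) has_derivative (\<lambda>v. snd (FD ?F \<zeta> v))) (at \<zeta>)"
    by (intro has_derivative_snd FD_works)
  then have "((\<lambda>x. snd (\<kappa> (u (\<psi> z0 x)))) has_derivative (\<lambda>v. snd (dW z0 \<zeta> v))) (at \<zeta>)"
    unfolding mderiv_euclid by (simp add: prod_atlas_simps)
  then show ?thesis
    by (rule has_derivative_transform_within_open[OF _ open_far_chart assms])
      (use far_end_D(5)[OF far_chartD(3)] in simp)
qed

text \<open>The pullbacks of \<open>\<lambda>\<close> and \<open>\<beta>\<close> to the chart of \<open>z_0\<close>.\<close>

abbreviation \<theta>u where "\<theta>u z0 x v \<equiv> liouv (\<kappa> (u (\<psi> z0 x))) (dW z0 x v)"
abbreviation \<beta>u where "\<beta>u z0 x v \<equiv> \<beta> (\<psi> z0 x) (dT z0 x v)"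

text \<open>The chart version of \<open>d\<rho> = (u^*\<lambda> - H(u)\<beta>) \<circ> j\<close>, and of the nonnegativity of
\<open>u^*\<omega> - d(H \<circ> u) \<and> \<beta>\<close>.\<close>

lemma dR_identity:
  assumes "\<zeta> \<in> far_chart z0"
  shows "snd (dW z0 \<zeta> v) = \<theta>u z0 \<zeta> (\<i> * v) - H (u (\<psi> z0 \<zeta>)) * \<beta>u z0 \<zeta> (\<i> * v)"
    and "\<omega> (u (\<psi> z0 \<zeta>)) (dU z0 \<zeta> 1) (dU z0 \<zeta> \<i>)
      - (FD (\<lambda>x. H (u (\<psi> z0 x))) \<zeta> 1 * \<beta>u z0 \<zeta> \<i> - FD (\<lambda>x. H (u (\<psi> z0 x))) \<zeta> \<i> * \<beta>u z0 \<zeta> 1) \<ge> 0"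
    and "linear (dW z0 \<zeta>)" "linear (\<beta>u z0 \<zeta>)"
proof -
  note D = far_chartD[OF assms] and c = chain_rules[OF assms]
  have lU: "linear (dU z0 \<zeta>)" by (rule mderiv_linear[OF c(1)])
  have lT: "linear (dT z0 \<zeta>)" by (rule mderiv_linear[OF chart_map_mdiff[OF assms]])
  have "linear (\<beta> (\<psi> z0 \<zeta>))" using \<beta>_form D(2) by (simp add: one_form_on_def)
  from linear_compose[OF lT this] show lb: "linear (\<beta>u z0 \<zeta>)" by (simp add: o_def)
  show "linear (dW z0 \<zeta>)" by (rule mderiv_linear[OF c(3)])
  have "part01 (J (u (\<psi> z0 \<zeta>))) (\<lambda>v. dU z0 \<zeta> v - \<beta>u z0 \<zeta> v *\<^sub>R XH (u (\<psi> z0 \<zeta>))) v = 0" for v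
  proof -
    have "part01 (J (u (\<psi> z0 \<zeta>))) (\<lambda>v. mderiv cS cM u (\<psi> z0 \<zeta>) v - \<beta> (\<psi> z0 \<zeta>) v *\<^sub>R XH (u (\<psi> z0 \<zeta>))) (dT z0 \<zeta> v) = 0"
      using floer D(2) unfolding floer_solution_def by blast
    then show ?thesis unfolding part01_def c(2) dT_complex_linear[OF assms] .
  qed
  note fp = floer_pointwise[OF D(3) lU lb this]
  show "snd (dW z0 \<zeta> v) = \<theta>u z0 \<zeta> (\<i> * v) - H (u (\<psi> z0 \<zeta>)) * \<beta>u z0 \<zeta> (\<i> * v)"
    unfolding c(4) by (rule fp(1))
  show "\<omega> (u (\<psi> z0 \<zeta>)) (dU z0 \<zeta> 1) (dU z0 \<zeta> \<i>)
      - (FD (\<lambda>x. H (u (\<psi> z0 x))) \<zeta> 1 * \<beta>u z0 \<zeta> \<i> - FD (\<lambda>x. H (u (\<psi> z0 x))) \<zeta> \<i> * \<beta>u z0 \<zeta> 1) \<ge> 0"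
    unfolding c(6) by (rule fp(2))
qed

text \<open>\<open>d(u^*\<lambda>) = u^*\<omega>\<close>. The form \<open>\<lambda>\<close> lives on the collar, so it is pulled back along
\<open>\<kappa> \<circ> u\<close>; that \<open>\<iota>\<close> is symplectic turns \<open>d\<lambda>\<close> into \<open>\<omega>\<close>.\<close>

lemma d_\<theta>u:
  assumes "\<zeta> \<in> far_chart z0"
  shows "(\<lambda>x. \<theta>u z0 x w) differentiable (at \<zeta>)"
    "FD (\<lambda>x. \<theta>u z0 x w) \<zeta> v - FD (\<lambda>x. \<theta>u z0 x v) \<zeta> w = \<omega> (u (\<psi> z0 \<zeta>)) (dU z0 \<zeta> v) (dU z0 \<zeta> w)"
proof -
  note D = far_chartD[OF assms] and c = chain_rules[OF assms]
  let ?p = "u (\<psi> z0 \<zeta>)" let ?F = "\<lambda>x. \<kappa> (u (\<psi> z0 x))"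
  obtain y R where k: "\<kappa> ?p = (y, R)" by force
  have p: "?p = \<iota> (y, R)" "R > R1" using far_end_D[OF D(3)] k by auto
  obtain U where U: "open U" "?p \<in> U" "U \<subseteq> far_end" "continuous_on U \<kappa>"
    "\<And>q q'. twice_diff_on (cmap (cM q) ` (cdom (cM q) \<inter> U \<inter> \<kappa> -` cdom (cC q'))) (\<lambda>x. cmap (cC q') (\<kappa> (cinv (cM q) x)))"
    using \<kappa>_twice_diff[OF D(3)] by metis
  \<comment> \<open>a neighbourhood of \<open>\<zeta>\<close> on which \<open>u\<close> stays in one chart and \<open>\<kappa>\<close> is twice differentiable there\<close>
  define D' where "D' = cmap (cS z0) ` (cdom (cS z0) \<inter> (- P \<inter> u -` (U \<inter> cdom (cM ?p))))"
  have oUM: "open (U \<inter> cdom (cM ?p))" by (intro open_Int U(1) chart_atD(2)[OF chM])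
  have D'open: "open D'" unfolding D'_def
    by (rule open_chart_image[OF chS continuous_open_preimage[OF u_cont P_open oUM]])
  have \<zeta>D': "\<zeta> \<in> D'"
    unfolding D'_def using D U(2) chart_atD(1)[OF chM[of ?p]] by (intro image_eqI[of _ _ "\<psi> z0 \<zeta>"]) auto
  have D'D: "\<psi> z0 x \<notin> P" "u (\<psi> z0 x) \<in> U" "u (\<psi> z0 x) \<in> cdom (cM ?p)" "x \<in> cmap (cS z0) ` cdom (cS z0)" if "x \<in> D'" for x
    using that chart_atD(4)[OF chS[of z0]] unfolding D'_def by auto
  have cu: "continuous_on D' (\<lambda>x. u (\<psi> z0 x))"
    by (rule continuous_on_compose2[OF u_cont continuous_on_subset[OF chart_atD(8)[OF chS[of z0]]]])
      (use D'D in auto)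
  have cF: "continuous_on D' ?F"
    by (rule continuous_on_compose2[OF U(4) cu]) (use D'D in auto)
  define V where "V = D' \<inter> ?F -` cdom (cC (?F \<zeta>))"
  have oV: "open V" unfolding V_def by (rule continuous_open_preimage[OF cF D'open chart_atD(2)[OF chC]])
  have tw1: "twice_diff_on V (\<lambda>x. cmap (cM ?p) (u (\<psi> z0 x)))"
    by (rule twice_diff_on_subset[OF msmooth_open_twice_diff[OF u_smooth, of z0 ?p]])
      (auto simp: V_def D'_def)
  have "twice_diff_on V (\<lambda>x. cmap (cC (?F \<zeta>)) (\<kappa> (cinv (cM ?p) (cmap (cM ?p) (u (\<psi> z0 x))))))"
    by (rule twice_diff_on_compose[OF tw1 oV U(5)[of ?p "?F \<zeta>"]])
      (use D'D in \<open>auto simp: V_def intro!: imageI\<close>)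
  then have tw: "twice_diff_on V (\<lambda>x. cmap (cC (?F \<zeta>)) (?F x))"
    by (rule twice_diff_on_cong[OF _ oV]) (use D'D chart_atD(4)[OF chM[of ?p]] in \<open>auto simp: V_def\<close>)
  have rep: "(\<lambda>z. rep1 cC (?F \<zeta>) liouv z w) differentiable (at (cmap (cC (?F \<zeta>)) (?F \<zeta>)))" for w
    using liouville_rep_derivative[OF atY \<alpha>_form, of y R "fst w" "snd w"] unfolding k
    by (auto simp: differentiable_def)
  note dp = d1_pullback[OF atC D'open \<zeta>D' cF tw[unfolded V_def] liouv_linear rep]
  show "(\<lambda>x. \<theta>u z0 x w) differentiable (at \<zeta>)" by (rule dp(1))
  have "FD (\<lambda>x. \<theta>u z0 x w) \<zeta> v - FD (\<lambda>x. \<theta>u z0 x v) \<zeta> w = d1 cC liouv (y, R) (dW z0 \<zeta> v) (dW z0 \<zeta> w)"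
    using dp(2) k by simp
  also have "\<dots> = \<omega> ?p (dI (\<kappa> ?p) (dW z0 \<zeta> v)) (dI (\<kappa> ?p) (dW z0 \<zeta> w))"
    using \<omega>_collar[OF p(2), of y] k p(1) by simp
  also have "\<dots> = \<omega> ?p (dU z0 \<zeta> v) (dU z0 \<zeta> w)"
    unfolding c(4) dI_dK[OF D(3)] ..
  finally show "FD (\<lambda>x. \<theta>u z0 x w) \<zeta> v - FD (\<lambda>x. \<theta>u z0 x v) \<zeta> w = \<omega> ?p (dU z0 \<zeta> v) (dU z0 \<zeta> w)" .
qed

lemma d_\<beta>u:
  assumes "\<zeta> \<in> far_chart z0"
  shows "(\<lambda>x. \<beta>u z0 x w) differentiable (at \<zeta>)"
    "FD (\<lambda>x. \<beta>u z0 x w) \<zeta> v - FD (\<lambda>x. \<beta>u z0 x v) \<zeta> w = d1 cS \<beta> (\<psi> z0 \<zeta>) (dT z0 \<zeta> v) (dT z0 \<zeta> w)"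
proof -
  note D = far_chartD[OF assms]
  let ?z = "\<psi> z0 \<zeta>"
  have c\<psi>: "continuous_on (far_chart z0) (\<psi> z0)"
    by (rule continuous_on_subset[OF chart_atD(8)[OF chS[of z0]]]) (use far_chartD(4) in auto)
  have tw: "twice_diff_on (far_chart z0 \<inter> \<psi> z0 -` cdom (cS ?z)) (\<lambda>x. cmap (cS ?z) (\<psi> z0 x))"
    by (rule twice_diff_on_subset[OF transition_twice_diff])
      (use chart_atD(4)[OF chS[of z0]] in \<open>auto simp: far_chart_def\<close>)
  have lin: "linear (\<beta> (\<psi> z0 x))" if "x \<in> far_chart z0" for x
    using \<beta>_form far_chartD(2)[OF that] by (simp add: one_form_on_def)
  have rep: "(\<lambda>y. rep1 cS ?z \<beta> y v) differentiable (at (cmap (cS ?z) ?z))" for v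
    by (rule one_form_rep_differentiable[OF \<beta>_form]) (use chart_atD(1)[OF chS[of ?z]] D(2) in auto)
  note dp = d1_pullback[OF atS open_far_chart assms c\<psi> tw lin rep]
  show "(\<lambda>x. \<beta>u z0 x w) differentiable (at \<zeta>)" by (rule dp(1))
  show "FD (\<lambda>x. \<beta>u z0 x w) \<zeta> v - FD (\<lambda>x. \<beta>u z0 x v) \<zeta> w = d1 cS \<beta> (\<psi> z0 \<zeta>) (dT z0 \<zeta> v) (dT z0 \<zeta> w)"
    by (rule dp(2))
qed

lemma H_d\<beta>_nonpos:
  assumes "\<zeta> \<in> far_chart z0"
  shows "H (u (\<psi> z0 \<zeta>)) * d1 cS \<beta> (\<psi> z0 \<zeta>) (dT z0 \<zeta> 1) (dT z0 \<zeta> \<i>) \<le> 0"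
proof (cases "\<forall>y. f y \<ge> 0")
  case True
  note D = far_chartD[OF assms]
  obtain y R where k: "\<kappa> (u (\<psi> z0 \<zeta>)) = (y, R)" by force
  have p: "u (\<psi> z0 \<zeta>) = \<iota> (y, R)" "R > R1" using far_end_D[OF D(3)] k by auto
  have "H (u (\<psi> z0 \<zeta>)) \<ge> 0" unfolding p(1) H_collar[OF p(2)] using True p(2) R1 by simp
  moreover have "d1 cS \<beta> (\<psi> z0 \<zeta>) (dT z0 \<zeta> 1) (dT z0 \<zeta> \<i>) \<le> 0"
    using \<beta>_sub[OF D(2), of "dT z0 \<zeta> 1"] dT_complex_linear[OF assms, of 1] by simp
  ultimately show ?thesis by (rule mult_nonneg_nonpos)
next
  case False
  then have "d1 cS \<beta> (\<psi> z0 \<zeta>) (dT z0 \<zeta> 1) (dT z0 \<zeta> \<i>) = 0"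
    using sign far_chartD(2)[OF assms] by blast
  then show ?thesis by simp
qed

text \<open>Differentiating \<open>\<rho>_s = (u^*\<lambda> - H\<beta>)(\<partial>_t)\<close> and \<open>\<rho>_t = -(u^*\<lambda> - H\<beta>)(\<partial>_s)\<close>
once more, \<open>\<Delta>\<rho>\<close> becomes the value of \<open>d(u^*\<lambda>) - d(H \<circ> u) \<and> \<beta> - H(u) d\<beta>\<close> on
\<open>(\<partial>_s, \<partial>_t)\<close>.\<close>

lemma radius_subharmonic:
  shows "twice_diff_on (far_chart z0) (\<lambda>x. radius (u (\<psi> z0 x)))"
    and "\<zeta> \<in> far_chart z0 \<Longrightarrow> laplacian (\<lambda>x. radius (u (\<psi> z0 x))) \<zeta> \<ge> 0"
proof -
  let ?G = "\<lambda>x. radius (u (\<psi> z0 x))" and ?h = "\<lambda>x. H (u (\<psi> z0 x))"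
  have G1: "FD ?G x v = \<theta>u z0 x (\<i> * v) - ?h x * \<beta>u z0 x (\<i> * v)" if "x \<in> far_chart z0" for x v
    unfolding FD_eqI[OF radius_derivative[OF that]] by (rule dR_identity(1)[OF that])
  have hd: "((\<lambda>x. FD ?G x v) has_derivative (\<lambda>w. FD (\<lambda>x. \<theta>u z0 x (\<i> * v)) \<zeta> w
      - (?h \<zeta> * FD (\<lambda>x. \<beta>u z0 x (\<i> * v)) \<zeta> w + FD ?h \<zeta> w * \<beta>u z0 \<zeta> (\<i> * v)))) (at \<zeta>)"
    if \<zeta>: "\<zeta> \<in> far_chart z0" for \<zeta> v
  proof (rule has_derivative_transform_within_open[OF _ open_far_chart \<zeta>])
    show "((\<lambda>x. \<theta>u z0 x (\<i> * v) - ?h x * \<beta>u z0 x (\<i> * v)) has_derivative (\<lambda>w. FD (\<lambda>x. \<theta>u z0 x (\<i> * v)) \<zeta> w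
      - (?h \<zeta> * FD (\<lambda>x. \<beta>u z0 x (\<i> * v)) \<zeta> w + FD ?h \<zeta> w * \<beta>u z0 \<zeta> (\<i> * v)))) (at \<zeta>)"
      by (intro has_derivative_diff has_derivative_mult FD_works d_\<theta>u(1)[OF \<zeta>] d_\<beta>u(1)[OF \<zeta>] chain_rules(5)[OF \<zeta>])
  qed (simp add: G1)
  show "twice_diff_on (far_chart z0) ?G"
    unfolding twice_diff_on_def
    using radius_derivative hd by (meson differentiableI)
  show "laplacian ?G \<zeta> \<ge> 0" if \<zeta>: "\<zeta> \<in> far_chart z0"
  proof -
    have neg\<theta>: "FD (\<lambda>x. \<theta>u z0 x (- 1)) \<zeta> = (\<lambda>v. - FD (\<lambda>x. \<theta>u z0 x 1) \<zeta> v)"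
    proof -
      have "((\<lambda>x. - \<theta>u z0 x 1) has_derivative (\<lambda>v. - FD (\<lambda>x. \<theta>u z0 x 1) \<zeta> v)) (at \<zeta>)"
        by (intro has_derivative_minus FD_works d_\<theta>u(1)[OF \<zeta>])
      then have "((\<lambda>x. \<theta>u z0 x (- 1)) has_derivative (\<lambda>v. - FD (\<lambda>x. \<theta>u z0 x 1) \<zeta> v)) (at \<zeta>)"
        by (rule has_derivative_transform_within_open[OF _ open_far_chart \<zeta>])
          (simp add: linear_neg[OF dR_identity(3)] linear_neg[OF liouv_linear])
      then show ?thesis by (rule FD_eqI)
    qed
    have neg\<beta>: "FD (\<lambda>x. \<beta>u z0 x (- 1)) \<zeta> = (\<lambda>v. - FD (\<lambda>x. \<beta>u z0 x 1) \<zeta> v)"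
    proof -
      have "((\<lambda>x. - \<beta>u z0 x 1) has_derivative (\<lambda>v. - FD (\<lambda>x. \<beta>u z0 x 1) \<zeta> v)) (at \<zeta>)"
        by (intro has_derivative_minus FD_works d_\<beta>u(1)[OF \<zeta>])
      then have "((\<lambda>x. \<beta>u z0 x (- 1)) has_derivative (\<lambda>v. - FD (\<lambda>x. \<beta>u z0 x 1) \<zeta> v)) (at \<zeta>)"
        by (rule has_derivative_transform_within_open[OF _ open_far_chart \<zeta>])
          (simp add: linear_neg[OF dR_identity(4)])
      then show ?thesis by (rule FD_eqI)
    qed
    have b1: "\<beta>u z0 \<zeta> (- 1) = - \<beta>u z0 \<zeta> 1" by (rule linear_neg[OF dR_identity(4)[OF \<zeta>]])
    have "laplacian ?G \<zeta> = (FD (\<lambda>x. \<theta>u z0 x \<i>) \<zeta> 1 - FD (\<lambda>x. \<theta>u z0 x 1) \<zeta> \<i>)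
        - (FD ?h \<zeta> 1 * \<beta>u z0 \<zeta> \<i> - FD ?h \<zeta> \<i> * \<beta>u z0 \<zeta> 1)
        - ?h \<zeta> * (FD (\<lambda>x. \<beta>u z0 x \<i>) \<zeta> 1 - FD (\<lambda>x. \<beta>u z0 x 1) \<zeta> \<i>)"
      unfolding laplacian_def FD_eqI[OF hd[OF \<zeta>]]
      by (simp add: neg\<theta> neg\<beta> b1) (simp add: algebra_simps)
    also have "\<dots> = \<omega> (u (\<psi> z0 \<zeta>)) (dU z0 \<zeta> 1) (dU z0 \<zeta> \<i>)
        - (FD ?h \<zeta> 1 * \<beta>u z0 \<zeta> \<i> - FD ?h \<zeta> \<i> * \<beta>u z0 \<zeta> 1)
        - ?h \<zeta> * d1 cS \<beta> (\<psi> z0 \<zeta>) (dT z0 \<zeta> 1) (dT z0 \<zeta> \<i>)"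
      unfolding d_\<theta>u(2)[OF \<zeta>] d_\<beta>u(2)[OF \<zeta>] ..
    also have "\<dots> \<ge> 0" using dR_identity(2)[OF \<zeta>] H_d\<beta>_nonpos[OF \<zeta>] by linarith
    finally show ?thesis .
  qed
qed

end

section \<open>Punctures and the global bound\<close>

text \<open>Cylindrical coordinates are locally injective, as the period is \<open>1\<close>; invariance of domain applies in charts.\<close>

lemma cylindrical_coords_open_map:
  fixes cS :: "'r::t2_space \<Rightarrow> ('r, complex) chart"
  assumes at: "diff_atlas cS" and E: "cylindrical_coords cS P p \<sigma> E"
    and V: "open V" "V \<subseteq> half_plane \<sigma>"
  shows "open (E ` V)"
proof (subst open_subopen, intro ballI)
  fix z assume "z \<in> E ` V"
  then obtain w where w: "w \<in> V" "z = E w" by blast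
  note C = chart_atD[OF diff_atlas_chart[OF at, of z]]
  have Ec: "continuous_on (half_plane \<sigma>) E"
    and inj: "\<And>w w'. w \<in> half_plane \<sigma> \<Longrightarrow> w' \<in> half_plane \<sigma> \<Longrightarrow> E w = E w' \<longleftrightarrow> (\<exists>n::int. w' - w = of_int n * \<i>)"
    using E by (auto simp: cylindrical_coords_def)
  let ?B = "V \<inter> ball w (1/2)"
  define V' where "V' = ?B \<inter> E -` cdom (cS z)"
  have sub: "?B \<subseteq> half_plane \<sigma>" using V(2) by blast
  have V': "open V'" "V' \<subseteq> V" "w \<in> V'"
    using continuous_open_preimage[OF continuous_on_subset[OF Ec sub] _ C(2)] V(1) w C(1)
    by (auto simp: V'_def)
  have "continuous_on V' (\<lambda>x. cmap (cS z) (E x))"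
    by (rule continuous_on_compose2[OF C(7) continuous_on_subset[OF Ec]]) (use V'(2) V(2) in \<open>auto simp: V'_def\<close>)
  moreover have "inj_on (\<lambda>x. cmap (cS z) (E x)) V'"
  proof (rule inj_onI)
    fix a b assume ab: "a \<in> V'" "b \<in> V'" "cmap (cS z) (E a) = cmap (cS z) (E b)"
    then have "E a = E b" using C(4) by (metis IntE V'_def vimageE)
    moreover have "a \<in> half_plane \<sigma>" "b \<in> half_plane \<sigma>" using ab V'(2) V(2) by auto
    ultimately obtain n :: int where n: "b - a = of_int n * \<i>" using inj by blast
    have "dist a b < 1" using ab dist_triangle[of a b w] by (simp add: V'_def dist_commute)
    moreover have "dist a b = \<bar>of_int n\<bar>"
      using n by (metis dist_commute dist_norm mult.right_neutral norm_ii norm_mult norm_of_int)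
    ultimately have "n = 0" by linarith
    then show "a = b" using n by simp
  qed
  ultimately have op: "open ((\<lambda>x. cmap (cS z) (E x)) ` V')" by (rule invariance_of_domain[OF _ V'(1)])
  have "E ` V' = cdom (cS z) \<inter> cmap (cS z) -` ((\<lambda>x. cmap (cS z) (E x)) ` V')"
  proof (intro equalityI subsetI)
    fix q assume q: "q \<in> cdom (cS z) \<inter> cmap (cS z) -` ((\<lambda>x. cmap (cS z) (E x)) ` V')"
    then obtain x where x: "x \<in> V'" "cmap (cS z) q = cmap (cS z) (E x)" by blast
    have "q = cinv (cS z) (cmap (cS z) q)" using q C(4) by auto
    also have "\<dots> = E x" unfolding x(2) using x(1) C(4) by (auto simp: V'_def)
    finally have "q = E x" .
    then show "q \<in> E ` V'" using x by blast
  qed (auto simp: V'_def)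
  moreover have "open (cdom (cS z) \<inter> cmap (cS z) -` ((\<lambda>x. cmap (cS z) (E x)) ` V'))"
    by (rule continuous_open_preimage[OF C(7,2) op])
  ultimately show "\<exists>T. open T \<and> z \<in> T \<and> T \<subseteq> E ` V" using V'(2,3) w by (intro exI[of _ "E ` V'"]) auto
qed

lemma cylindrical_coords_periodic:
  assumes E: "cylindrical_coords cS P p \<sigma> E" and w: "w \<in> half_plane \<sigma>"
  shows "E (Complex (Re w) (frac (Im w))) = E w"
proof -
  have "Complex (Re w) (frac (Im w)) \<in> half_plane \<sigma>" using w by (simp add: half_plane_def)
  moreover have "w - Complex (Re w) (frac (Im w)) = of_int \<lfloor>Im w\<rfloor> * \<i>"
    by (simp add: complex_eq_iff frac_def)
  ultimately show ?thesis using E w unfolding cylindrical_coords_def by blast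
qed

text \<open>The definition of cylindrical coordinates says that the entire punctured end is a neighbourhood of
\<open>p\<close> and that \<open>E(w) \<rightarrow> p\<close>. A priori points with bounded \<open>\<sigma> Re w\<close> could still accumulate at \<open>p\<close>.
To exclude this, cut along the compact circle \<open>\<sigma> Re w = r\<close>. A small punctured disc around
\<open>p\<close> avoids the circle and is connected, so it lies in one of the two pieces; as \<open>E(w) \<rightarrow> p\<close>,
it is the outer one.\<close>

lemma puncture_neighbourhood:
  fixes cS :: "'r::t2_space \<Rightarrow> ('r, complex) chart"
  assumes at: "diff_atlas cS" and E: "cylindrical_coords cS P p \<sigma> E" and p: "p \<in> P"
  obtains N where "open N" "p \<in> N" "N - {p} \<subseteq> E ` {w. \<sigma> * Re w > s}"
proof -
  define r where "r = max s 1"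
  have r: "r > 0" "r \<ge> s" by (auto simp: r_def)
  have \<sigma>: "\<sigma> * \<sigma> = 1" and Ec: "continuous_on (half_plane \<sigma>) E"
    and inj: "\<And>w w'. w \<in> half_plane \<sigma> \<Longrightarrow> w' \<in> half_plane \<sigma> \<Longrightarrow> E w = E w' \<longleftrightarrow> (\<exists>n::int. w' - w = of_int n * \<i>)"
    and EP: "E ` half_plane \<sigma> \<subseteq> - P" and op: "open (insert p (E ` half_plane \<sigma>))"
    and lim: "(E \<longlongrightarrow> p) (filtercomap (\<lambda>w. \<sigma> * Re w) at_top)"
    using E by (auto simp: cylindrical_coords_def)
  define A where "A = E ` {w. \<sigma> * Re w > r}"
  define B where "B = E ` {w. 0 < \<sigma> * Re w \<and> \<sigma> * Re w < r}"
  define \<Gamma> where "\<Gamma> = E ` {w. \<sigma> * Re w = r}"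
  have oA: "open A" unfolding A_def
    by (rule cylindrical_coords_open_map[OF at E])
      (use r in \<open>auto simp: half_plane_def intro!: open_Collect_less continuous_intros\<close>)
  have oB: "open B" unfolding B_def
    by (rule cylindrical_coords_open_map[OF at E])
      (use r in \<open>auto simp: half_plane_def intro!: open_Collect_conj open_Collect_less continuous_intros\<close>)
  have AB: "A \<inter> B = {}"
  proof (rule ccontr)
    assume "A \<inter> B \<noteq> {}"
    then obtain w w' where w: "\<sigma> * Re w > r" "0 < \<sigma> * Re w'" "\<sigma> * Re w' < r" "E w = E w'"
      unfolding A_def B_def by blast
    then have "w \<in> half_plane \<sigma>" "w' \<in> half_plane \<sigma>" using r by (auto simp: half_plane_def)
    then obtain n :: int where "w' - w = of_int n * \<i>" using inj w(4) by blast
    then have "Re (w' - w) = 0" by simp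
    then show False using w by simp
  qed
  have "compact \<Gamma>"
  proof -
    let ?K = "(\<lambda>t. Complex (\<sigma> * r) t) ` {0..1}"
    have "\<Gamma> = E ` ?K"
    proof (intro equalityI subsetI)
      fix z assume "z \<in> \<Gamma>"
      then obtain w where w: "\<sigma> * Re w = r" "z = E w" unfolding \<Gamma>_def by blast
      then have "Re w = \<sigma> * r" using \<sigma> by (metis mult.assoc mult_1)
      moreover have "E (Complex (Re w) (frac (Im w))) = z"
        using cylindrical_coords_periodic[OF E, of w] w r by (simp add: half_plane_def)
      moreover have "frac (Im w) \<in> {0..1}" using frac_lt_1[of "Im w"] by (simp add: less_imp_le)
      ultimately show "z \<in> E ` ?K" by (metis imageI)
    next
      fix z assume "z \<in> E ` ?K"
      then show "z \<in> \<Gamma>" using \<sigma> by (auto simp: \<Gamma>_def mult.assoc[symmetric] intro!: imageI)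
    qed
    moreover have "continuous_on ?K E"
      by (rule continuous_on_subset[OF Ec]) (use \<sigma> r in \<open>auto simp: half_plane_def mult.assoc[symmetric]\<close>)
    moreover have "compact ?K" by (intro compact_continuous_image continuous_intros compact_Icc)
    ultimately show ?thesis using compact_continuous_image by metis
  qed
  then have c\<Gamma>: "closed \<Gamma>" by (rule compact_imp_closed)
  have p\<Gamma>: "p \<notin> \<Gamma>" using EP p r by (auto simp: \<Gamma>_def half_plane_def)
  define N0 where "N0 = insert p (E ` half_plane \<sigma>) - \<Gamma>"
  have N0: "open N0" "p \<in> N0" using op c\<Gamma> p\<Gamma> by (auto simp: N0_def)
  have N0sub: "N0 - {p} \<subseteq> A \<union> B"
  proof
    fix z assume z: "z \<in> N0 - {p}"
    then obtain w where w: "w \<in> half_plane \<sigma>" "z = E w" by (auto simp: N0_def)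
    moreover have "\<sigma> * Re w \<noteq> r" using z w by (auto simp: N0_def \<Gamma>_def)
    ultimately consider "\<sigma> * Re w > r" | "0 < \<sigma> * Re w" "\<sigma> * Re w < r"
      by (fastforce simp: half_plane_def)
    then show "z \<in> A \<union> B" using w(2) by cases (auto simp: A_def B_def)
  qed
  have ch: "chart_at p (cS p)" by (rule diff_atlas_chart[OF at])
  note C = chart_atD[OF ch]
  obtain e where e: "e > 0" "ball (cmap (cS p) p) e \<subseteq> cmap (cS p) ` (cdom (cS p) \<inter> N0)"
  proof -
    have "cmap (cS p) p \<in> cmap (cS p) ` (cdom (cS p) \<inter> N0)" using C(1) N0(2) by (intro imageI IntI)
    from openE[OF open_chart_image[OF ch N0(1)] this] that show ?thesis by metis
  qed
  define b where "b = ball (cmap (cS p) p) e"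
  define N where "N = cdom (cS p) \<inter> cmap (cS p) -` b"
  have N: "open N" "p \<in> N" using continuous_open_preimage[OF C(7,2) open_ball] C(1) e by (auto simp: N_def b_def)
  have NN0: "N \<subseteq> N0"
  proof
    fix z assume z: "z \<in> N"
    then have "cmap (cS p) z \<in> cmap (cS p) ` (cdom (cS p) \<inter> N0)" using e(2) unfolding N_def b_def by blast
    then obtain z' where z': "z' \<in> cdom (cS p)" "z' \<in> N0" "cmap (cS p) z = cmap (cS p) z'" by blast
    have "z = cinv (cS p) (cmap (cS p) z)" using z C(4) by (auto simp: N_def)
    also have "\<dots> = z'" unfolding z'(3) using z'(1) by (rule C(4))
    finally show "z \<in> N0" using z'(2) by simp
  qed
  have Neq: "N - {p} = cinv (cS p) ` (b - {cmap (cS p) p})"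
  proof (intro equalityI subsetI)
    fix z assume z: "z \<in> N - {p}"
    then have "cmap (cS p) z \<noteq> cmap (cS p) p" using C(1,4) by (metis DiffD1 DiffD2 IntE N_def singletonI)
    then show "z \<in> cinv (cS p) ` (b - {cmap (cS p) p})"
      using z C(4)[of z] by (intro image_eqI[of _ _ "cmap (cS p) z"]) (auto simp: N_def)
  next
    fix z assume "z \<in> cinv (cS p) ` (b - {cmap (cS p) p})"
    then obtain x where x: "x \<in> b" "x \<noteq> cmap (cS p) p" "z = cinv (cS p) x" by blast
    then have "x \<in> cmap (cS p) ` cdom (cS p)" using e(2) unfolding b_def by blast
    then have "z \<in> cdom (cS p)" "cmap (cS p) z = x" using C(5,6) x(3) by metis+
    then show "z \<in> N - {p}" using x(1,2) by (auto simp: N_def)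
  qed
  have "connected (b - {cmap (cS p) p})"
    unfolding b_def by (rule connected_punctured_ball) simp
  moreover have "continuous_on (b - {cmap (cS p) p}) (cinv (cS p))"
    by (rule continuous_on_subset[OF C(8)]) (use e(2) in \<open>unfold b_def, blast\<close>)
  ultimately have conn: "connected (N - {p})" unfolding Neq by (intro connected_continuous_image)
  obtain w where w: "\<sigma> * Re w > r" "E w \<in> N"
  proof -
    have "eventually (\<lambda>w. E w \<in> N) (filtercomap (\<lambda>w. \<sigma> * Re w) at_top)"
      using topological_tendstoD[OF lim N] .
    then obtain X where X: "\<And>w. \<sigma> * Re w \<ge> X \<Longrightarrow> E w \<in> N"
      unfolding eventually_filtercomap_at_top_linorder by blast
    define w0 where "w0 = complex_of_real (\<sigma> * max X (r + 1))"
    have "\<sigma> * Re w0 = max X (r + 1)" using \<sigma> unfolding w0_def Re_complex_of_real by (metis mult.assoc mult_1)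
    then show ?thesis using that[of w0] X[of w0] by simp
  qed
  have "E w \<noteq> p" using EP p w r by (force simp: half_plane_def)
  then have "A \<inter> (N - {p}) \<noteq> {}" using w by (auto simp: A_def)
  moreover have "A \<inter> B \<inter> (N - {p}) = {}" using AB by blast
  moreover have "N - {p} \<subseteq> A \<union> B" using N0sub NN0 by blast
  ultimately have "B \<inter> (N - {p}) = {}" using connectedD[OF conn oA oB] by blast
  then have "N - {p} \<subseteq> A" using N0sub NN0 by blast
  also have "A \<subseteq> E ` {w. \<sigma> * Re w > s}" using r by (auto simp: A_def)
  finally show ?thesis using that N by blast
qed

text \<open>Compactness of a period in \<open>t\<close> makes the convergence uniform.\<close>

lemma uniform_end_bound:
  fixes g :: "'m::topological_space \<Rightarrow> real"
  assumes E: "cylindrical_coords cS P p \<sigma> E"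
    and lim: "\<And>t0. ((\<lambda>(s, t). u (E (Complex (\<sigma> * s) t))) \<longlongrightarrow> x t0) (at_top \<times>\<^sub>F nhds t0)"
    and g: "continuous_on UNIV g" and lt: "\<And>t. g (x t) < m"
  obtains s where "\<And>w. \<sigma> * Re w > s \<Longrightarrow> g (u (E w)) < m"
proof -
  have op: "open {q. g q < m}"
    using continuous_open_preimage[OF g open_UNIV open_lessThan[of m]] by (simp add: vimage_def)
  have "\<exists>S V. open V \<and> t0 \<in> V \<and> (\<forall>s\<ge>S. \<forall>t\<in>V. g (u (E (Complex (\<sigma> * s) t))) < m)" for t0
  proof -
    have "eventually (\<lambda>z. (case z of (s, t) \<Rightarrow> u (E (Complex (\<sigma> * s) t))) \<in> {q. g q < m}) (at_top \<times>\<^sub>F nhds t0)"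
      by (rule topological_tendstoD[OF lim op]) (simp add: lt)
    then obtain Pf Pg where P: "eventually Pf at_top" "eventually Pg (nhds t0)"
      "\<And>s t. Pf s \<Longrightarrow> Pg t \<Longrightarrow> g (u (E (Complex (\<sigma> * s) t))) < m"
      unfolding eventually_prod_filter by auto
    obtain S where "\<And>s. s \<ge> S \<Longrightarrow> Pf s" using P(1) unfolding eventually_at_top_linorder by blast
    moreover obtain V where "open V" "t0 \<in> V" "\<And>t. t \<in> V \<Longrightarrow> Pg t" using P(2) unfolding eventually_nhds by blast
    ultimately show ?thesis using P(3) by blast
  qed
  then obtain S V where SV: "\<And>t0. open (V t0)" "\<And>t0. t0 \<in> V t0"
    "\<And>t0 s t. s \<ge> S t0 \<Longrightarrow> t \<in> V t0 \<Longrightarrow> g (u (E (Complex (\<sigma> * s) t))) < m" by metis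
  obtain T where T: "T \<subseteq> {0..1::real}" "finite T" "{0..1} \<subseteq> (\<Union>t\<in>T. V t)"
    using compactE_image[of "{0..1::real}" "{0..1}" V] SV(1,2) by blast
  define s0 where "s0 = Max (insert 0 (S ` T))"
  have s0: "s0 \<ge> 0" "\<And>t. t \<in> T \<Longrightarrow> S t \<le> s0" using T(2) by (auto simp: s0_def)
  have \<sigma>: "\<sigma> * \<sigma> = 1" using E by (auto simp: cylindrical_coords_def)
  have "g (u (E w)) < m" if w: "\<sigma> * Re w > s0" for w
  proof -
    have fr: "frac (Im w) \<in> {0..1}" using frac_lt_1[of "Im w"] by (simp add: less_imp_le)
    then obtain t where t: "t \<in> T" "frac (Im w) \<in> V t" using T(3) by blast
    have "E w = E (Complex (\<sigma> * (\<sigma> * Re w)) (frac (Im w)))"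
      using cylindrical_coords_periodic[OF E, of w] w s0(1) \<sigma> by (simp add: half_plane_def mult.assoc[symmetric])
    then show ?thesis using SV(3)[of t "\<sigma> * Re w" "frac (Im w)"] t s0(2)[OF t(1)] w by simp
  qed
  then show ?thesis using that by blast
qed

context floer_curve begin

lemma radius_max_is_open:
  assumes z0: "z0 \<notin> P" "radius (u z0) > R1"
    and max: "\<And>z. z \<notin> P \<Longrightarrow> radius (u z) \<le> radius (u z0)"
  obtains N where "open N" "z0 \<in> N" "\<And>z. z \<in> N \<Longrightarrow> z \<notin> P \<and> radius (u z) = radius (u z0)"
proof -
  note C = chart_atD[OF chS[of z0]]
  define c where "c = cmap (cS z0) z0"
  let ?G = "\<lambda>x. radius (u (\<psi> z0 x))"
  have c: "c \<in> far_chart z0" unfolding c_def far_chart_def using z0 C(1) by (auto simp: far_end_def)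
  obtain e where e: "e > 0" "ball c e \<subseteq> far_chart z0" using openE[OF open_far_chart c] by blast
  have G: "?G q = radius (u z0)" if "q \<in> ball c (e/2)" for q
  proof (rule strong_maximum_principle[OF _ _ _ _ that])
    show "twice_diff_on (ball c e) ?G" by (rule twice_diff_on_subset[OF radius_subharmonic(1) e(2)])
    show "laplacian ?G x \<ge> 0" if "x \<in> ball c e" for x using radius_subharmonic(2) e(2) that by blast
    show "?G x \<le> radius (u z0)" if "x \<in> ball c e" for x using max far_chartD(2) e(2) that by blast
    show "?G c = radius (u z0)" using C(1,4) by (simp add: c_def)
  qed
  define N where "N = cdom (cS z0) \<inter> cmap (cS z0) -` ball c (e/2)"
  show ?thesis
  proof
    show "open N" unfolding N_def by (rule continuous_open_preimage[OF C(7,2) open_ball])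
    show "z0 \<in> N" using C(1) e(1) by (simp add: N_def c_def)
    fix z assume z: "z \<in> N"
    then have q: "cmap (cS z0) z \<in> ball c (e/2)" "\<psi> z0 (cmap (cS z0) z) = z" using C(4) by (auto simp: N_def)
    moreover have "cmap (cS z0) z \<in> far_chart z0" using q(1) e by (intro subsetD[OF e(2)]) auto
    ultimately show "z \<notin> P \<and> radius (u z) = radius (u z0)" using G[OF q(1)] far_chartD(2) by metis
  qed
qed

text \<open>If the bound fails, the radius attains a maximum above \<open>B\<close>. The set \<open>L\<close> of maximum points is open and
closed in the connected compact surface and misses the punctures, of which there is at least one.\<close>

lemma radius_bound:
  assumes S: "punctured_riemann_surface cS P \<sigma> E"
    and asy: "asymptotic_orbits cM \<omega> H P \<sigma> E k u x"
    and C: "\<And>p t. p \<in> P \<Longrightarrow> radius (x p t) \<le> B" and B: "B \<ge> R1" and z: "z1 \<notin> P"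
  shows "radius (u z1) \<le> B"
proof (rule ccontr)
  assume "\<not> radius (u z1) \<le> B"
  define m where "m = radius (u z1)"
  have m: "m > B" using \<open>\<not> radius (u z1) \<le> B\<close> by (simp add: m_def)
  let ?g = "\<lambda>z. radius (u z)"
  have cpt: "compact (UNIV :: 'r set)" and conn: "connected (UNIV :: 'r set)" and P0: "P \<noteq> {}"
    and cyl: "\<And>p. p \<in> P \<Longrightarrow> cylindrical_coords cS P p (\<sigma> p) (E p)"
    using S by (auto simp: punctured_riemann_surface_def)
  have gc: "continuous_on (- P) ?g" by (rule continuous_on_compose2[OF radius_continuous u_cont]) simp
  \<comment> \<open>closed also in the compact surface, as it stays away from the punctures\<close>
  define K where "K = {z \<in> - P. ?g z \<ge> m}"
  have "open (- K)"
  proof (subst open_subopen, intro ballI)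
    fix z assume z: "z \<in> - K"
    show "\<exists>T. open T \<and> z \<in> T \<and> T \<subseteq> - K"
    proof (cases "z \<in> P")
      case False
      have "open (- P \<inter> ?g -` {..<m})" by (rule continuous_open_preimage[OF gc P_open open_lessThan])
      then show ?thesis using z False by (intro exI[of _ "- P \<inter> ?g -` {..<m}"]) (auto simp: K_def)
    next
      case True
      note cyl' = cyl[OF True]
      obtain s where s: "\<And>w. \<sigma> z * Re w > s \<Longrightarrow> ?g (E z w) < m"
      proof -
        have lim: "((\<lambda>(s, t). u (E z (Complex (\<sigma> z * s) t))) \<longlongrightarrow> x z t0) (at_top \<times>\<^sub>F nhds t0)" for t0
          using asy True by (simp add: asymptotic_orbits_def)
        have lt: "radius (x z t) < m" for t using C[OF True, of t] m by simp
        show ?thesis using uniform_end_bound[OF cyl' lim radius_continuous lt] that by blast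
      qed
      obtain N where N: "open N" "z \<in> N" "N - {z} \<subseteq> E z ` {w. \<sigma> z * Re w > s}"
        by (rule puncture_neighbourhood[OF atS cyl' True])
      have "N \<subseteq> - K"
      proof
        fix y assume "y \<in> N"
        then consider "y = z" | w where "y = E z w" "\<sigma> z * Re w > s" using N(3) by blast
        then show "y \<in> - K" using s True by cases (fastforce simp: K_def)+
      qed
      then show ?thesis using N by blast
    qed
  qed
  then have K: "compact K" using closed_Int_compact[OF _ cpt, of K] by (simp add: closed_def)
  have Kc: "continuous_on K ?g" by (rule continuous_on_subset[OF gc]) (auto simp: K_def)
  have "z1 \<in> K" using z by (simp add: K_def m_def)
  then obtain z0 where z0: "z0 \<in> K" "\<And>z. z \<in> K \<Longrightarrow> ?g z \<le> ?g z0"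
    using continuous_attains_sup[OF K _ Kc] by blast
  have max: "?g z \<le> ?g z0" if "z \<notin> P" for z
    using z0 that by (cases "z \<in> K") (auto simp: K_def intro: order_trans)
  define L where "L = {z \<in> - P. ?g z = ?g z0}"
  have "open L"
  proof (subst open_subopen, intro ballI)
    fix z assume z: "z \<in> L"
    then have "z \<notin> P" "?g z > R1" using z0(1) m B by (auto simp: L_def K_def)
    moreover have gz: "?g z = ?g z0" using z by (simp add: L_def)
    then have "?g y \<le> ?g z" if "y \<notin> P" for y using max[OF that] by simp
    ultimately obtain N where N: "open N" "z \<in> N" "\<And>y. y \<in> N \<Longrightarrow> y \<notin> P \<and> ?g y = ?g z"
      using radius_max_is_open[of z] by blast
    have "N \<subseteq> L" using N(3) unfolding L_def gz by blast
    then show "\<exists>T. open T \<and> z \<in> T \<and> T \<subseteq> L" using N(1,2) by blast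
  qed
  moreover have "closed L"
  proof -
    have "L = {z \<in> K. ?g z = ?g z0}" using z0(1) by (auto simp: L_def K_def)
    then show ?thesis using continuous_closed_preimage_constant[OF Kc compact_imp_closed[OF K]] by simp
  qed
  moreover have "z0 \<in> L" using z0(1) by (auto simp: L_def K_def)
  ultimately have "L = UNIV"
    using connectedD[OF conn, of L "- L"] by (auto simp: closed_def)
  then show False using P0 by (auto simp: L_def)
qed

end

theorem lemma1p3:
  fixes cM :: "'m::{t2_space,second_countable_topology} \<Rightarrow> ('m, 'e::euclidean_space) chart"
    and \<omega> :: "'m \<Rightarrow> 'e \<Rightarrow> 'e \<Rightarrow> real"
    and cY :: "'y::{t2_space,second_countable_topology} \<Rightarrow> ('y, 'f::euclidean_space) chart"
    and \<alpha> :: "'y \<Rightarrow> 'f \<Rightarrow> real"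
    and M0 :: "'m set" and \<kappa> :: "'m \<Rightarrow> 'y \<times> real" and \<iota> :: "'y \<times> real \<Rightarrow> 'm"
    and H :: "'m \<Rightarrow> real" and f :: "'y \<Rightarrow> real" and J :: "'m \<Rightarrow> 'e \<Rightarrow> 'e"
  assumes "conical_at_infinity cM \<omega> cY \<alpha> M0 \<kappa> \<iota>"
    and "msmooth_open cM euclid UNIV H"
    and "\<exists>R0\<ge>1. \<forall>y. \<forall>R>R0. H (\<iota> (y, R)) = f y * R"
    and "\<forall>y. mderiv cY euclid f y (reeb cY \<alpha> y) = 0"
    and "compatible_acs cM \<omega> J"
    and "contact_type_at_infinity cM cY \<alpha> \<iota> J"
  shows "\<exists>B :: real \<Rightarrow> real.
    \<forall>(cS :: 'r::{t2_space,second_countable_topology} \<Rightarrow> ('r, complex) chart) P \<sigma> E k \<beta> u x C.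
      punctured_riemann_surface cS P \<sigma> E \<and>
      floer_one_form cS P \<sigma> E k \<beta> \<and>
      ((\<forall>y. f y \<ge> 0) \<or> (\<forall>z\<in>- P. \<forall>v w. d1 cS \<beta> z v w = 0)) \<and>
      floer_solution cM \<omega> H J cS P \<beta> u \<and>
      asymptotic_orbits cM \<omega> H P \<sigma> E k u x \<and>
      (\<forall>p\<in>P. \<forall>t. x p t \<notin> M0 \<longrightarrow> snd (\<kappa> (x p t)) \<le> C) \<longrightarrow>
      (\<forall>z\<in>- P. u z \<notin> M0 \<longrightarrow> snd (\<kappa> (u z)) \<le> B C)"
proof -
  obtain R0 where R0: "R0 \<ge> 1" "\<And>y R. R > R0 \<Longrightarrow> H (\<iota> (y, R)) = f y * R"
    using assms(3) by blast
  obtain R0' where R0': "R0' \<ge> 1" "\<And>y R. R > R0' \<Longrightarrow>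
        J (\<iota> (y, R)) (mderiv (collar_atlas cY) cM \<iota> (y, R) (0, R))
        = mderiv (collar_atlas cY) cM \<iota> (y, R) (reeb cY \<alpha> y, 0)"
    using assms(6) unfolding contact_type_at_infinity_def by blast
  define R1 where "R1 = max R0 R0'"
  interpret hamiltonian_end cM \<omega> cY \<alpha> M0 \<kappa> \<iota> H f J R1
  proof unfold_locales
    show "R1 \<ge> 1" using R0(1) by (simp add: R1_def)
  qed (use assms R0(2) R0'(2) in \<open>auto simp: R1_def\<close>)
  show ?thesis
  proof (intro exI[of _ "\<lambda>C. max R1 C"] allI impI ballI; elim conjE)
    fix cS :: "'r \<Rightarrow> ('r, complex) chart" and P \<sigma> E k \<beta> u x C z
    assume S: "punctured_riemann_surface cS P \<sigma> E" and \<beta>: "floer_one_form cS P \<sigma> E k \<beta>"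
      and sign: "(\<forall>y. f y \<ge> 0) \<or> (\<forall>z\<in>- P. \<forall>v w. d1 cS \<beta> z v w = 0)"
      and fl: "floer_solution cM \<omega> H J cS P \<beta> u"
      and asy: "asymptotic_orbits cM \<omega> H P \<sigma> E k u x"
      and C: "\<forall>p\<in>P. \<forall>t. x p t \<notin> M0 \<longrightarrow> snd (\<kappa> (x p t)) \<le> C"
      and z: "z \<in> - P" "u z \<notin> M0"
    interpret floer_curve cM \<omega> cY \<alpha> M0 \<kappa> \<iota> H f J R1 cS P \<beta> u
      by unfold_locales (use S \<beta> sign fl in \<open>auto simp: punctured_riemann_surface_def floer_one_form_def\<close>)
    have "radius (x p t) \<le> max R1 C" if "p \<in> P" for p t
      using C that R1 by (auto simp: radius_def max.coboundedI2)
    from radius_bound[OF S asy this, of z] show "snd (\<kappa> (u z)) \<le> max R1 C"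
      using z by (simp add: radius_def)
  qed
qed

end
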